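(* Let $\Lambda,\lambda,y_1>0$, $\ell\in\mathbb R\setminus\{0\}$ and $\alpha\in\mathbb R$ with $\alpha<-1$. Let $g:(0,\infty)\to\mathbb R$ be of class $\mathcal C^2$ and assume that $|g'(y)|\ge\lambda$ and $|g''(y)|\ge\lambda y^{\alpha}$ for any $y\ge y_1$. (1) If $s\in\mathbb R$ satisfies $\frac{\alpha-1}2<s<-2$ or $\frac{\alpha-1}2>s>-2$, there exists $C>0$ such that for any $t\in\mathbb R\setminus\{0\}$ and any $\delta>0$, $$\sum_{2^k\ge2y_1}\sup_{x\in\mathbb R^2}|I^{s}_{t,x,k}|\le C\,\frac{\delta^{-\frac{(\alpha+1)(s+2)}{\alpha+3}}}{|t|^{\frac{2(s+2)}{\alpha+3}}},\qquad \sup_{x\in\mathbb R^2}\Big|\int_{\mathbb R^2}e^{ix\cdot\xi}e^{i\frac t\delta g(\delta|\xi|)}\sum_{2^k\ge2y_1}Q_k(\delta|\xi|)|\xi|^{s}d\xi\Big|\le C\,\frac{\delta^{-\frac{(\alpha+1)(s+2)}{\alpha+3}}}{|t|^{\frac{2(s+2)}{\alpha+3}}}.$$ (2) If furthermore $\alpha\ne-2$ and $\lambda y^{\alpha+1}\le|g'(y)-\ell|\le\Lambda y^{\alpha+1}$ for any $y\ge y_1$, there exists $C>0$ such that for any $t\in\mathbb R\setminus\{0\}$ and any $\delta>0$, $$\sup_{x\in\mathbb R^2}\ \sum_{2^k\ge2y_1}\big|I^{\frac{\alpha-1}2}_{t,x,k}\big|\le C\,\frac{\delta^{-\frac{\alpha+1}2}}{|t|},\qquad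 \sup_{x\in\mathbb R^2}\Big|\int_{\mathbb R^2}e^{ix\cdot\xi}e^{i\frac t\delta g(\delta|\xi|)}\sum_{2^k\ge2y_1}Q_k(\delta|\xi|)|\xi|^{\frac{\alpha-1}2}d\xi\Big|\le C\,\frac{\delta^{-\frac{\alpha+1}2}}{|t|}.$$
   Context: Dimension $n=2$. Sums over $2^k\ge 2y_1$ are over all $k\in\mathbb Z$ with $2^k\ge2y_1$. $P$ is a fixed smooth even function on $\mathbb R$ supported in $[-2,-\tfrac12]\cup[\tfrac12,2]$, and for $t\in\mathbb R$, $x\in\mathbb R^2$, $s\in\mathbb R$, $k\in\mathbb Z$, $\delta>0$, $$I^{s}_{t,x,k}:=\int_{\mathbb R^2}e^{ix\cdot\xi}e^{i\frac t\delta g(\delta|\xi|)}P\big(\tfrac{\delta|\xi|}{2^k}\big)|\xi|^{s}\,d\xi.$$ Littlewood-Paley functions: $\varphi_0$ is a fixed smooth nonnegative even function supported in $[-\tfrac45,\tfrac45]$, equal to $1$ on $[-\tfrac35,\tfrac35]$ and nonincreasing on $[0,\infty)$; $Q_j(y):=\varphi_0(2^{-j-1}y)-\varphi_0(2^{-j}y)$. When the integral containing $\sum_kQ_k$ is not absolutely convergent it is understood as the sum over $k$ of the integrals with $Q_k$. Constants $C$ do not depend on $t,\delta,x$. *)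

theory Defs
  imports "HOL-Analysis.Analysis"
begin

definition smooth_real :: "(real \<Rightarrow> real) \<Rightarrow> bool" where
  "smooth_real f \<longleftrightarrow> (\<forall>n y. (deriv ^^ n) f field_differentiable at y)"

(* Intended for open S. *)
definition C2_on :: "real set \<Rightarrow> (real \<Rightarrow> real) \<Rightarrow> bool" where
  "C2_on S f \<longleftrightarrow>
     (\<forall>y\<in>S. f field_differentiable at y) \<and>
     (\<forall>y\<in>S. deriv f field_differentiable at y) \<and>
     continuous_on S (deriv (deriv f))"

definition dyadic_range :: "real \<Rightarrow> int set" where
  "dyadic_range y\<^sub>1 = {k. 2 powi k \<ge> 2 * y\<^sub>1}"

definition LP_Q :: "(real \<Rightarrow> real) \<Rightarrow> int \<Rightarrow> real \<Rightarrow> real" where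
  "LP_Q \<phi>\<^sub>0 j y = \<phi>\<^sub>0 (2 powi (- j - 1) * y) - \<phi>\<^sub>0 (2 powi (- j) * y)"

(* The value at \<xi> = 0, where 0 powr s = 0 and g is evaluated outside its domain, is
   irrelevant: it concerns a null set, and all amplitudes a used below vanish at 0. *)
definition osc_integrand ::
  "(real \<Rightarrow> real) \<Rightarrow> (real \<Rightarrow> real) \<Rightarrow> real \<Rightarrow> real \<Rightarrow> real \<Rightarrow> real^2 \<Rightarrow> real^2 \<Rightarrow> complex" where
  "osc_integrand g a s t \<delta> x \<xi> =
     exp (\<i> * of_real (x \<bullet> \<xi>)) * exp (\<i> * of_real (t / \<delta> * g (\<delta> * norm \<xi>)))
       * of_real (a (\<delta> * norm \<xi>)) * of_real (norm \<xi> powr s)"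

definition osc_I ::
  "(real \<Rightarrow> real) \<Rightarrow> (real \<Rightarrow> real) \<Rightarrow> real \<Rightarrow> real \<Rightarrow> real \<Rightarrow> real^2 \<Rightarrow> int \<Rightarrow> complex" where
  "osc_I g P s t \<delta> x k =
     (LINT \<xi>|lborel. osc_integrand g (\<lambda>y. P (y / 2 powi k)) s t \<delta> x \<xi>)"

definition LP_integrand ::
  "(real \<Rightarrow> real) \<Rightarrow> (real \<Rightarrow> real) \<Rightarrow> real \<Rightarrow> real \<Rightarrow> real \<Rightarrow> real \<Rightarrow> real^2 \<Rightarrow> real^2 \<Rightarrow> complex" where
  "LP_integrand g \<phi>\<^sub>0 y\<^sub>1 s t \<delta> x =
     osc_integrand g (\<lambda>y. \<Sum>\<^sub>\<infinity>k\<in>dyadic_range y\<^sub>1. LP_Q \<phi>\<^sub>0 k y) s t \<delta> x"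

definition LP_piece ::
  "(real \<Rightarrow> real) \<Rightarrow> (real \<Rightarrow> real) \<Rightarrow> real \<Rightarrow> real \<Rightarrow> real \<Rightarrow> real^2 \<Rightarrow> int \<Rightarrow> complex" where
  "LP_piece g \<phi>\<^sub>0 s t \<delta> x k = (LINT \<xi>|lborel. osc_integrand g (LP_Q \<phi>\<^sub>0 k) s t \<delta> x \<xi>)"

(* The integral with the summed amplitude is a Lebesgue integral when it converges
   absolutely, and otherwise the sum over k of the integrals with LP_Q k. Since LINT and
   infsum are total, the predicate LP_converges says that the value is not a default one. *)
definition LP_converges ::
  "(real \<Rightarrow> real) \<Rightarrow> (real \<Rightarrow> real) \<Rightarrow> real \<Rightarrow> real \<Rightarrow> real \<Rightarrow> real \<Rightarrow> real^2 \<Rightarrow> bool" where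
  "LP_converges g \<phi>\<^sub>0 y\<^sub>1 s t \<delta> x \<longleftrightarrow>
     integrable lborel (LP_integrand g \<phi>\<^sub>0 y\<^sub>1 s t \<delta> x) \<or>
     LP_piece g \<phi>\<^sub>0 s t \<delta> x summable_on dyadic_range y\<^sub>1"

definition LP_integral ::
  "(real \<Rightarrow> real) \<Rightarrow> (real \<Rightarrow> real) \<Rightarrow> real \<Rightarrow> real \<Rightarrow> real \<Rightarrow> real \<Rightarrow> real^2 \<Rightarrow> complex" where
  "LP_integral g \<phi>\<^sub>0 y\<^sub>1 s t \<delta> x =
     (if integrable lborel (LP_integrand g \<phi>\<^sub>0 y\<^sub>1 s t \<delta> x)
      then LINT \<xi>|lborel. LP_integrand g \<phi>\<^sub>0 y\<^sub>1 s t \<delta> x \<xi>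
      else \<Sum>\<^sub>\<infinity>k\<in>dyadic_range y\<^sub>1. LP_piece g \<phi>\<^sub>0 s t \<delta> x k)"

end

(* After rescaling by delta, polar coordinates turn each dyadic piece into a one-dimensional integral
   of exp(i tau g(r)) against a bump on [R/2, 2R], R = 2^k, times the Bessel function J_0(r X), where
   tau = t/delta and X = |x|/delta. The energy u (|J|^2 + |J' + J/(2u)|^2) of the Bessel equation stays
   bounded, so J_0(u) = e^{iu} H_+(u) + e^{-iu} H_-(u) with |H| <= C u^{-1/2} and |H'| <= C u^{-3/2}.
   Van der Corput's lemma for the phases tau g(r) +- X r then gives, besides the trivial bound R^{s+2},
   the bound R^{s-(alpha-1)/2} / |tau|: if X is small compared with tau there is no stationary point
   because |g'| >= lam, and otherwise the second derivative test combines with the decay of J_0.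
   Part (1) is a geometric sum of the minimum of the two bounds. At the critical exponent the second
   bound does not depend on k, but g' - l has size R^{alpha+1}, so for fixed x and tau the phase is
   nearly stationary only when R^{alpha+1} is comparable with |l +- X/tau|; for the other k the first
   derivative test gains a power of |tau| R^{alpha+2}, which sums because alpha is not -2. *)

theory Submission
  imports Defs
begin

section \<open>Geometric sums over dyadic scales\<close>

text \<open>Since g is only C^2, each oscillatory gain has to come from one integration by parts in
  r: monotonicity of g' (g'' never changes sign on the range used) replaces any control of a third
  derivative. Pure phase integrals are therefore bounded on all initial segments [R/2, r0] first,
  and the amplitude is restored afterwards at a cost that scales with R exactly as its size does.
  The factor 1/|tau| in the second bound consists of two halves: |tau|^(-1/2) from the second
  derivative test, and |tau|^(-1/2) from the Bessel decay, available when X is at least of order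
  |tau|. The exponents s + 2 and s - (\<alpha> - 1)/2 of the two bounds have opposite signs exactly
  under the hypothesis of (1); the scale at which the bounds cross produces the powers of t and
  \<delta>. Neither bound sees x, so the supremum may stand inside the sum. At the critical exponent
  the second bound is constant in R, and the resonant scale moves with |x|/t; the sum is then
  controlled for each fixed x, which is why the supremum in (2) stands outside.\<close>

lemma sum_power_abs_int_le:
  fixes q :: real and F :: "int set"
  assumes q: "0 < q" "q < 1" and F: "finite F"
  shows "(\<Sum>j\<in>F. q ^ nat \<bar>j\<bar>) \<le> 2 / (1 - q)"
proof -
  have half: "(\<Sum>j\<in>G. q ^ nat \<bar>j\<bar>) \<le> 1 / (1 - q)"
    if G: "finite G" and inj: "inj_on (\<lambda>j. nat \<bar>j\<bar>) G" for G :: "int set"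
  proof -
    have "(\<Sum>j\<in>G. q ^ nat \<bar>j\<bar>) = (\<Sum>n\<in>(\<lambda>j. nat \<bar>j\<bar>) ` G. q ^ n)"
      using inj by (simp add: sum.reindex)
    also have "\<dots> \<le> (\<Sum>n. q ^ n)"
      using q G by (intro sum_le_suminf summable_geometric) auto
    also have "\<dots> = 1 / (1 - q)"
      using q by (intro suminf_geometric) auto
    finally show ?thesis .
  qed
  have "F = {j\<in>F. j \<ge> 0} \<union> {j\<in>F. j < 0}"
    by auto
  then have "(\<Sum>j\<in>F. q ^ nat \<bar>j\<bar>)
      = (\<Sum>j\<in>{j\<in>F. j \<ge> 0}. q ^ nat \<bar>j\<bar>) + (\<Sum>j\<in>{j\<in>F. j < 0}. q ^ nat \<bar>j\<bar>)"
    using F by (metis (no_types, lifting) disjoint_iff finite_Un linorder_not_le mem_Collect_eq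
        sum.union_disjoint)
  also have "\<dots> \<le> 1 / (1 - q) + 1 / (1 - q)"
    using F by (intro add_mono half) (auto simp: inj_on_def)
  finally show ?thesis
    by simp
qed

text \<open>As functions of x the two exponentials cross at \<open>log 2 (A / B) / (b - a)\<close>,
  and the product of powers of A and B is their common value there. Because a and b have opposite
  signs, on either side of the crossing one of the two decays, at rate at least
  \<open>min \<bar>a\<bar> \<bar>b\<bar>\<close>.\<close>

lemma min_powr_le:
  fixes a b A B x :: real
  assumes ab: "a * b < 0" and AB: "A > 0" "B > 0"
  shows "min (A * 2 powr (x * a)) (B * 2 powr (x * b))
      \<le> A powr (b / (b - a)) * B powr (- a / (b - a))
          * 2 powr (- (min \<bar>a\<bar> \<bar>b\<bar> * \<bar>x - log 2 (A / B) / (b - a)\<bar>))"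
proof -
  define L where "L = log 2 (A / B) / (b - a)"
  have ne: "b - a \<noteq> 0"
    using ab by (auto simp: mult_less_0_iff)
  define M where "M = A powr (b / (b - a)) * B powr (- a / (b - a))"
  have AB2: "A = 2 powr (log 2 A)" "B = 2 powr (log 2 B)"
    using AB by auto
  have L: "L * (b - a) = log 2 A - log 2 B"
    using ne AB by (simp add: L_def log_divide)
  have M: "M = 2 powr (log 2 A * (b / (b - a)) + log 2 B * (- a / (b - a)))"
    unfolding M_def by (subst AB2(1), subst AB2(2)) (simp only: powr_powr powr_add)
  have e: "log 2 A * (b / (b - a)) + log 2 B * (- a / (b - a)) = log 2 A + L * a"
    "log 2 A * (b / (b - a)) + log 2 B * (- a / (b - a)) = log 2 B + L * b"
  proof -
    have *: "u * (b / (b - a)) + v * (- a / (b - a)) = u + (u - v) / (b - a) * a"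
      "u * (b / (b - a)) + v * (- a / (b - a)) = v + (u - v) / (b - a) * b" for u v
      using ne by (simp_all add: divide_simps) (simp_all add: algebra_simps)
    show "log 2 A * (b / (b - a)) + log 2 B * (- a / (b - a)) = log 2 A + L * a"
      "log 2 A * (b / (b - a)) + log 2 B * (- a / (b - a)) = log 2 B + L * b"
      using *[of "log 2 A" "log 2 B"] AB unfolding L_def by (simp_all add: log_divide)
  qed
  have A: "A * 2 powr (x * a) = M * 2 powr ((x - L) * a)"
    using AB unfolding M e(1) by (subst AB2(1)) (simp only: powr_add[symmetric], simp add: algebra_simps)
  have B: "B * 2 powr (x * b) = M * 2 powr ((x - L) * b)"
    using AB unfolding M e(2) by (subst AB2(2)) (simp only: powr_add[symmetric], simp add: algebra_simps)
  have M0: "M \<ge> 0"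
    by (simp add: M_def)
  let ?c = "min \<bar>a\<bar> \<bar>b\<bar>"
  have "(x - L) * a \<le> - (?c * \<bar>x - L\<bar>) \<or> (x - L) * b \<le> - (?c * \<bar>x - L\<bar>)"
  proof -
    have *: "u * d \<le> - (?c * \<bar>u\<bar>)" if "u * d \<le> 0" "?c \<le> \<bar>d\<bar>" for u d :: real
    proof -
      have "?c * \<bar>u\<bar> \<le> \<bar>d\<bar> * \<bar>u\<bar>"
        using that by (intro mult_right_mono) auto
      also have "\<dots> = - (u * d)"
        using that(1) by (simp add: abs_mult[symmetric] mult.commute)
      finally show ?thesis by simp
    qed
    have "(x - L) * a \<le> 0 \<or> (x - L) * b \<le> 0"
      using ab by (auto simp: mult_le_0_iff mult_less_0_iff)
    then show ?thesis
      using *[of "x - L" a] *[of "x - L" b] by auto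
  qed
  then have "min (M * 2 powr ((x - L) * a)) (M * 2 powr ((x - L) * b)) \<le> M * 2 powr (- (?c * \<bar>x - L\<bar>))"
    using M0 by (auto intro!: mult_left_mono simp: min_le_iff_disj)
  then show ?thesis
    unfolding A B M_def[symmetric] L_def[symmetric] .
qed

text \<open>Around the crossing point the terms are dominated by a two-sided geometric series, so
  the whole sum is comparable to the crossing value, with a constant depending on a and b
  only.\<close>

lemma sum_min_powr_le:
  fixes a b :: real
  assumes ab: "a * b < 0"
  obtains C where "C > 0"
    "\<And>A B F. A > 0 \<Longrightarrow> B > 0 \<Longrightarrow> finite F \<Longrightarrow>
      (\<Sum>k\<in>F. min (A * 2 powr (real_of_int k * a)) (B * 2 powr (real_of_int k * b)))
        \<le> C * (A powr (b / (b - a)) * B powr (- a / (b - a)))"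
proof -
  define q where "q = 2 powr (- (min \<bar>a\<bar> \<bar>b\<bar>))"
  have c: "min \<bar>a\<bar> \<bar>b\<bar> > 0"
    using ab by (auto simp: mult_less_0_iff)
  have q: "0 < q" "q < 1"
    using c by (auto simp: q_def powr_minus inverse_less_1_iff)
  show ?thesis
  proof (rule that)
    show "1 / q * (2 / (1 - q)) > 0"
      using q by simp
    fix A B :: real and F :: "int set"
    assume AB: "A > 0" "B > 0" and F: "finite F"
    define M where "M = A powr (b / (b - a)) * B powr (- a / (b - a))"
    define L where "L = log 2 (A / B) / (b - a)"
    have M0: "M \<ge> 0"
      by (simp add: M_def)
    have tm: "min (A * 2 powr (real_of_int k * a)) (B * 2 powr (real_of_int k * b))
        \<le> M * (1 / q * q ^ nat \<bar>k - \<lfloor>L\<rfloor>\<bar>)" for k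
    proof -
      \<comment> \<open>The crossing point need not be an integer; centering the series at its floor
        costs at most one step, hence one factor \<open>1 / q\<close>.\<close>
      have "real_of_int \<bar>k - \<lfloor>L\<rfloor>\<bar> - 1 \<le> \<bar>real_of_int k - L\<bar>"
        by linarith
      then have "min \<bar>a\<bar> \<bar>b\<bar> * (real_of_int \<bar>k - \<lfloor>L\<rfloor>\<bar> - 1) \<le> min \<bar>a\<bar> \<bar>b\<bar> * \<bar>real_of_int k - L\<bar>"
        using c by (intro mult_left_mono) auto
      then have "2 powr (- (min \<bar>a\<bar> \<bar>b\<bar> * \<bar>real_of_int k - L\<bar>))
          \<le> 2 powr (- (min \<bar>a\<bar> \<bar>b\<bar> * (real_of_int \<bar>k - \<lfloor>L\<rfloor>\<bar> - 1)))"
        by (intro powr_mono) auto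
      also have "\<dots> = q powr (real_of_int \<bar>k - \<lfloor>L\<rfloor>\<bar> - 1)"
        unfolding q_def powr_powr by simp
      also have "\<dots> = 1 / q * q ^ nat \<bar>k - \<lfloor>L\<rfloor>\<bar>"
        using q by (simp add: powr_diff flip: powr_realpow)
      finally have "M * 2 powr (- (min \<bar>a\<bar> \<bar>b\<bar> * \<bar>real_of_int k - L\<bar>)) \<le> M * (1 / q * q ^ nat \<bar>k - \<lfloor>L\<rfloor>\<bar>)"
        using M0 by (intro mult_left_mono)
      then show ?thesis
        using min_powr_le[OF ab AB, of "real_of_int k"] unfolding M_def L_def by linarith
    qed
    have "(\<Sum>k\<in>F. min (A * 2 powr (real_of_int k * a)) (B * 2 powr (real_of_int k * b)))
        \<le> (\<Sum>k\<in>F. M * (1 / q * q ^ nat \<bar>k - \<lfloor>L\<rfloor>\<bar>))"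
      by (intro sum_mono tm)
    also have "\<dots> = M / q * (\<Sum>k\<in>F. q ^ nat \<bar>k - \<lfloor>L\<rfloor>\<bar>)"
      by (simp add: sum_distrib_left)
    also have "(\<Sum>k\<in>F. q ^ nat \<bar>k - \<lfloor>L\<rfloor>\<bar>) = (\<Sum>j\<in>(\<lambda>k. k - \<lfloor>L\<rfloor>) ` F. q ^ nat \<bar>j\<bar>)"
      by (simp add: sum.reindex inj_on_def)
    also have "M / q * \<dots> \<le> M / q * (2 / (1 - q))"
      using F M0 q by (intro mult_left_mono sum_power_abs_int_le) auto
    finally show "(\<Sum>k\<in>F. min (A * 2 powr (real_of_int k * a)) (B * 2 powr (real_of_int k * b)))
        \<le> 1 / q * (2 / (1 - q)) * (A powr (b / (b - a)) * B powr (- a / (b - a)))"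
      unfolding M_def by (simp add: mult_ac)
  qed
qed

section \<open>Van der Corput estimates\<close>

lemma has_vector_derivative_cis_comp:
  fixes \<phi> :: "real \<Rightarrow> real"
  assumes "(\<phi> has_real_derivative d) (at x within S)"
  shows "((\<lambda>r. cis (\<phi> r)) has_vector_derivative \<i> * of_real d * cis (\<phi> x)) (at x within S)"
proof -
  have "((\<lambda>r. of_real (\<phi> r) :: complex) has_vector_derivative of_real d) (at x within S)"
    using assms by (intro has_vector_derivative_of_real)
  then have "((exp \<circ> (\<lambda>r. \<i> * of_real (\<phi> r))) has_vector_derivative
      (\<i> * of_real d) * exp (\<i> * of_real (\<phi> x))) (at x within S)"
    by (intro field_vector_diff_chain_within) 
      (auto intro!: has_vector_derivative_mult_right DERIV_exp[THEN has_field_derivative_at_within])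
  then show ?thesis
    by (simp add: cis_conv_exp o_def mult_ac)
qed

text \<open>Integration by parts against 1/\<phi>'. A one-signed \<phi>'' makes 1/\<phi>' monotone,
  so its total variation telescopes to a difference of end values and the size of \<phi>'' never
  enters.\<close>

lemma van_der_corput_1:
  fixes \<phi> \<phi>' \<phi>'' :: "real \<Rightarrow> real"
  assumes ab: "a \<le> b"
    and d1: "\<And>r. r \<in> {a..b} \<Longrightarrow> (\<phi> has_real_derivative \<phi>' r) (at r)"
    and d2: "\<And>r. r \<in> {a..b} \<Longrightarrow> (\<phi>' has_real_derivative \<phi>'' r) (at r)"
    and c2: "continuous_on {a..b} \<phi>''"
    and sgn: "(\<forall>r\<in>{a..b}. \<phi>'' r \<ge> 0) \<or> (\<forall>r\<in>{a..b}. \<phi>'' r \<le> 0)"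
    and \<mu>: "\<mu> > 0" "\<And>r. r \<in> {a..b} \<Longrightarrow> \<bar>\<phi>' r\<bar> \<ge> \<mu>"
  shows "norm (integral {a..b} (\<lambda>r. cis (\<phi> r))) \<le> 4 / \<mu>"
proof -
  define h where "h r = 1 / \<phi>' r" for r
  define h' where "h' r = - \<phi>'' r / (\<phi>' r)\<^sup>2" for r
  have nz: "\<phi>' r \<noteq> 0" if "r \<in> {a..b}" for r
    using \<mu>(1) \<mu>(2)[OF that] by auto
  have cont: "continuous_on {a..b} \<phi>" "continuous_on {a..b} \<phi>'"
    using d1 d2 by (meson DERIV_isCont continuous_at_imp_continuous_on)+
  have dh: "(h has_real_derivative h' r) (at r)" if "r \<in> {a..b}" for r
    unfolding h_def h'_def using nz[OF that]
    by (auto intro!: derivative_eq_intros d2[OF that] simp: power2_eq_square)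
  have hb: "\<bar>h r\<bar> \<le> 1 / \<mu>" if "r \<in> {a..b}" for r
    unfolding h_def using \<mu>(1) \<mu>(2)[OF that] by (simp add: frac_le)
  have ch': "continuous_on {a..b} h'"
    unfolding h'_def using nz by (auto intro!: continuous_intros c2 cont)
  \<comment> \<open>\<open>?F\<close> is the boundary term of the integration by parts and
    \<open>?G\<close> its remainder.\<close>
  let ?F = "\<lambda>r. - \<i> * of_real (h r) * cis (\<phi> r)"
  let ?G = "\<lambda>r. - \<i> * of_real (h' r) * cis (\<phi> r)"
  have "(?F has_vector_derivative ?G r + cis (\<phi> r)) (at r within {a..b})" if r: "r \<in> {a..b}" for r
  proof -
    have "((\<lambda>r. of_real (h r) * cis (\<phi> r)) has_vector_derivative
        of_real (h r) * (\<i> * of_real (\<phi>' r) * cis (\<phi> r)) + of_real (h' r) * cis (\<phi> r)) (at r within {a..b})"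
      by (intro has_vector_derivative_mult has_vector_derivative_cis_comp has_vector_derivative_of_real
          dh[OF r] d1[OF r] has_field_derivative_at_within)
    then have "((\<lambda>r. - \<i> * (of_real (h r) * cis (\<phi> r))) has_vector_derivative
        - \<i> * (of_real (h r) * (\<i> * of_real (\<phi>' r) * cis (\<phi> r)) + of_real (h' r) * cis (\<phi> r))) (at r within {a..b})"
      by (rule has_vector_derivative_mult_right)
    moreover have "of_real (h r) * of_real (\<phi>' r) = (1::complex)"
      using nz[OF r] unfolding h_def of_real_mult[symmetric] by simp
    then have "- \<i> * (of_real (h r) * (\<i> * of_real (\<phi>' r) * cis (\<phi> r)) + of_real (h' r) * cis (\<phi> r))
        = ?G r + cis (\<phi> r)"
      by (simp add: algebra_simps)
    ultimately show ?thesis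
      by (simp add: mult.assoc)
  qed
  then have FTC: "((\<lambda>r. ?G r + cis (\<phi> r)) has_integral ?F b - ?F a) {a..b}"
    using ab by (intro fundamental_theorem_of_calculus) auto
  have iG: "?G integrable_on {a..b}"
    by (intro integrable_continuous_real continuous_intros ch' cont)
  have ic: "(\<lambda>r. cis (\<phi> r)) integrable_on {a..b}"
    by (intro integrable_continuous_real continuous_intros cont)
  have eq: "integral {a..b} (\<lambda>r. cis (\<phi> r)) = ?F b - ?F a - integral {a..b} ?G"
    unfolding integral_unique[OF FTC, symmetric] integral_add[OF iG ic] by (rule add_diff_cancel_left'[symmetric])
  have nF: "norm (?F r) \<le> 1 / \<mu>" if "r \<in> {a..b}" for r
    using hb[OF that] by (simp add: norm_mult)
  have hi: "(h' has_integral h b - h a) {a..b}"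
    using ab dh by (intro fundamental_theorem_of_calculus)
      (auto intro: has_field_derivative_at_within simp flip: has_real_derivative_iff_has_vector_derivative)
  have ih: "h' integrable_on {a..b}" "(\<lambda>r. - h' r) integrable_on {a..b}"
    using hi by (auto intro: integrable_neg)
  have nG: "norm (?G r) = \<bar>h' r\<bar>" for r
    by (simp add: norm_mult)
  have "norm (integral {a..b} ?G) \<le> \<bar>h b - h a\<bar>"
    using sgn
  proof
    assume s: "\<forall>r\<in>{a..b}. \<phi>'' r \<ge> 0"
    have "norm (integral {a..b} ?G) \<le> integral {a..b} (\<lambda>r. - h' r)"
      using s by (intro integral_norm_bound_integral iG ih, unfold nG) (simp add: h'_def)
    also have "\<dots> = - (h b - h a)"
      using hi by (simp add: integral_unique)
    finally show ?thesis by simp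
  next
    assume s: "\<forall>r\<in>{a..b}. \<phi>'' r \<le> 0"
    have "norm (integral {a..b} ?G) \<le> integral {a..b} h'"
      using s by (intro integral_norm_bound_integral iG ih, unfold nG)
        (simp add: h'_def divide_nonpos_nonneg)
    also have "\<dots> = h b - h a"
      using hi by (simp add: integral_unique)
    finally show ?thesis by simp
  qed
  also have "\<dots> \<le> 1 / \<mu> + 1 / \<mu>"
    using hb[of a] hb[of b] ab by (intro order_trans[OF abs_triangle_ineq4] add_mono) auto
  \<comment> \<open>Two units 1/\<mu> come from the boundary values of \<open>?F\<close>, two from
    the crude bound on \<open>\<bar>h b - h a\<bar>\<close>.\<close>
  finally have "norm (integral {a..b} (\<lambda>r. cis (\<phi> r))) \<le> (1 / \<mu> + 1 / \<mu>) + (1 / \<mu> + 1 / \<mu>)"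
    unfolding eq using nF[of a] nF[of b] ab
    by (intro order_trans[OF norm_triangle_ineq4] add_mono) auto
  then show ?thesis by simp
qed

text \<open>Away from one point c the derivative \<phi>' grows at least linearly with slope \<rho>.
  The radius 1/sqrt \<rho> balances the length of the excised interval against the first derivative
  test outside it; the constant is 4 + 2 + 4.\<close>

lemma van_der_corput_2_aux:
  fixes \<phi> \<phi>' \<phi>'' :: "real \<Rightarrow> real"
  assumes ab: "a \<le> b"
    and d1: "\<And>r. r \<in> {a..b} \<Longrightarrow> (\<phi> has_real_derivative \<phi>' r) (at r)"
    and d2: "\<And>r. r \<in> {a..b} \<Longrightarrow> (\<phi>' has_real_derivative \<phi>'' r) (at r)"
    and c2: "continuous_on {a..b} \<phi>''"
    and \<rho>: "\<rho> > 0" "\<And>r. r \<in> {a..b} \<Longrightarrow> \<phi>'' r \<ge> \<rho>"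
  shows "norm (integral {a..b} (\<lambda>r. cis (\<phi> r))) \<le> 10 / sqrt \<rho>"
proof -
  have incr: "\<phi>' s - \<phi>' r \<ge> \<rho> * (s - r)" if "a \<le> r" "r \<le> s" "s \<le> b" for r s
  proof (cases "r = s")
    case False
    then have "r < s" using that by auto
    then obtain z where "r < z" "z < s" "\<phi>' s - \<phi>' r = (s - r) * \<phi>'' z"
      using MVT2[of r s \<phi>' \<phi>''] d2 \<open>a \<le> r\<close> \<open>s \<le> b\<close>
      by (metis atLeastAtMost_iff order_trans)
    moreover have "\<phi>'' z \<ge> \<rho>"
      using \<open>r < z\<close> \<open>z < s\<close> that by (intro \<rho>(2)) auto
    ultimately show ?thesis
      using \<open>r < s\<close> by (simp add: mult.commute mult_left_mono)
  qed simp
  have cont: "continuous_on {a..b} \<phi>" "continuous_on {a..b} \<phi>'"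
    using d1 d2 by (meson DERIV_isCont continuous_at_imp_continuous_on)+
  \<comment> \<open>The point c is the zero of \<phi>' if there is one in the interior, and
    otherwise the endpoint at which \<phi>' comes closest to 0.\<close>
  have "\<exists>c\<in>{a..b}. (\<forall>r\<in>{c<..b}. \<phi>' r \<ge> \<rho> * (r - c)) \<and> (\<forall>r\<in>{a..<c}. \<phi>' r \<le> - (\<rho> * (c - r)))"
  proof -
    consider "\<phi>' a \<ge> 0" | "\<phi>' b \<le> 0" | "\<phi>' a < 0" "\<phi>' b > 0"
      by linarith
    then show ?thesis
    proof cases
      case 1
      have "\<phi>' r \<ge> \<rho> * (r - a)" if "r \<in> {a<..b}" for r
        using incr[of a r] 1 that by auto
      then show ?thesis
        using ab by (intro bexI[of _ a]) auto
    next
      case 2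
      have "\<phi>' r \<le> - (\<rho> * (b - r))" if "r \<in> {a..<b}" for r
        using incr[of r b] 2 that by auto
      then show ?thesis
        using ab by (intro bexI[of _ b]) auto
    next
      case 3
      then obtain c where c: "a \<le> c" "c \<le> b" "\<phi>' c = 0"
        using IVT'[of \<phi>' a 0 b] cont ab by auto
      have "\<phi>' r \<ge> \<rho> * (r - c)" if "r \<in> {c<..b}" for r
        using incr[of c r] c that by auto
      moreover have "\<phi>' r \<le> - (\<rho> * (c - r))" if "r \<in> {a..<c}" for r
        using incr[of r c] c that by auto
      ultimately show ?thesis
        using c by (intro bexI[of _ c]) auto
    qed
  qed
  then obtain c where c: "c \<in> {a..b}" "\<And>r. r \<in> {c<..b} \<Longrightarrow> \<phi>' r \<ge> \<rho> * (r - c)"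
     "\<And>r. r \<in> {a..<c} \<Longrightarrow> \<phi>' r \<le> - (\<rho> * (c - r))"
    by blast
  \<comment> \<open>Cut out the interval of radius \<open>d\<close> around the critical point and apply the first derivative test outside.\<close>
  define d where "d = 1 / sqrt \<rho>"
  have d0: "d > 0" and \<rho>d: "\<rho> * d = sqrt \<rho>"
    using \<rho>(1) by (auto simp: d_def field_simps)
  define a' where "a' = max a (c - d)"
  define b' where "b' = min b (c + d)"
  have o: "a \<le> a'" "a' \<le> b'" "b' \<le> b" "b' - a' \<le> 2 * d"
    using c(1) d0 by (auto simp: a'_def b'_def)
  let ?f = "\<lambda>r. cis (\<phi> r)"
  have int: "?f integrable_on {u..v}" if "a \<le> u" "v \<le> b" for u v
    using that by (intro integrable_continuous_real continuous_intros continuous_on_subset[OF cont(1)]) auto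
  have "integral {a..b} ?f = integral {a..a'} ?f + integral {a'..b} ?f"
    using o by (intro Henstock_Kurzweil_Integration.integral_combine[symmetric] int) auto
  also have "integral {a'..b} ?f = integral {a'..b'} ?f + integral {b'..b} ?f"
    using o by (intro Henstock_Kurzweil_Integration.integral_combine[symmetric] int) auto
  finally have eq: "integral {a..b} ?f = integral {a..a'} ?f + (integral {a'..b'} ?f + integral {b'..b} ?f)" .
  have sd: "sqrt \<rho> > 0" using \<rho>(1) by simp
  have p1: "norm (integral {a..a'} ?f) \<le> 4 / sqrt \<rho>"
  proof (cases "a' = a")
    case False
    then have a': "a' = c - d" by (auto simp: a'_def)
    show ?thesis
    proof (rule van_der_corput_1[where \<phi>'=\<phi>' and \<phi>''=\<phi>''])
      fix r assume r: "r \<in> {a..a'}"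
      then have "\<rho> * d \<le> \<rho> * (c - r)"
        using a' \<rho>(1) by (intro mult_left_mono) auto
      moreover have "\<phi>' r \<le> - (\<rho> * (c - r))"
        using r a' d0 by (intro c(3)) auto
      ultimately show "sqrt \<rho> \<le> \<bar>\<phi>' r\<bar>"
        using \<rho>d by linarith
    next
      show "(\<forall>r\<in>{a..a'}. \<phi>'' r \<ge> 0) \<or> (\<forall>r\<in>{a..a'}. \<phi>'' r \<le> 0)"
      proof (intro disjI1 ballI)
        fix r assume "r \<in> {a..a'}"
        then show "\<phi>'' r \<ge> 0" using \<rho>(1) \<rho>(2)[of r] o by auto
      qed
    qed (use o d1 d2 sd in \<open>auto intro: continuous_on_subset[OF c2]\<close>)
  qed (use sd in simp)
  have p3: "norm (integral {b'..b} ?f) \<le> 4 / sqrt \<rho>"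
  proof (cases "b' = b")
    case False
    then have b': "b' = c + d" by (auto simp: b'_def min_def split: if_splits)
    show ?thesis
    proof (rule van_der_corput_1[where \<phi>'=\<phi>' and \<phi>''=\<phi>''])
      fix r assume r: "r \<in> {b'..b}"
      then have "\<rho> * d \<le> \<rho> * (r - c)"
        using b' \<rho>(1) by (intro mult_left_mono) auto
      moreover have "\<phi>' r \<ge> \<rho> * (r - c)"
        using r b' d0 by (intro c(2)) auto
      ultimately show "sqrt \<rho> \<le> \<bar>\<phi>' r\<bar>"
        using \<rho>d by linarith
    next
      show "(\<forall>r\<in>{b'..b}. \<phi>'' r \<ge> 0) \<or> (\<forall>r\<in>{b'..b}. \<phi>'' r \<le> 0)"
      proof (intro disjI1 ballI)
        fix r assume "r \<in> {b'..b}"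
        then show "\<phi>'' r \<ge> 0" using \<rho>(1) \<rho>(2)[of r] o by auto
      qed
    qed (use o d1 d2 sd in \<open>auto intro: continuous_on_subset[OF c2]\<close>)
  qed (use sd in simp)
  have "norm (integral {a'..b'} ?f) \<le> 1 * (b' - a')"
    using o by (intro integral_bound continuous_intros continuous_on_subset[OF cont(1)]) auto
  then have p2: "norm (integral {a'..b'} ?f) \<le> 2 / sqrt \<rho>"
    using o by (simp add: d_def)
  have "norm (integral {a..b} ?f) \<le> 4 / sqrt \<rho> + (2 / sqrt \<rho> + 4 / sqrt \<rho>)"
    unfolding eq by (intro order_trans[OF norm_triangle_ineq] add_mono p1 p2 p3)
  then show ?thesis by simp
qed

lemma van_der_corput_2:
  fixes \<phi> \<phi>' \<phi>'' :: "real \<Rightarrow> real"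
  assumes ab: "a \<le> b"
    and d1: "\<And>r. r \<in> {a..b} \<Longrightarrow> (\<phi> has_real_derivative \<phi>' r) (at r)"
    and d2: "\<And>r. r \<in> {a..b} \<Longrightarrow> (\<phi>' has_real_derivative \<phi>'' r) (at r)"
    and c2: "continuous_on {a..b} \<phi>''"
    and \<rho>: "\<rho> > 0"
    and sgn: "(\<forall>r\<in>{a..b}. \<phi>'' r \<ge> \<rho>) \<or> (\<forall>r\<in>{a..b}. \<phi>'' r \<le> - \<rho>)"
  shows "norm (integral {a..b} (\<lambda>r. cis (\<phi> r))) \<le> 10 / sqrt \<rho>"
  using sgn
proof
  assume "\<forall>r\<in>{a..b}. \<phi>'' r \<ge> \<rho>"
  then show ?thesis
    using van_der_corput_2_aux[OF ab d1 d2 c2 \<rho>] by blast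
next
  assume *: "\<forall>r\<in>{a..b}. \<phi>'' r \<le> - \<rho>"
  \<comment> \<open>The phase -\<phi> is convex, and reversing the sign of the phase only conjugates
    the integral.\<close>
  have "norm (integral {a..b} (\<lambda>r. cis (- \<phi> r))) \<le> 10 / sqrt \<rho>"
  proof (rule van_der_corput_2_aux[where \<phi>'="\<lambda>r. - \<phi>' r" and \<phi>''="\<lambda>r. - \<phi>'' r"])
    fix r assume r: "r \<in> {a..b}"
    show "((\<lambda>r. - \<phi> r) has_real_derivative - \<phi>' r) (at r)"
      "((\<lambda>r. - \<phi>' r) has_real_derivative - \<phi>'' r) (at r)"
      by (intro DERIV_minus d1 d2 r)+
    show "\<rho> \<le> - \<phi>'' r"
      using * r by force
  qed (use ab \<rho> in \<open>auto intro!: continuous_intros c2\<close>)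
  also have "integral {a..b} (\<lambda>r. cis (- \<phi> r)) = cnj (integral {a..b} (\<lambda>r. cis (\<phi> r)))"
    by (simp add: integral_cnj cis_cnj)
  finally show ?thesis by simp
qed

text \<open>Integration by parts against the primitive of f: the primitive vanishes at a and \<psi>
  vanishes at b, so no boundary term survives and the amplitude enters through \<psi>' alone. This
  is why the hypothesis on D concerns all initial segments.\<close>

lemma oscillatory_amplitude_bound:
  fixes f \<psi> \<psi>' :: "real \<Rightarrow> complex"
  assumes ab: "a \<le> b"
    and cf: "continuous_on {a..b} f"
    and d: "\<And>r. r \<in> {a..b} \<Longrightarrow> (\<psi> has_vector_derivative \<psi>' r) (at r)"
    and c: "continuous_on {a..b} \<psi>'"
    and D: "\<And>r. r \<in> {a..b} \<Longrightarrow> norm (integral {a..r} f) \<le> D"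
    and M: "\<And>r. r \<in> {a..b} \<Longrightarrow> norm (\<psi>' r) \<le> M"
    and \<psi>b: "\<psi> b = 0"
  shows "norm (integral {a..b} (\<lambda>r. \<psi> r * f r)) \<le> D * M * (b - a)"
proof -
  define F where "F r = integral {a..r} f" for r
  have dF: "(F has_vector_derivative f r) (at r within {a..b})" if "r \<in> {a..b}" for r
    unfolding F_def using integral_has_vector_derivative[OF cf that] .
  have c\<psi>: "continuous_on {a..b} \<psi>"
    using d by (meson has_vector_derivative_continuous continuous_at_imp_continuous_on)
  have cF: "continuous_on {a..b} F"
    using dF by (meson continuous_on_eq_continuous_within has_vector_derivative_continuous)
  have "((\<lambda>r. \<psi> r * F r) has_vector_derivative \<psi> r * f r + \<psi>' r * F r) (at r within {a..b})"
    if "r \<in> {a..b}" for r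
    by (intro has_vector_derivative_mult dF that has_vector_derivative_at_within[OF d])
  then have "((\<lambda>r. \<psi> r * f r + \<psi>' r * F r) has_integral \<psi> b * F b - \<psi> a * F a) {a..b}"
    using ab by (intro fundamental_theorem_of_calculus) auto
  moreover have "\<psi> b * F b - \<psi> a * F a = 0"
    by (simp add: \<psi>b F_def)
  moreover have i1: "(\<lambda>r. \<psi> r * f r) integrable_on {a..b}"
    by (intro integrable_continuous_real continuous_intros c\<psi> cf)
  moreover have i2: "(\<lambda>r. \<psi>' r * F r) integrable_on {a..b}"
    by (intro integrable_continuous_real continuous_intros c cF)
  ultimately have "integral {a..b} (\<lambda>r. \<psi> r * f r) + integral {a..b} (\<lambda>r. \<psi>' r * F r) = 0"
    using integral_add[OF i1 i2] integral_unique by metis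
  then have "norm (integral {a..b} (\<lambda>r. \<psi> r * f r)) = norm (integral {a..b} (\<lambda>r. \<psi>' r * F r))"
    by (metis add_eq_0_iff norm_minus_cancel)
  also have "\<dots> \<le> D * M * (b - a)"
  proof (rule integral_bound[OF ab])
    show "continuous_on {a..b} (\<lambda>r. \<psi>' r * F r)"
      by (intro continuous_intros c cF)
    fix r assume r: "r \<in> {a..b}"
    have "norm (\<psi>' r * F r) \<le> M * D"
      using M[OF r] D[OF r] order_trans[OF norm_ge_zero M[OF r]]
      by (auto simp: norm_mult F_def intro!: mult_mono)
    then show "norm (\<psi>' r * F r) \<le> D * M"
      by (simp add: mult.commute)
  qed
  finally show ?thesis .
qed

section \<open>The Bessel function of order zero\<close>

text \<open>\<open>bessel_moment n\<close> is the \<open>n\<close>-th derivative of \<open>2 \<pi> J\<^sub>0\<close>.\<close>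

definition bessel_moment :: "nat \<Rightarrow> real \<Rightarrow> complex" where
  "bessel_moment n u = integral {0..2*pi} (\<lambda>\<theta>. (\<i> * of_real (cos \<theta>)) ^ n * cis (u * cos \<theta>))"

lemma bessel_moment_integrable:
  "(\<lambda>\<theta>. (\<i> * of_real (cos \<theta>)) ^ n * cis (u * cos \<theta>)) integrable_on {0..2*pi}"
  by (intro integrable_continuous_real continuous_intros)

lemma bessel_moment_bound: "norm (bessel_moment n u) \<le> 2 * pi"
proof -
  have "norm (bessel_moment n u) \<le> 1 * (2 * pi - 0)"
    unfolding bessel_moment_def
    by (intro integral_bound continuous_intros)
      (auto simp: norm_mult norm_power intro!: power_le_one)
  then show ?thesis by simp
qed

lemma has_vector_derivative_bessel_moment:
  "(bessel_moment n has_vector_derivative bessel_moment (Suc n) u) (at u within S)"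
proof -
  have "((\<lambda>u. integral (cbox 0 (2*pi)) (\<lambda>\<theta>. (\<i> * of_real (cos \<theta>)) ^ n * cis (u * cos \<theta>)))
      has_vector_derivative integral (cbox 0 (2*pi)) (\<lambda>\<theta>. (\<i> * of_real (cos \<theta>)) ^ Suc n * cis (u * cos \<theta>)))
      (at u within UNIV)"
  proof (rule leibniz_rule_vector_derivative)
    fix u \<theta> :: real
    have "((\<lambda>u. (\<i> * of_real (cos \<theta>)) ^ n * cis (u * cos \<theta>)) has_vector_derivative
        (\<i> * of_real (cos \<theta>)) ^ n * (\<i> * of_real (cos \<theta>) * cis (u * cos \<theta>))) (at u)"
      by (intro has_vector_derivative_mult_right has_vector_derivative_cis_comp)
        (auto intro!: derivative_eq_intros)
    then show "((\<lambda>u. (\<i> * of_real (cos \<theta>)) ^ n * cis (u * cos \<theta>)) has_vector_derivative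
        (\<i> * of_real (cos \<theta>)) ^ Suc n * cis (u * cos \<theta>)) (at u)"
      by (simp add: mult_ac)
  next
    show "continuous_on (UNIV \<times> cbox 0 (2 * pi))
        (\<lambda>(u, \<theta>). (\<i> * complex_of_real (cos \<theta>)) ^ Suc n * cis (u * cos \<theta>))"
      unfolding case_prod_beta by (intro continuous_intros)
  qed (use bessel_moment_integrable in auto)
  then show ?thesis
    unfolding bessel_moment_def[abs_def] box_real
    by (rule has_vector_derivative_at_within)
qed

lemma continuous_on_bessel_moment [continuous_intros]:
  assumes "continuous_on S f"
  shows "continuous_on S (\<lambda>x. bessel_moment n (f x))"
proof -
  have "continuous_on UNIV (bessel_moment n)"
    by (meson has_vector_derivative_bessel_moment has_vector_derivative_continuous
        continuous_on_eq_continuous_within)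
  then show ?thesis
    by (rule continuous_on_compose2[OF _ assms]) auto
qed

text \<open>Under the integral sign the left-hand side is the \<theta>-derivative of
  \<open>\<i> * (sin \<theta> * cis (u * cos \<theta>))\<close>, which vanishes at 0 and at 2
  pi.\<close>

lemma bessel_equation:
  "of_real u * bessel_moment 2 u + bessel_moment 1 u + of_real u * bessel_moment 0 u = 0"
proof -
  let ?G = "\<lambda>\<theta>. \<i> * (of_real (sin \<theta>) * cis (u * cos \<theta>))"
  let ?f = "\<lambda>n \<theta>. (\<i> * of_real (cos \<theta>)) ^ n * cis (u * cos \<theta>)"
  have "(?G has_vector_derivative
      of_real u * ?f 2 \<theta> + ?f 1 \<theta> + of_real u * ?f 0 \<theta>) (at \<theta> within {0..2*pi})" for \<theta>
  proof -
    have "((\<lambda>\<theta>. cis (u * cos \<theta>)) has_vector_derivative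
        \<i> * of_real (- (u * sin \<theta>)) * cis (u * cos \<theta>)) (at \<theta> within {0..2*pi})"
      by (intro has_vector_derivative_cis_comp) (auto intro!: derivative_eq_intros)
    moreover have "((\<lambda>\<theta>. complex_of_real (sin \<theta>)) has_vector_derivative of_real (cos \<theta>)) (at \<theta> within {0..2*pi})"
      by (intro has_vector_derivative_of_real) (auto intro!: derivative_eq_intros)
    ultimately have "(?G has_vector_derivative
       \<i> * (of_real (sin \<theta>) * (\<i> * of_real (- (u * sin \<theta>)) * cis (u * cos \<theta>)) + of_real (cos \<theta>) * cis (u * cos \<theta>)))
       (at \<theta> within {0..2*pi})"
      by (intro has_vector_derivative_mult_right has_vector_derivative_mult)
    moreover have "\<i> * (of_real (sin \<theta>) * (\<i> * of_real (- (u * sin \<theta>)) * cis (u * cos \<theta>)) + of_real (cos \<theta>) * cis (u * cos \<theta>))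
       = of_real u * ?f 2 \<theta> + ?f 1 \<theta> + of_real u * ?f 0 \<theta>"
    proof -
      \<comment> \<open>The moments contain powers of the cosine only, so the squared sine produced
        by differentiating the exponential is eliminated.\<close>
      have alg: "\<i> * (s * (\<i> * - (v * s) * k) + c * k) = v * ((\<i> * c) ^ 2 * k) + (\<i> * c) ^ 1 * k + v * ((\<i> * c) ^ 0 * k)"
        if "s * s = 1 - c * c" for s c v k :: complex
      proof -
        have "\<i> * (s * (\<i> * - (v * s) * k) + c * k) = v * (s * s) * k + \<i> * c * k"
          by (simp add: algebra_simps)
        then show ?thesis
          unfolding that by (simp add: power2_eq_square algebra_simps)
      qed
      have "complex_of_real (sin \<theta>) * of_real (sin \<theta>) = 1 - of_real (cos \<theta>) * of_real (cos \<theta>)"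
        by (metis of_real_1 of_real_diff of_real_mult power2_eq_square sin_squared_eq)
      from alg[OF this] show ?thesis
        by simp
    qed
    ultimately show ?thesis by simp
  qed
  then have 1: "((\<lambda>\<theta>. of_real u * ?f 2 \<theta> + ?f 1 \<theta> + of_real u * ?f 0 \<theta>) has_integral ?G (2 * pi) - ?G 0) {0..2*pi}"
    by (intro fundamental_theorem_of_calculus) auto
  have 2: "((\<lambda>\<theta>. of_real u * ?f 2 \<theta> + ?f 1 \<theta> + of_real u * ?f 0 \<theta>) has_integral
      of_real u * bessel_moment 2 u + bessel_moment 1 u + of_real u * bessel_moment 0 u) {0..2*pi}"
    unfolding bessel_moment_def
    by (intro has_integral_add has_integral_mult_right integrable_integral bessel_moment_integrable)
  show ?thesis
    using has_integral_unique[OF 2 1] by simp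
qed

lemma bessel_moment_2:
  assumes "u \<noteq> 0"
  shows "bessel_moment 2 u = - bessel_moment 0 u - bessel_moment 1 u / of_real u"
proof -
  have "bessel_moment 2 u = ((of_real u * bessel_moment 2 u + bessel_moment 1 u + of_real u * bessel_moment 0 u)
      - bessel_moment 1 u - of_real u * bessel_moment 0 u) / of_real u"
    using assms by simp
  then show ?thesis
    unfolding bessel_equation using assms by (simp add: diff_divide_distrib)
qed

text \<open>With \<open>w = sqrt u * bessel_moment 0 u\<close>, this is \<open>w' / sqrt u\<close>; the Bessel equation becomes
  \<open>w'' = - (1 + 1 / (4 u^2)) w\<close>, whose energy is almost conserved.\<close>

definition bessel_deriv :: "real \<Rightarrow> complex" where
  "bessel_deriv u = bessel_moment 1 u + bessel_moment 0 u / of_real (2 * u)"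

section \<open>Energy method for the Bessel equation\<close>

lemma has_vector_derivative_bessel_moment_0:
  assumes "u \<noteq> 0"
  shows "(bessel_moment 0 has_vector_derivative bessel_deriv u - bessel_moment 0 u / of_real (2 * u)) (at u)"
  using has_vector_derivative_bessel_moment[of 0 u UNIV] by (simp add: bessel_deriv_def)

lemma has_vector_derivative_bessel_deriv:
  assumes u: "u \<noteq> 0"
  shows "(bessel_deriv has_vector_derivative
     - bessel_moment 0 u - bessel_deriv u / of_real (2 * u) - bessel_moment 0 u / of_real (4 * u\<^sup>2)) (at u)"
proof -
  have "((\<lambda>u. complex_of_real (1 / (2 * u))) has_vector_derivative of_real (- 1 / (2 * u\<^sup>2))) (at u)"
    using u by (intro has_vector_derivative_of_real) (auto intro!: derivative_eq_intros simp: power2_eq_square field_simps)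
  then have "((\<lambda>u. bessel_moment 1 u + bessel_moment 0 u * of_real (1 / (2 * u))) has_vector_derivative
      bessel_moment 2 u + (bessel_moment 0 u * of_real (- 1 / (2 * u\<^sup>2)) + bessel_moment 1 u * of_real (1 / (2 * u)))) (at u)"
    using has_vector_derivative_bessel_moment[of 0 u UNIV] has_vector_derivative_bessel_moment[of 1 u UNIV]
    by (intro has_vector_derivative_add has_vector_derivative_mult) (simp_all add: numeral_2_eq_2)
  moreover have "bessel_moment 2 u + (bessel_moment 0 u * of_real (- 1 / (2 * u\<^sup>2)) + bessel_moment 1 u * of_real (1 / (2 * u)))
     = - bessel_moment 0 u - bessel_deriv u / of_real (2 * u) - bessel_moment 0 u / of_real (4 * u\<^sup>2)"
    using u unfolding bessel_moment_2[OF u] bessel_deriv_def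
    by (simp add: divide_simps power2_eq_square) (simp add: algebra_simps)
  moreover have "bessel_deriv = (\<lambda>u. bessel_moment 1 u + bessel_moment 0 u * of_real (1 / (2 * u)))"
    by (simp add: fun_eq_iff bessel_deriv_def)
  ultimately show ?thesis
    by simp
qed

text \<open>The energy E changes at a rate of at most E / (4 u^2), which is integrable at infinity.
  The weight exp (1 / (4 u)) is the matching integrating factor: the derivative of \<open>W\<close>
  is a negative multiple of the squared norm of \<open>?B u + ?J u\<close>. The factor exp (1/2) is
  the value of the weight at the starting point 1/2.\<close>

lemma bessel_energy_bound:
  assumes "1/2 \<le> u"
  shows "u * ((norm (bessel_moment 0 u))\<^sup>2 + (norm (bessel_deriv u))\<^sup>2)
     \<le> exp (1/2) * (1/2 * ((norm (bessel_moment 0 (1/2)))\<^sup>2 + (norm (bessel_deriv (1/2)))\<^sup>2))"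
proof -
  let ?J = "bessel_moment 0" and ?B = "bessel_deriv"
  define N where "N u = ?J u \<bullet> ?J u + ?B u \<bullet> ?B u" for u
  define E where "E u = u * N u" for u
  define W where "W u = E u * exp (1 / (4 * u))" for u
  have N0: "N u \<ge> 0" for u by (simp add: N_def)
  have dE: "(E has_real_derivative - (?B u \<bullet> ?J u) / (2 * u)) (at u)" if "u \<noteq> 0" for u
  proof -
    note bb = bounded_bilinear.has_vector_derivative[OF bounded_bilinear_inner]
    have "(N has_vector_derivative
       (?J u \<bullet> (?B u - ?J u / of_real (2 * u)) + (?B u - ?J u / of_real (2 * u)) \<bullet> ?J u)
      + (?B u \<bullet> (- ?J u - ?B u / of_real (2 * u) - ?J u / of_real (4 * u\<^sup>2))
         + (- ?J u - ?B u / of_real (2 * u) - ?J u / of_real (4 * u\<^sup>2)) \<bullet> ?B u)) (at u)"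
      unfolding N_def[abs_def]
      by (intro has_vector_derivative_add bb has_vector_derivative_bessel_deriv[OF that] has_vector_derivative_bessel_moment_0[OF that])
    also have "(?J u \<bullet> (?B u - ?J u / of_real (2 * u)) + (?B u - ?J u / of_real (2 * u)) \<bullet> ?J u)
      + (?B u \<bullet> (- ?J u - ?B u / of_real (2 * u) - ?J u / of_real (4 * u\<^sup>2))
         + (- ?J u - ?B u / of_real (2 * u) - ?J u / of_real (4 * u\<^sup>2)) \<bullet> ?B u)
      = - N u / u - (?B u \<bullet> ?J u) / (2 * u\<^sup>2)"
    proof -
      have d: "z / complex_of_real c = (1 / c) *\<^sub>R z" for z c
        by (simp add: scaleR_conv_of_real)
      have alg: "(p - 1 / (2 * u) * q + (p - 1 / (2 * u) * q))
          + (- p - 1 / (2 * u) * r - 1 / (4 * u\<^sup>2) * p + (- p - 1 / (2 * u) * r - 1 / (4 * u\<^sup>2) * p))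
          = - (q + r) / u - p / (2 * u\<^sup>2)" for p q r :: real
        using that by (simp add: field_simps power2_eq_square)
      show ?thesis
        unfolding d inner_diff_left inner_diff_right inner_minus_left inner_minus_right
          inner_scaleR_left inner_scaleR_right inner_commute[of "?J u" "?B u"] N_def
        by (rule alg)
    qed
    finally have "(N has_real_derivative - N u / u - (?B u \<bullet> ?J u) / (2 * u\<^sup>2)) (at u)"
      by (simp add: has_real_derivative_iff_has_vector_derivative)
    \<comment> \<open>In N' the leading cross terms have cancelled; the factor u is chosen to remove
      the damping \<open>- N u / u\<close>, and only a term of lower order is left.\<close>
    then have "((\<lambda>u. u * N u) has_real_derivative 1 * N u + (- N u / u - (?B u \<bullet> ?J u) / (2 * u\<^sup>2)) * u) (at u)"
      by (intro DERIV_mult DERIV_ident)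
    also have "1 * N u + (- N u / u - (?B u \<bullet> ?J u) / (2 * u\<^sup>2)) * u = - (?B u \<bullet> ?J u) / (2 * u)"
      using that by (simp add: field_simps power2_eq_square)
    finally show ?thesis
      unfolding E_def[abs_def] .
  qed
  have "W u \<le> W (1/2)"
  proof (rule DERIV_nonpos_imp_nonincreasing[OF assms])
    fix x :: real assume "1/2 \<le> x" "x \<le> u"
    then have x: "x > 0" by simp
    have "(W has_real_derivative - (?B x \<bullet> ?J x) / (2 * x) * exp (1 / (4 * x)) + exp (1 / (4 * x)) * (- 1 / (4 * x\<^sup>2)) * E x) (at x)"
      unfolding W_def[abs_def] using x
      by (intro DERIV_mult dE) (auto intro!: derivative_eq_intros simp: power2_eq_square field_simps)
    moreover have "- (?B x \<bullet> ?J x) / (2 * x) * exp (1 / (4 * x)) + exp (1 / (4 * x)) * (- 1 / (4 * x\<^sup>2)) * E x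
       = - exp (1 / (4 * x)) / (4 * x) * (2 * (?B x \<bullet> ?J x) + N x)"
      using x unfolding E_def by (simp add: divide_simps power2_eq_square) (simp add: algebra_simps)
    moreover have "2 * (?B x \<bullet> ?J x) + N x = (?B x + ?J x) \<bullet> (?B x + ?J x)"
      by (simp add: N_def inner_add_left inner_add_right inner_commute)
    moreover have "- exp (1 / (4 * x)) / (4 * x) * ((?B x + ?J x) \<bullet> (?B x + ?J x)) \<le> 0"
      using x by (intro mult_nonpos_nonneg) auto
    ultimately show "\<exists>y. (W has_real_derivative y) (at x) \<and> y \<le> 0"
      by metis
  qed
  moreover have "E u * 1 \<le> W u"
    unfolding W_def using assms N0[of u] by (intro mult_left_mono) (auto simp: E_def)
  ultimately have "E u \<le> W (1/2)"
    by simp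
  then show ?thesis
    unfolding W_def E_def N_def by (simp add: power2_norm_eq_inner mult_ac)
qed

text \<open>The splitting is exact rather than asymptotic: H is the projection of the pair (J, B),
  with B as in \<open>bessel_deriv\<close>, onto one of the two rotating directions, with the
  rotation divided out. The energy bound controls J and B, hence H, and the derivative of H retains
  only the O(1/u) perturbation of the rotation. The range starts at 1/2 because r X is at least R X
  / 2 on a dyadic shell.\<close>

lemma bessel_decomposition:
  obtains K :: real and H H' :: "real \<Rightarrow> real \<Rightarrow> complex" where
    "K > 0"
    "\<And>u. u \<ge> 1/2 \<Longrightarrow> bessel_moment 0 u = cis u * H 1 u + cis (- u) * H (-1) u"
    "\<And>\<sigma> u. \<sigma>\<^sup>2 = 1 \<Longrightarrow> u \<ge> 1/2 \<Longrightarrow> (H \<sigma> has_vector_derivative H' \<sigma> u) (at u)"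
    "\<And>\<sigma>. continuous_on {1/2..} (H' \<sigma>)"
    "\<And>\<sigma> u. \<sigma>\<^sup>2 = 1 \<Longrightarrow> u \<ge> 1/2 \<Longrightarrow> norm (H \<sigma> u) \<le> K / sqrt u"
    "\<And>\<sigma> u. \<sigma>\<^sup>2 = 1 \<Longrightarrow> u \<ge> 1/2 \<Longrightarrow> norm (H' \<sigma> u) \<le> K / (u * sqrt u)"
proof -
  let ?J = "bessel_moment 0" and ?B = "bessel_deriv"
  define E where "E = exp (1/2) * (1/2 * ((norm (bessel_moment 0 (1/2)))\<^sup>2 + (norm (bessel_deriv (1/2)))\<^sup>2))"
  \<comment> \<open>The summand 1 only serves to make \<open>K\<close> positive.\<close>
  define K where "K = sqrt E + 1"
  have E0: "E \<ge> 0" by (auto simp: E_def intro!: mult_nonneg_nonneg)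
  have K0: "K > 0" using E0 by (auto simp: K_def intro: add_nonneg_pos)
  have bd: "norm z \<le> K / sqrt u" if "u \<ge> 1/2" "u * (norm z)\<^sup>2 \<le> E" for u and z :: complex
  proof -
    have "sqrt u * norm z = sqrt (u * (norm z)\<^sup>2)"
      using that by (simp add: real_sqrt_mult)
    also have "\<dots> \<le> K"
      using real_sqrt_le_mono[OF that(2)] unfolding K_def by linarith
    finally show ?thesis
      using that by (simp add: field_simps)
  qed
  have bJ: "norm (?J u) \<le> K / sqrt u" and bB: "norm (?B u) \<le> K / sqrt u" if "u \<ge> 1/2" for u
  proof -
    have "u * ((norm (?J u))\<^sup>2 + (norm (?B u))\<^sup>2) \<le> E"
      using bessel_energy_bound[OF that] unfolding E_def .
    moreover have "u * (norm (?J u))\<^sup>2 \<ge> 0" "u * (norm (?B u))\<^sup>2 \<ge> 0"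
      using that by auto
    ultimately have "u * (norm (?J u))\<^sup>2 \<le> E" "u * (norm (?B u))\<^sup>2 \<le> E"
      by (auto simp: distrib_left)
    then show "norm (?J u) \<le> K / sqrt u" "norm (?B u) \<le> K / sqrt u"
      using bd that by auto
  qed
  define H where "H \<sigma> u = cis (- \<sigma> * u) * (?J u - \<i> * of_real \<sigma> * ?B u) / 2" for \<sigma> u
  define H' where "H' \<sigma> u = cis (- \<sigma> * u) * (- ?J u / of_real (2 * u)
     + \<i> * of_real \<sigma> * (?B u / of_real (2 * u) + ?J u / of_real (4 * u\<^sup>2))) / 2" for \<sigma> u
  show thesis
  proof (rule that[OF K0])
    fix u :: real assume "u \<ge> 1/2"
    have cc: "cis u * (cis (- u) * z) = z" "cis (- u) * (cis u * z) = z" for z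
      by (simp_all add: mult.assoc[symmetric] cis_mult)
    have "cis u * H 1 u + cis (- u) * H (-1) u = (?J u - \<i> * ?B u) / 2 + (?J u + \<i> * ?B u) / 2"
      unfolding H_def by (simp add: times_divide_eq_right cc)
    then show "?J u = cis u * H 1 u + cis (- u) * H (-1) u"
      by (simp add: add_divide_distrib[symmetric])
  next
    fix \<sigma> u :: real assume s: "\<sigma>\<^sup>2 = 1" and u: "u \<ge> 1/2"
    then have u0: "u \<noteq> 0" by auto
    have ss: "complex_of_real \<sigma> * (of_real \<sigma> * z) = z" for z
    proof -
      have "complex_of_real \<sigma> * of_real \<sigma> = 1"
        unfolding of_real_mult[symmetric] using s by (simp add: power2_eq_square)
      then show ?thesis
        by (simp add: mult.assoc[symmetric])
    qed
    have "((\<lambda>u. cis (- \<sigma> * u)) has_vector_derivative \<i> * of_real (- \<sigma>) * cis (- \<sigma> * u)) (at u)"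
      by (intro has_vector_derivative_cis_comp) (auto intro!: derivative_eq_intros)
    then have "(H \<sigma> has_vector_derivative (cis (- \<sigma> * u) *
        ((?B u - ?J u / of_real (2 * u)) - \<i> * of_real \<sigma> * (- ?J u - ?B u / of_real (2 * u) - ?J u / of_real (4 * u\<^sup>2)))
        + (\<i> * of_real (- \<sigma>) * cis (- \<sigma> * u)) * (?J u - \<i> * of_real \<sigma> * ?B u)) / 2) (at u)"
      unfolding H_def[abs_def]
      by (intro has_vector_derivative_divide has_vector_derivative_mult has_vector_derivative_diff
          has_vector_derivative_mult_right has_vector_derivative_bessel_deriv[OF u0] has_vector_derivative_bessel_moment_0[OF u0])
    \<comment> \<open>To leading order differentiation multiplies J - \<i> \<sigma> B by \<i>
      \<sigma>, by \<sigma>^2 = 1; the derivative of \<open>cis (- \<sigma> * u)\<close> cancels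
      precisely this part.\<close>
    also have "(cis (- \<sigma> * u) *
        ((?B u - ?J u / of_real (2 * u)) - \<i> * of_real \<sigma> * (- ?J u - ?B u / of_real (2 * u) - ?J u / of_real (4 * u\<^sup>2)))
        + (\<i> * of_real (- \<sigma>) * cis (- \<sigma> * u)) * (?J u - \<i> * of_real \<sigma> * ?B u)) / 2 = H' \<sigma> u"
      unfolding H'_def by (simp add: algebra_simps ss)
    finally show "(H \<sigma> has_vector_derivative H' \<sigma> u) (at u)" .
    have ns: "\<bar>\<sigma>\<bar> = 1" using s by (auto simp: power2_eq_1_iff)
    have "norm (?J u - \<i> * of_real \<sigma> * ?B u) \<le> K / sqrt u + K / sqrt u"
      using bJ[OF u] bB[OF u] ns
      by (intro order_trans[OF norm_triangle_ineq4] add_mono) (auto simp: norm_mult)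
    then show "norm (H \<sigma> u) \<le> K / sqrt u"
      by (simp add: H_def norm_mult norm_divide mult.commute)
    have "norm (- ?J u / of_real (2 * u) + \<i> * of_real \<sigma> * (?B u / of_real (2 * u) + ?J u / of_real (4 * u\<^sup>2)))
       \<le> norm (?J u) / (2 * u) + (norm (?B u) / (2 * u) + norm (?J u) / (4 * u\<^sup>2))"
      using u ns by (intro order_trans[OF norm_triangle_ineq] add_mono)
        (auto simp: norm_mult norm_divide norm_power intro!: order_trans[OF norm_triangle_ineq])
    \<comment> \<open>For u at least 1/2 the term with 1/u^2 is absorbed into those with 1/u; three
      equal terms, halved by the definition of \<open>H'\<close>, give the factor 3/4 below.\<close>
    also have "norm (?J u) / (4 * u\<^sup>2) \<le> norm (?J u) / (2 * u)"
      using u by (intro divide_left_mono) (auto simp: power2_eq_square)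
    also have "norm (?J u) / (2 * u) + (norm (?B u) / (2 * u) + norm (?J u) / (2 * u))
       \<le> (K / sqrt u) / (2 * u) + ((K / sqrt u) / (2 * u) + (K / sqrt u) / (2 * u))"
      using bJ[OF u] bB[OF u] u by (intro add_mono divide_right_mono) auto
    also have "\<dots> = 3/2 * (K / (u * sqrt u))"
      using u by (simp add: field_simps)
    finally have "norm (H' \<sigma> u) \<le> 3/4 * (K / (u * sqrt u))"
      unfolding H'_def by (simp add: norm_mult norm_divide)
    moreover have "K / (u * sqrt u) \<ge> 0" using K0 u by auto
    ultimately show "norm (H' \<sigma> u) \<le> K / (u * sqrt u)"
    proof -
      have "p \<le> q" if "p \<le> 3/4 * q" "0 \<le> q" for p q :: real
        using that by simp
      with \<open>norm (H' \<sigma> u) \<le> 3/4 * (K / (u * sqrt u))\<close> \<open>K / (u * sqrt u) \<ge> 0\<close> show ?thesis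
        by blast
    qed
  next
    fix \<sigma>
    show "continuous_on {1/2..} (H' \<sigma>)"
    proof -
      have cB: "continuous_on {1/2..} bessel_deriv"
        by (intro continuous_at_imp_continuous_on ballI
            has_vector_derivative_continuous[OF has_vector_derivative_bessel_deriv]) auto
      have ci: "continuous_on {1/2..} (\<lambda>u. inverse (complex_of_real (2 * u)))"
        "continuous_on {1/2..} (\<lambda>u. inverse (complex_of_real (4 * u\<^sup>2)))"
        by (auto intro!: continuous_on_inverse continuous_intros)
      have "H' \<sigma> = (\<lambda>u. cis (- \<sigma> * u) * (- ?J u * inverse (of_real (2 * u))
          + \<i> * of_real \<sigma> * (?B u * inverse (of_real (2 * u)) + ?J u * inverse (of_real (4 * u\<^sup>2)))) * inverse 2)"
        by (rule ext) (simp only: H'_def divide_inverse)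
      then show ?thesis
        by (simp only:) (intro continuous_on_add continuous_on_mult continuous_on_minus continuous_on_bessel_moment
            cB ci continuous_on_cis continuous_on_id continuous_on_const)
    qed
  qed
qed

section \<open>Polar coordinates in the plane\<close>

lemma Basis_vec2: "(Basis :: (real^2) set) = {axis 1 1, axis 2 1}"
  unfolding Basis_vec_def UNIV_2 by auto

lemma borel_measurable_vec2:
  "(\<lambda>p::real\<times>real. vector [fst p, snd p] :: real^2) \<in> borel_measurable borel"
proof -
  have "continuous_on UNIV (\<lambda>p::real\<times>real. vector [fst p, snd p] :: real^2)"
    unfolding continuous_on_componentwise[where 'b="real^2"] Basis_vec2
    by (auto simp: cart_eq_inner_axis[symmetric] intro!: continuous_intros)
  then show ?thesis
    by (rule borel_measurable_continuous_onI)
qed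

text \<open>The polar change of variables takes place in \<open>real^2\<close>, the iterated
  integral in a product of two lines; this identification of Lebesgue measures connects
  them.\<close>

lemma lborel_vec2_eq:
  "(lborel :: (real^2) measure) = distr lborel borel (\<lambda>p::real\<times>real. vector [fst p, snd p])"
proof (rule lborel_eqI)
  have ne: "axis 1 1 \<noteq> (axis 2 1 :: real^2)"
    by (simp add: axis_eq_axis)
  have m [measurable]: "(\<lambda>p::real\<times>real. vector [fst p, snd p] :: real^2) \<in> borel_measurable lborel"
    using borel_measurable_vec2 by simp
  fix l u :: "real^2"
  assume le: "\<And>b. b \<in> Basis \<Longrightarrow> l \<bullet> b \<le> u \<bullet> b"
  have le': "l $ 1 \<le> u $ 1" "l $ 2 \<le> u $ 2"
    using le by (auto simp: Basis_vec2 cart_eq_inner_axis)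
  have "(\<lambda>p::real\<times>real. vector [fst p, snd p] :: real^2) -` box l u = box (l $ 1, l $ 2) (u $ 1, u $ 2)"
    by (auto simp: box_def Basis_vec2 cart_eq_inner_axis[symmetric] Basis_prod_def)
  then have "emeasure (distr lborel borel (\<lambda>p::real\<times>real. vector [fst p, snd p] :: real^2)) (box l u)
      = emeasure lborel (box (l $ 1, l $ 2) (u $ 1, u $ 2))"
    by (subst emeasure_distr) auto
  also have "\<dots> = (\<Prod>b\<in>Basis. ((u $ 1, u $ 2) - (l $ 1, l $ 2)) \<bullet> b)"
    using le' by (intro emeasure_lborel_box) (auto simp: Basis_prod_def)
  also have "(\<Prod>b\<in>Basis. ((u $ 1, u $ 2) - (l $ 1, l $ 2)) \<bullet> b) = (\<Prod>b\<in>Basis. (u - l) \<bullet> b)"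
    unfolding Basis_vec2 using ne by (simp add: Basis_prod_def cart_eq_inner_axis[symmetric])
  finally show "emeasure (distr lborel borel (\<lambda>p::real\<times>real. vector [fst p, snd p] :: real^2)) (box l u)
     = (\<Prod>b\<in>Basis. (u - l) \<bullet> b)" .
qed simp

lemma integral_vec2_rectangle:
  fixes h :: "real \<Rightarrow> real \<Rightarrow> complex"
  assumes h: "continuous_on ({a..b} \<times> {c..d}) (\<lambda>(x, y). h x y)"
  shows "integral {v::real^2. v $ 1 \<in> {a..b} \<and> v $ 2 \<in> {c..d}} (\<lambda>v. h (v $ 1) (v $ 2))
    = integral {a..b} (\<lambda>x. integral {c..d} (h x))"
proof -
  let ?S = "{v::real^2. v $ 1 \<in> {a..b} \<and> v $ 2 \<in> {c..d}}"
  have S: "?S = cbox (vector [a, c]) (vector [b, d])"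
    by (auto simp: cbox_def Basis_vec_def UNIV_2 cart_eq_inner_axis[symmetric])
  have rect: "{a..b} \<times> {c..d} = cbox (a, c) (b, d)"
    by (simp add: cbox_Pair_eq)
  let ?f = "\<lambda>v::real^2. indicator ?S v *\<^sub>R h (v $ 1) (v $ 2)"
  have "continuous_on ?S ((\<lambda>(x, y). h x y) \<circ> (\<lambda>v. (v $ 1, v $ 2)))"
    by (intro continuous_on_compose continuous_intros continuous_on_subset[OF h]) auto
  then have cont: "continuous_on ?S (\<lambda>v. h (v $ 1) (v $ 2))"
    by (simp add: o_def)
  have si: "set_integrable lborel ?S (\<lambda>v. h (v $ 1) (v $ 2))"
    unfolding set_integrable_def by (intro borel_integrable_compact cont) (simp only: S compact_cbox)
  then have fm: "?f \<in> borel_measurable borel"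
    unfolding set_integrable_def by (simp add: borel_measurable_integrable)
  have si2: "set_integrable lborel ({a..b} \<times> {c..d}) (\<lambda>(x, y). h x y)"
    unfolding set_integrable_def by (intro borel_integrable_compact h) (simp add: rect)
  have "integral ?S (\<lambda>v. h (v $ 1) (v $ 2)) = (LINT v|lborel. ?f v)"
    using set_borel_integral_eq_integral(2)[OF si] by (simp add: set_lebesgue_integral_def)
  also have "\<dots> = (LINT p|lborel. ?f (vector [fst p, snd p]))"
    by (subst lborel_vec2_eq, rule integral_distr[OF _ fm]) (simp add: borel_measurable_vec2)
  also have "\<dots> = (LINT p:({a..b} \<times> {c..d})|lborel. (\<lambda>(x, y). h x y) p)"
    unfolding set_lebesgue_integral_def
    by (intro Bochner_Integration.integral_cong) (auto simp: indicator_def)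
  also have "\<dots> = integral (cbox (a, c) (b, d)) (\<lambda>(x, y). h x y)"
    using set_borel_integral_eq_integral(2)[OF si2] by (simp add: rect)
  also have "\<dots> = integral {a..b} (\<lambda>x. integral {c..d} (h x))"
    using h by (subst integral_prod_continuous) (simp_all add: rect)
  finally show ?thesis .
qed

text \<open>The change of variables for vector-valued integrands is used with values in
  \<open>real^1\<close>, separately for the real and the imaginary part.\<close>

lemma integral_change_of_variables_complex:
  fixes f :: "real^'n::{finite,wellorder} \<Rightarrow> complex" and g :: "real^'n::_ \<Rightarrow> real^'n::_"
  assumes S: "S \<in> sets lebesgue"
    and der: "\<And>x. x \<in> S \<Longrightarrow> (g has_derivative g' x) (at x within S)"
    and inj: "inj_on g S"
    and f: "f absolutely_integrable_on (g ` S)"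
  shows "integral (g ` S) f = integral S (\<lambda>x. \<bar>det (matrix (g' x))\<bar> *\<^sub>R f (g x))"
proof -
  have real: "(\<lambda>x. \<bar>det (matrix (g' x))\<bar> * r (g x)) integrable_on S \<and>
      integral (g ` S) r = integral S (\<lambda>x. \<bar>det (matrix (g' x))\<bar> * r (g x))"
    if "r absolutely_integrable_on (g ` S)" for r :: "real^'n::_ \<Rightarrow> real"
  proof -
    have "(\<lambda>x. vec (r x) :: real^1) absolutely_integrable_on (g ` S)"
      using that by (simp add: absolutely_integrable_on_1_iff)
    then show ?thesis
      using has_absolute_integral_change_of_variables[OF S der inj, where f = "\<lambda>x. vec (r x) :: real^1"
          and b = "integral (g ` S) (\<lambda>x. vec (r x) :: real^1)"]
      by (auto simp: absolutely_integrable_on_1_iff integral_on_1_eq vec_eq_iff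
          intro: absolutely_integrable_on_def[THEN iffD1, THEN conjunct1])
  qed
  have fi: "f integrable_on g ` S"
    using f by (simp add: absolutely_integrable_on_def)
  have Re: "(\<lambda>x. Re (f x)) absolutely_integrable_on (g ` S)"
    using absolutely_integrable_linear[OF f bounded_linear_Re] by (simp add: o_def)
  have Im: "(\<lambda>x. Im (f x)) absolutely_integrable_on (g ` S)"
    using absolutely_integrable_linear[OF f bounded_linear_Im] by (simp add: o_def)
  let ?D = "\<lambda>x. \<bar>det (matrix (g' x))\<bar> *\<^sub>R f (g x)"
  have "(\<lambda>x. of_real (\<bar>det (matrix (g' x))\<bar> * Re (f (g x))) + \<i> * of_real (\<bar>det (matrix (g' x))\<bar> * Im (f (g x)))) integrable_on S"
    using conjunct1[OF real[OF Re]] conjunct1[OF real[OF Im]]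
    by (intro integrable_add integrable_on_mult_right)
      (auto dest!: integrable_linear[OF _ bounded_linear_of_real[where 'a=complex]] simp: o_def simp del: of_real_mult)
  moreover have D: "?D = (\<lambda>x. of_real (\<bar>det (matrix (g' x))\<bar> * Re (f (g x))) + \<i> * of_real (\<bar>det (matrix (g' x))\<bar> * Im (f (g x))))"
    by (auto simp: complex_eq_iff)
  ultimately have Di: "?D integrable_on S" by simp
  show ?thesis
  proof (rule complex_eqI)
    show "Re (integral (g ` S) f) = Re (integral S ?D)"
      using real[OF Re] integral_linear[OF fi bounded_linear_Re] integral_linear[OF Di bounded_linear_Re]
      by (simp add: o_def)
    show "Im (integral (g ` S) f) = Im (integral S ?D)"
      using real[OF Im] integral_linear[OF fi bounded_linear_Im] integral_linear[OF Di bounded_linear_Im]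
      by (simp add: o_def)
  qed
qed

text \<open>Polar coordinates with the angle counted from the direction \<beta>. Taking for \<beta>
  the direction of x makes the angular integral a Bessel integral over 0 to 2 pi directly, without a
  shift of a periodic integrand.\<close>

definition polar_map :: "real \<Rightarrow> real^2 \<Rightarrow> real^2" where
  "polar_map \<beta> v = vector [v $ 1 * cos (v $ 2 + \<beta>), v $ 1 * sin (v $ 2 + \<beta>)]"

lemma polar_map_nth [simp]:
  "polar_map \<beta> v $ 1 = v $ 1 * cos (v $ 2 + \<beta>)" "polar_map \<beta> v $ 2 = v $ 1 * sin (v $ 2 + \<beta>)"
  by (simp_all add: polar_map_def)

definition polar_deriv :: "real \<Rightarrow> real^2 \<Rightarrow> real^2 \<Rightarrow> real^2" where
  "polar_deriv \<beta> v h = vector [h $ 1 * cos (v $ 2 + \<beta>) - v $ 1 * sin (v $ 2 + \<beta>) * h $ 2,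
     h $ 1 * sin (v $ 2 + \<beta>) + v $ 1 * cos (v $ 2 + \<beta>) * h $ 2]"

lemma has_derivative_polar_map: "(polar_map \<beta> has_derivative polar_deriv \<beta> v) (at v within S)"
proof -
  have d: "((\<lambda>v. v $ i) has_derivative (\<lambda>h. h $ i)) (at v within S)" for i and v :: "real^2"
    by (rule bounded_linear.has_derivative[OF bounded_linear_vec_nth]) auto
  have 1: "((\<lambda>v. polar_map \<beta> v $ 1) has_derivative (\<lambda>h. polar_deriv \<beta> v h $ 1)) (at v within S)"
    unfolding polar_map_nth polar_deriv_def vector_2
    by (auto intro!: derivative_eq_intros d)
  have 2: "((\<lambda>v. polar_map \<beta> v $ 2) has_derivative (\<lambda>h. polar_deriv \<beta> v h $ 2)) (at v within S)"
    unfolding polar_map_nth polar_deriv_def vector_2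
    by (auto intro!: derivative_eq_intros d)
  show ?thesis
    using 1 2 unfolding has_derivative_componentwise_within[where f="polar_map \<beta>"] Basis_vec_def UNIV_2
    by (auto simp: cart_eq_inner_axis)
qed

lemma det_polar_deriv: "det (matrix (polar_deriv \<beta> v)) = v $ 1"
proof -
  have "det (matrix (polar_deriv \<beta> v))
      = v $ 1 * (cos (v $ 2 + \<beta>) * cos (v $ 2 + \<beta>)) + v $ 1 * (sin (v $ 2 + \<beta>) * sin (v $ 2 + \<beta>))"
    unfolding det_2 matrix_def polar_deriv_def by (simp add: axis_def mult_ac)
  also have "\<dots> = v $ 1"
    unfolding distrib_left[symmetric] by simp
  finally show ?thesis .
qed

lemma norm_vec2: "norm (v :: real^2) = sqrt ((v $ 1)\<^sup>2 + (v $ 2)\<^sup>2)"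
  by (simp add: norm_vec_def L2_set_def sum_2)

lemma inner_vec2: "(v :: real^2) \<bullet> w = v $ 1 * w $ 1 + v $ 2 * w $ 2"
  by (simp add: inner_vec_def sum_2)

lemma norm_polar_map: "norm (polar_map \<beta> v) = \<bar>v $ 1\<bar>"
proof -
  have "(v $ 1 * cos (v $ 2 + \<beta>))\<^sup>2 + (v $ 1 * sin (v $ 2 + \<beta>))\<^sup>2 = (v $ 1)\<^sup>2"
    by (simp add: power_mult_distrib distrib_left[symmetric])
  then show ?thesis
    by (simp add: norm_vec2)
qed

lemma inj_on_polar_map: "inj_on (polar_map \<beta>) {v. 0 < v $ 1 \<and> v $ 2 \<in> {0<..<2*pi}}"
proof (rule inj_onI)
  fix v w :: "real^2"
  assume v: "v \<in> {v. 0 < v $ 1 \<and> v $ 2 \<in> {0<..<2*pi}}"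
    and w: "w \<in> {v. 0 < v $ 1 \<and> v $ 2 \<in> {0<..<2*pi}}" and eq: "polar_map \<beta> v = polar_map \<beta> w"
  have r: "v $ 1 = w $ 1"
    using arg_cong[OF eq, of norm] v w by (simp add: norm_polar_map)
  have "cos (v $ 2 + \<beta>) = cos (w $ 2 + \<beta>)" "sin (v $ 2 + \<beta>) = sin (w $ 2 + \<beta>)"
    using arg_cong[OF eq, of "\<lambda>u. u $ 1"] arg_cong[OF eq, of "\<lambda>u. u $ 2"] r v w by auto
  then obtain n :: int where "v $ 2 + \<beta> = w $ 2 + \<beta> + 2 * pi * n"
    using sin_cos_eq_iff by blast
  then have n: "v $ 2 - w $ 2 = 2 * pi * n" by simp
  have "\<bar>2 * pi * n\<bar> < 2 * pi"
    using v w unfolding n[symmetric] by auto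
  then have "\<bar>real_of_int n\<bar> < 1"
    by (simp add: abs_mult)
  then have "n = 0" by linarith
  then show "v = w"
    using r n by (simp add: vec_eq_iff forall_2)
qed

text \<open>In the frame rotated by \<beta> the hypothesis says that the second coordinate Y is
  nonzero, so the angle is not 0 and lies in the open interval. The excluded set is a whole line
  instead of the half-line of the cut, but it is null all the same.\<close>

lemma polar_map_image:
  assumes "(\<xi> :: real^2) \<bullet> vector [- sin \<beta>, cos \<beta>] \<noteq> 0"
  shows "\<xi> \<in> polar_map \<beta> ` {v. 0 < v $ 1 \<and> v $ 2 \<in> {0<..<2*pi}}"
proof -
  define X Y where "X = \<xi> $ 1 * cos \<beta> + \<xi> $ 2 * sin \<beta>" and "Y = \<xi> $ 2 * cos \<beta> - \<xi> $ 1 * sin \<beta>"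
  have Y: "Y \<noteq> 0"
    using assms by (simp add: inner_vec2 Y_def)
  define r where "r = norm \<xi>"
  have r: "r > 0"
    using assms by (auto simp: r_def)
  have "X\<^sup>2 + Y\<^sup>2 = ((\<xi> $ 1)\<^sup>2 + (\<xi> $ 2)\<^sup>2) * ((sin \<beta>)\<^sup>2 + (cos \<beta>)\<^sup>2)"
  proof -
    have "(p * c + q * s)\<^sup>2 + (q * c - p * s)\<^sup>2 = (p\<^sup>2 + q\<^sup>2) * (s\<^sup>2 + c\<^sup>2)" for p q c s :: real
      by (simp add: power2_eq_square algebra_simps)
    then show ?thesis
      unfolding X_def Y_def by blast
  qed
  then have XY: "X\<^sup>2 + Y\<^sup>2 = r\<^sup>2"
    by (simp add: r_def norm_vec2)
  then have "(X / r)\<^sup>2 + (Y / r)\<^sup>2 = 1"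
    using r by (simp add: power_divide add_divide_distrib[symmetric])
  then obtain t where t: "0 \<le> t" "t < 2*pi" "X / r = cos t" "Y / r = sin t"
    by (rule sincos_total_2pi)
  have "t \<noteq> 0" using Y r t(4) by auto
  have "X * cos \<beta> - Y * sin \<beta> = \<xi> $ 1 * ((sin \<beta>)\<^sup>2 + (cos \<beta>)\<^sup>2)" "X * sin \<beta> + Y * cos \<beta> = \<xi> $ 2 * ((sin \<beta>)\<^sup>2 + (cos \<beta>)\<^sup>2)"
  proof -
    have "(p * c + q * s) * c - (q * c - p * s) * s = p * (s\<^sup>2 + c\<^sup>2)"
      "(p * c + q * s) * s + (q * c - p * s) * c = q * (s\<^sup>2 + c\<^sup>2)" for p q c s :: real
      by (simp_all add: power2_eq_square algebra_simps)
    then show "X * cos \<beta> - Y * sin \<beta> = \<xi> $ 1 * ((sin \<beta>)\<^sup>2 + (cos \<beta>)\<^sup>2)"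
      "X * sin \<beta> + Y * cos \<beta> = \<xi> $ 2 * ((sin \<beta>)\<^sup>2 + (cos \<beta>)\<^sup>2)"
      unfolding X_def Y_def by blast+
  qed
  then have x: "\<xi> $ 1 = X * cos \<beta> - Y * sin \<beta>" "\<xi> $ 2 = X * sin \<beta> + Y * cos \<beta>"
    by simp_all
  have XY: "X = r * cos t" "Y = r * sin t"
    using t r by (simp_all add: field_simps)
  have "\<xi> = polar_map \<beta> (vector [r, t])"
    using x unfolding XY by (simp add: vec_eq_iff forall_2 cos_add sin_add algebra_simps)
  moreover have "(vector [r, t] :: real^2) \<in> {v. 0 < v $ 1 \<and> v $ 2 \<in> {0<..<2*pi}}"
    using r t \<open>t \<noteq> 0\<close> by simp
  ultimately show ?thesis by blast
qed

text \<open>With angles counted from x the phase is |x| r cos \<theta>, and integrating out \<theta>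
  leaves \<open>bessel_moment 0\<close>. The support in a shell with a > 0 gives absolute
  integrability and avoids the singularity of the coordinates at the origin.\<close>

lemma radial_fourier_integral:
  fixes F :: "real \<Rightarrow> complex" and x :: "real^2"
  assumes a: "0 < a" and F: "continuous_on {a..b} F"
    and F0: "\<And>r. r \<ge> 0 \<Longrightarrow> r \<notin> {a..b} \<Longrightarrow> F r = 0"
  shows "integrable lborel (\<lambda>\<xi>. cis (x \<bullet> \<xi>) * F (norm \<xi>))"
    and "(LINT \<xi>|lborel. cis (x \<bullet> \<xi>) * F (norm \<xi>))
      = integral {a..b} (\<lambda>r. of_real r * F r * bessel_moment 0 (r * norm x))"
proof -
  let ?f = "\<lambda>\<xi>. cis (x \<bullet> \<xi>) * F (norm \<xi>)"
  let ?K = "{\<xi>::real^2. norm \<xi> \<in> {a..b}}"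
  have K: "compact ?K"
    unfolding compact_eq_bounded_closed
  proof
    show "bounded ?K" by (rule boundedI[of _ b]) auto
    show "closed ?K" by (auto intro!: closed_Collect_conj closed_Collect_le continuous_intros)
  qed
  have "integrable lborel (\<lambda>\<xi>. indicator ?K \<xi> *\<^sub>R ?f \<xi>)"
    by (intro borel_integrable_compact K continuous_intros continuous_on_compose2[OF F]) auto
  also have "(\<lambda>\<xi>. indicator ?K \<xi> *\<^sub>R ?f \<xi>) = ?f"
    using F0 by (auto simp: fun_eq_iff indicator_def)
  finally show int: "integrable lborel ?f" .
  then have ai: "?f absolutely_integrable_on UNIV"
    by (simp add: set_integrable_def integrable_completion borel_measurable_integrable)
  \<comment> \<open>The polar angle of x; for x = 0 any angle will do.\<close>
  obtain \<beta> where x: "x $ 1 = norm x * cos \<beta>" "x $ 2 = norm x * sin \<beta>"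
  proof (cases "x = 0")
    case False
    have "(x $ 1)\<^sup>2 + (x $ 2)\<^sup>2 = (norm x)\<^sup>2"
      by (simp add: norm_vec2)
    then have "(x $ 1 / norm x)\<^sup>2 + (x $ 2 / norm x)\<^sup>2 = 1"
      using False by (simp add: power_divide add_divide_distrib[symmetric])
    then obtain t where "x $ 1 / norm x = cos t" "x $ 2 / norm x = sin t"
      using sincos_total_2pi by metis
    then show ?thesis
      using False that[of t] by (simp add: field_simps)
  qed (auto intro: that[of 0])
  let ?S = "{v::real^2. 0 < v $ 1 \<and> v $ 2 \<in> {0<..<2*pi}}"
  let ?R = "{v::real^2. v $ 1 \<in> {a..b} \<and> v $ 2 \<in> {0..2*pi}}"
  define h where "h r \<theta> = of_real r * F r * cis (r * norm x * cos \<theta>)" for r \<theta>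
  have "open ?S"
  proof -
    have "?S = {v. 0 < v $ 1} \<inter> ({v. 0 < v $ 2} \<inter> {v. v $ 2 < 2*pi})"
      by auto
    then show ?thesis
      by (simp only:) (intro open_Int open_Collect_less continuous_on_const continuous_intros)
  qed
  then have S: "?S \<in> sets lebesgue"
    by (intro sets_completionI_sets) simp
  have dS: "polar_map \<beta> differentiable_on ?S"
    unfolding differentiable_on_def differentiable_def using has_derivative_polar_map by blast
  have gS: "polar_map \<beta> ` ?S \<in> sets lebesgue"
    by (rule differentiable_image_in_sets_lebesgue[OF S _ dS]) simp
  have neg: "negligible {\<xi>::real^2. vector [- sin \<beta>, cos \<beta>] \<bullet> \<xi> = 0}"
  proof (rule negligible_hyperplane)
    have "(vector [- sin \<beta>, cos \<beta>] :: real^2) $ 1 \<noteq> 0 \<or> (vector [- sin \<beta>, cos \<beta>] :: real^2) $ 2 \<noteq> 0"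
      using sin_cos_squared_add[of \<beta>] by (auto simp del: sin_cos_squared_add)
    then show "vector [- sin \<beta>, cos \<beta>] \<noteq> (0::real^2) \<or> 0 \<noteq> (0::real)"
      by (metis zero_index)
  qed
  have "(LINT \<xi>|lborel. ?f \<xi>) = integral UNIV ?f"
    using integral_lborel[OF int] by simp
  also have "\<dots> = integral (polar_map \<beta> ` ?S) ?f"
    using polar_map_image[of _ \<beta>]
    by (intro integral_spike_set negligible_subset[OF neg]) (auto simp: inner_commute)
  also have "\<dots> = integral ?S (\<lambda>v. \<bar>det (matrix (polar_deriv \<beta> v))\<bar> *\<^sub>R ?f (polar_map \<beta> v))"
    by (intro integral_change_of_variables_complex S has_derivative_polar_map inj_on_polar_map
        set_integrable_subset[OF ai] gS) auto
  also have "\<dots> = integral ?S (\<lambda>v. h (v $ 1) (v $ 2))"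
  proof (rule integral_cong)
    fix v assume v: "v \<in> ?S"
    have "x \<bullet> polar_map \<beta> v = norm x * (v $ 1 * (cos \<beta> * cos (v $ 2 + \<beta>) + sin \<beta> * sin (v $ 2 + \<beta>)))"
      by (subst inner_vec2, subst x(1), subst x(2)) (simp add: algebra_simps)
    also have "cos \<beta> * cos (v $ 2 + \<beta>) + sin \<beta> * sin (v $ 2 + \<beta>) = cos (v $ 2)"
      using cos_diff[of "v $ 2 + \<beta>" \<beta>] by (simp add: mult.commute)
    finally show "\<bar>det (matrix (polar_deriv \<beta> v))\<bar> *\<^sub>R ?f (polar_map \<beta> v) = h (v $ 1) (v $ 2)"
      using v by (simp add: det_polar_deriv norm_polar_map h_def scaleR_conv_of_real mult_ac)
  qed
  \<comment> \<open>The strip and the rectangle differ by points where F vanishes and by the null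
    lines of angle 0 and 2 pi; since a > 0, the rectangle has no points with nonpositive
    radius.\<close>
  also have "\<dots> = integral ?R (\<lambda>v. h (v $ 1) (v $ 2))"
  proof (rule integral_spike_set)
    have "h (v $ 1) (v $ 2) = 0" if "v \<in> ?S - ?R" for v
    proof -
      have "v $ 1 \<ge> 0" "v $ 1 \<notin> {a..b}"
        using that by auto
      then show ?thesis
        using F0[of "v $ 1"] by (simp add: h_def)
    qed
    then have "{v \<in> ?S - ?R. h (v $ 1) (v $ 2) \<noteq> 0} = {}"
      by blast
    then show "negligible {v \<in> ?S - ?R. h (v $ 1) (v $ 2) \<noteq> 0}"
      by (simp only: negligible_empty)
    have "negligible ({v::real^2. axis 2 1 \<bullet> v = 0} \<union> {v::real^2. axis 2 1 \<bullet> v = 2 * pi})"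
      by (intro negligible_Un negligible_hyperplane) (auto simp: axis_eq_0_iff)
    then show "negligible {v \<in> ?R - ?S. h (v $ 1) (v $ 2) \<noteq> 0}"
      by (rule negligible_subset) (use a in \<open>auto simp: cart_eq_inner_axis inner_commute\<close>)
  qed
  also have "\<dots> = integral {a..b} (\<lambda>r. integral {0..2*pi} (h r))"
  proof (rule integral_vec2_rectangle)
    show "continuous_on ({a..b} \<times> {0..2 * pi}) (\<lambda>(r, \<theta>). h r \<theta>)"
      unfolding h_def case_prod_beta
      by (intro continuous_intros continuous_on_compose2[OF F]) auto
  qed
  also have "\<dots> = integral {a..b} (\<lambda>r. of_real r * F r * bessel_moment 0 (r * norm x))"
    unfolding h_def bessel_moment_def by (intro integral_cong) simp
  finally show "(LINT \<xi>|lborel. ?f \<xi>) = integral {a..b} (\<lambda>r. of_real r * F r * bessel_moment 0 (r * norm x))" .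
qed

section \<open>Oscillatory integrals on one dyadic scale\<close>

lemma has_vector_derivative_imp_continuous_on:
  assumes "\<And>x. x \<in> S \<Longrightarrow> (f has_vector_derivative f' x) (at x)"
  shows "continuous_on S f"
proof (intro continuous_at_imp_continuous_on ballI)
  fix x assume "x \<in> S"
  then show "isCont f x"
    by (rule has_vector_derivative_continuous[OF assms])
qed

lemma one_sided_bound_mult:
  fixes f :: "'a \<Rightarrow> real"
  assumes "(\<forall>r\<in>S. f r \<ge> \<rho>) \<or> (\<forall>r\<in>S. f r \<le> - \<rho>)"
  shows "(\<forall>r\<in>S. \<tau> * f r \<ge> \<bar>\<tau>\<bar> * \<rho>) \<or> (\<forall>r\<in>S. \<tau> * f r \<le> - (\<bar>\<tau>\<bar> * \<rho>))"
proof (cases "\<tau> \<ge> 0")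
  case True
  then show ?thesis
    using assms mult_left_mono[of \<rho> _ \<tau>] mult_left_mono[of _ "- \<rho>" \<tau>] by auto
next
  case False
  then show ?thesis
    using assms mult_left_mono_neg[of \<rho> _ \<tau>] mult_left_mono_neg[of _ "- \<rho>" \<tau>] by auto
qed

text \<open>The bump \<open>p\<close> stands both for P and for the Littlewood-Paley function Q_0,
  so that one argument serves the two families of integrals. Its support is described on the
  positive half-line, where the values r / R lie.\<close>

locale dyadic_oscillation =
  fixes g g1 g2 p p' :: "real \<Rightarrow> real" and lam y1 \<alpha> s :: real
  assumes lam: "lam > 0" and y1: "y1 > 0" and \<alpha>: "\<alpha> < -1"
    and g1: "\<And>y. y > 0 \<Longrightarrow> (g has_real_derivative g1 y) (at y)"
    and g2: "\<And>y. y > 0 \<Longrightarrow> (g1 has_real_derivative g2 y) (at y)"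
    and cont_g2: "continuous_on {0<..} g2"
    and g1_ge: "\<And>y. y \<ge> y1 \<Longrightarrow> lam \<le> \<bar>g1 y\<bar>"
    and g2_ge: "\<And>y. y \<ge> y1 \<Longrightarrow> lam * y powr \<alpha> \<le> \<bar>g2 y\<bar>"
    and p': "\<And>y. (p has_real_derivative p' y) (at y)"
    and cont_p': "continuous_on UNIV p'"
    and p_supp: "\<And>y. y > 0 \<Longrightarrow> y \<notin> {1/2..2} \<Longrightarrow> p y = 0"
begin

text \<open>The exponent s + 1 is s plus the polar Jacobian; powers of \<delta> have been scaled
  out.\<close>

definition radial_integral :: "real \<Rightarrow> real \<Rightarrow> real \<Rightarrow> complex" where
  "radial_integral \<tau> X R = integral {R/2..2*R}
     (\<lambda>r. of_real (r powr (s + 1) * p (r / R)) * cis (\<tau> * g r) * bessel_moment 0 (r * X))"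

text \<open>\<open>p_supp\<close> says nothing at the endpoint itself; continuity supplies the
  value, and with it the vanishing boundary term at r = 2 R.\<close>

lemma p_2: "p 2 = 0"
proof -
  have "p \<midarrow>2\<rightarrow> p 2"
    using DERIV_isCont[OF p'] by (simp add: isCont_def)
  then have "(p \<longlongrightarrow> p 2) (at_right 2)"
    by (simp add: filterlim_at_split)
  moreover have "\<forall>\<^sub>F y in at_right 2. p y = 0"
    using eventually_at_right_less[of 2] by eventually_elim (auto intro: p_supp)
  then have "(p \<longlongrightarrow> 0) (at_right 2)"
    by (simp add: tendsto_eventually)
  ultimately show ?thesis
    using tendsto_unique trivial_limit_at_right_real by blast
qed

text \<open>A change of sign would force a zero of the continuous g2 beyond y1, where its modulus is
  bounded below by a positive quantity. This is the monotonicity that the first derivative test asks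
  for.\<close>

lemma g2_sign: "(\<forall>y\<ge>y1. g2 y \<ge> lam * y powr \<alpha>) \<or> (\<forall>y\<ge>y1. g2 y \<le> - (lam * y powr \<alpha>))"
proof (rule ccontr)
  assume "\<not> ?thesis"
  then obtain a b where a: "a \<ge> y1" "g2 a < lam * a powr \<alpha>" and b: "b \<ge> y1" "g2 b > - (lam * b powr \<alpha>)"
    by (auto simp: not_le)
  have pos: "lam * y powr \<alpha> > 0" if "y \<ge> y1" for y
    using lam y1 that by simp
  have sa: "g2 a < 0" and sb: "g2 b > 0"
    using a b g2_ge[OF a(1)] g2_ge[OF b(1)] by (auto simp: abs_if split: if_splits)
  have cont: "continuous_on S g2" if "S \<subseteq> {y1..}" for S
    using y1 that by (intro continuous_on_subset[OF cont_g2]) auto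
  have "\<exists>z\<ge>y1. g2 z = 0"
  proof (cases "a \<le> b")
    case True
    then obtain z where "a \<le> z" "g2 z = 0"
      using IVT'[of g2 a 0 b] sa sb a b cont[of "{a..b}"] by auto
    then show ?thesis
      using a by (intro exI[of _ z]) auto
  next
    case False
    then obtain z where "b \<le> z" "g2 z = 0"
      using IVT2'[of g2 a 0 b] sa sb a b cont[of "{b..a}"] by auto
    then show ?thesis
      using b by (intro exI[of _ z]) auto
  qed
  then obtain z where z: "z \<ge> y1" "g2 z = 0" by blast
  show False
    using g2_ge[OF z(1)] pos[OF z(1)] z(2) by simp
qed

lemma continuous_on_g:
  assumes "S \<subseteq> {0<..}"
  shows "continuous_on S g"
proof (intro continuous_at_imp_continuous_on ballI)
  fix y assume "y \<in> S"
  then show "isCont g y"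
    using assms by (intro DERIV_isCont[OF g1]) auto
qed

section \<open>Phase integrals without amplitude\<close>

lemma phase_derivs:
  assumes "r > 0"
  shows "((\<lambda>r. \<tau> * g r + \<sigma> * r) has_real_derivative \<tau> * g1 r + \<sigma>) (at r)"
    and "((\<lambda>r. \<tau> * g1 r + \<sigma>) has_real_derivative \<tau> * g2 r) (at r)"
proof -
  have "((\<lambda>r. \<tau> * g r) has_real_derivative \<tau> * g1 r) (at r)"
    by (intro DERIV_cmult g1 assms)
  moreover have "((\<lambda>r. \<sigma> * r) has_real_derivative \<sigma> * 1) (at r)"
    by (intro DERIV_cmult DERIV_ident)
  ultimately show "((\<lambda>r. \<tau> * g r + \<sigma> * r) has_real_derivative \<tau> * g1 r + \<sigma>) (at r)"
    using DERIV_add by fastforce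
  have "((\<lambda>r. \<tau> * g1 r) has_real_derivative \<tau> * g2 r) (at r)"
    by (intro DERIV_cmult g2 assms)
  from DERIV_add[OF this DERIV_const[of \<sigma>]]
  show "((\<lambda>r. \<tau> * g1 r + \<sigma>) has_real_derivative \<tau> * g2 r) (at r)"
    by simp
qed

text \<open>The condition R \<ge> 2 y1 places the whole shell in the range where the hypotheses on g
  apply.\<close>

lemma phase_integral_bound_1:
  assumes R: "R \<ge> 2 * y1" and r0: "r0 \<in> {R/2..2*R}" and \<mu>: "\<mu> > 0"
    and lb: "\<And>r. r \<in> {R/2..2*R} \<Longrightarrow> \<mu> \<le> \<bar>\<tau> * g1 r + \<sigma>\<bar>"
  shows "norm (integral {R/2..r0} (\<lambda>r. cis (\<tau> * g r + \<sigma> * r))) \<le> 4 / \<mu>"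
proof (rule van_der_corput_1[where \<phi>'="\<lambda>r. \<tau> * g1 r + \<sigma>" and \<phi>''="\<lambda>r. \<tau> * g2 r"])
  have pos: "r > 0" "r \<ge> y1" if "r \<in> {R/2..r0}" for r
    using R y1 that by auto
  show "((\<lambda>r. \<tau> * g r + \<sigma> * r) has_real_derivative \<tau> * g1 r + \<sigma>) (at r)"
    "((\<lambda>r. \<tau> * g1 r + \<sigma>) has_real_derivative \<tau> * g2 r) (at r)" if "r \<in> {R/2..r0}" for r
    using phase_derivs pos[OF that] by auto
  show "continuous_on {R/2..r0} (\<lambda>r. \<tau> * g2 r)"
    using pos by (intro continuous_intros continuous_on_subset[OF cont_g2]) auto
  have "(\<forall>r\<in>{R/2..r0}. g2 r \<ge> 0) \<or> (\<forall>r\<in>{R/2..r0}. g2 r \<le> 0)"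
    using g2_sign
  proof
    assume *: "\<forall>y\<ge>y1. g2 y \<ge> lam * y powr \<alpha>"
    have "g2 r \<ge> 0" if "r \<in> {R/2..r0}" for r
      using pos[OF that] * lam by (intro order_trans[OF _ *[rule_format]]) auto
    then show ?thesis by blast
  next
    assume *: "\<forall>y\<ge>y1. g2 y \<le> - (lam * y powr \<alpha>)"
    have "g2 r \<le> 0" if "r \<in> {R/2..r0}" for r
      using pos[OF that] * lam by (intro order_trans[OF *[rule_format]]) auto
    then show ?thesis by blast
  qed
  then show "(\<forall>r\<in>{R/2..r0}. \<tau> * g2 r \<ge> 0) \<or> (\<forall>r\<in>{R/2..r0}. \<tau> * g2 r \<le> 0)"
    using one_sided_bound_mult[of "{R/2..r0}" 0 g2 \<tau>] by simp
qed (use r0 \<mu> lb in auto)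

text \<open>The linear term drops out of the second derivative, so the bound is uniform in \<sigma>,
  that is, in x. As \<alpha> is negative, the lower bound for g2 is weakest at the right end 2
  R.\<close>

lemma phase_integral_bound_2:
  assumes R: "R \<ge> 2 * y1" and r0: "r0 \<in> {R/2..2*R}" and \<tau>: "\<tau> \<noteq> 0"
  shows "norm (integral {R/2..r0} (\<lambda>r. cis (\<tau> * g r + \<sigma> * r))) \<le> 10 / sqrt (\<bar>\<tau>\<bar> * (lam * (2 * R) powr \<alpha>))"
proof (rule van_der_corput_2[where \<phi>'="\<lambda>r. \<tau> * g1 r + \<sigma>" and \<phi>''="\<lambda>r. \<tau> * g2 r"])
  have pos: "r > 0" "r \<ge> y1" if "r \<in> {R/2..r0}" for r
    using R y1 that by auto
  show "((\<lambda>r. \<tau> * g r + \<sigma> * r) has_real_derivative \<tau> * g1 r + \<sigma>) (at r)"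
    "((\<lambda>r. \<tau> * g1 r + \<sigma>) has_real_derivative \<tau> * g2 r) (at r)" if "r \<in> {R/2..r0}" for r
    using phase_derivs pos[OF that] by auto
  show "continuous_on {R/2..r0} (\<lambda>r. \<tau> * g2 r)"
    using pos by (intro continuous_intros continuous_on_subset[OF cont_g2]) auto
  have R0: "R > 0" using R y1 by simp
  let ?\<rho> = "lam * (2 * R) powr \<alpha>"
  have rho: "?\<rho> \<le> lam * r powr \<alpha>" if "r \<in> {R/2..r0}" for r
    using pos[OF that] that r0 lam \<alpha> by (intro mult_left_mono powr_mono2') auto
  have "(\<forall>r\<in>{R/2..r0}. g2 r \<ge> ?\<rho>) \<or> (\<forall>r\<in>{R/2..r0}. g2 r \<le> - ?\<rho>)"
    using g2_sign
  proof
    assume *: "\<forall>y\<ge>y1. g2 y \<ge> lam * y powr \<alpha>"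
    have "g2 r \<ge> ?\<rho>" if "r \<in> {R/2..r0}" for r
      using pos[OF that] * rho[OF that] by force
    then show ?thesis by blast
  next
    assume *: "\<forall>y\<ge>y1. g2 y \<le> - (lam * y powr \<alpha>)"
    have "g2 r \<le> - ?\<rho>" if "r \<in> {R/2..r0}" for r
      using pos[OF that] * rho[OF that] by force
    then show ?thesis by blast
  qed
  then show "(\<forall>r\<in>{R/2..r0}. \<tau> * g2 r \<ge> \<bar>\<tau>\<bar> * ?\<rho>) \<or> (\<forall>r\<in>{R/2..r0}. \<tau> * g2 r \<le> - (\<bar>\<tau>\<bar> * ?\<rho>))"
    by (rule one_sided_bound_mult)
  show "\<bar>\<tau>\<bar> * ?\<rho> > 0"
    using \<tau> lam R0 by simp
qed (use r0 in auto)

lemma phase_integral_trivial_bound: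
  assumes R: "R \<ge> 2 * y1" and r0: "r0 \<in> {R/2..2*R}"
  shows "norm (integral {R/2..r0} (\<lambda>r. cis (\<tau> * g r + \<sigma> * r))) \<le> 2 * R"
proof -
  have R0: "R > 0" using R y1 by simp
  have "continuous_on {R/2..r0} g"
    using R0 by (intro continuous_on_g) auto
  then have "norm (integral {R/2..r0} (\<lambda>r. cis (\<tau> * g r + \<sigma> * r))) \<le> 1 * (r0 - R/2)"
    using r0 by (intro integral_bound continuous_intros) auto
  then show ?thesis
    using r0 R0 by auto
qed

text \<open>An amplitude that varies on the scale R loses a factor 1/R upon differentiation, and the
  length of the interval gives it back. The factor h will be the Bessel factor, and D remains free
  so that the length of the interval or either derivative test can be inserted.\<close>

lemma amplitude_bound:
  obtains A where "A > 0"
    "\<And>R \<tau> \<sigma> h h' m D. \<lbrakk>R \<ge> 2 * y1; m \<ge> 0;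
        \<And>r. r \<in> {R/2..2*R} \<Longrightarrow> (h has_vector_derivative h' r) (at r);
        continuous_on {R/2..2*R} h';
        \<And>r. r \<in> {R/2..2*R} \<Longrightarrow> norm (h r) \<le> m;
        \<And>r. r \<in> {R/2..2*R} \<Longrightarrow> norm (h' r) \<le> m / R;
        \<And>r0. r0 \<in> {R/2..2*R} \<Longrightarrow> norm (integral {R/2..r0} (\<lambda>r. cis (\<tau> * g r + \<sigma> * r))) \<le> D\<rbrakk> \<Longrightarrow>
      norm (integral {R/2..2*R} (\<lambda>r. (of_real (r powr (s + 1) * p (r / R)) * h r) * cis (\<tau> * g r + \<sigma> * r)))
        \<le> A * R powr (s + 1) * m * D"
proof -
  have cp: "continuous_on UNIV p"
    using p' by (meson DERIV_isCont continuous_at_imp_continuous_on)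
  have "compact (p ` {1/2..2})" "compact (p' ` {1/2..2})"
    by (intro compact_continuous_image continuous_on_subset[OF cp] continuous_on_subset[OF cont_p'] compact_Icc; simp)+
  then have "bounded (p ` {1/2..2})" "bounded (p' ` {1/2..2})"
    by (simp_all add: compact_imp_bounded)
  then obtain B1 B2 where B1: "\<And>y. y \<in> {1/2..2} \<Longrightarrow> norm (p y) \<le> B1"
    and B2: "\<And>y. y \<in> {1/2..2} \<Longrightarrow> norm (p' y) \<le> B2"
    unfolding bounded_iff by blast
  define B where "B = max 1 (max B1 B2)"
  \<comment> \<open>The ratio r / R lies in [1/2, 2], so its s-th power is at most
    \<open>2 powr \<bar>s\<bar>\<close> for either sign of s.\<close>
  define c where "c = 2 powr \<bar>s\<bar>"
  \<comment> \<open>Differentiating the power of r contributes \<open>\<bar>s + 1\<bar>\<close>,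
    differentiating \<open>p\<close> contributes 2, and differentiating h another 2.\<close>
  define A0 where "A0 = (\<bar>s + 1\<bar> + 4) * (c * B)"
  have B: "\<bar>p y\<bar> \<le> B" "\<bar>p' y\<bar> \<le> B" if "y \<in> {1/2..2}" for y
    using B1[OF that] B2[OF that] by (auto simp: B_def)
  have B0: "B > 0" and c0: "c > 0" by (auto simp: B_def c_def)
  have A0: "A0 > 0" unfolding A0_def using B0 c0 by (intro mult_pos_pos) auto
  show thesis
  proof (rule that[of "3/2 * A0"])
    show "3/2 * A0 > 0" using A0 by simp
    fix R \<tau> \<sigma> m D :: real and h h' :: "real \<Rightarrow> complex"
    assume R: "R \<ge> 2 * y1" and m: "m \<ge> 0"
      and dh: "\<And>r. r \<in> {R/2..2*R} \<Longrightarrow> (h has_vector_derivative h' r) (at r)"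
      and ch': "continuous_on {R/2..2*R} h'"
      and hm: "\<And>r. r \<in> {R/2..2*R} \<Longrightarrow> norm (h r) \<le> m"
      and h'm: "\<And>r. r \<in> {R/2..2*R} \<Longrightarrow> norm (h' r) \<le> m / R"
      and D: "\<And>r0. r0 \<in> {R/2..2*R} \<Longrightarrow> norm (integral {R/2..r0} (\<lambda>r. cis (\<tau> * g r + \<sigma> * r))) \<le> D"
    have R0: "R > 0" using R y1 by simp
    have cg: "continuous_on {R/2..2*R} g"
      using R0 by (intro continuous_on_g) auto
    have ch: "continuous_on {R/2..2*R} h"
      using dh by (intro has_vector_derivative_imp_continuous_on)
    define a where "a r = r powr (s + 1) * p (r / R)" for r
    define a' where "a' r = (s + 1) * r powr s * p (r / R) + r powr (s + 1) * (p' (r / R) / R)" for r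
    have da: "(a has_real_derivative a' r) (at r)" if "r \<in> {R/2..2*R}" for r
    proof -
      have r: "r > 0" using that R0 by auto
      have 1: "((\<lambda>r. r powr (s + 1)) has_real_derivative (s + 1) * r powr s) (at r)"
        using has_real_derivative_powr[OF r, of "s + 1"] by simp
      have 2: "((\<lambda>r. p (r / R)) has_real_derivative p' (r / R) * (1 / R)) (at r)"
        by (rule DERIV_chain2[OF p']) (use R0 in \<open>auto intro!: derivative_eq_intros\<close>)
      show ?thesis
        unfolding a_def[abs_def] a'_def using DERIV_mult[OF 1 2] by (simp add: algebra_simps)
    qed
    have ca: "continuous_on {R/2..2*R} a" "continuous_on {R/2..2*R} a'"
      unfolding a_def[abs_def] a'_def[abs_def] using R0
      by (auto intro!: continuous_intros continuous_on_compose2[OF cp] continuous_on_compose2[OF cont_p'])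
    have rs: "r powr s \<le> c * R powr s" if "r \<in> {R/2..2*R}" for r
    proof -
      have r: "r > 0" using that R0 by auto
      have "(r / R) powr s \<le> c"
      proof (cases "s \<ge> 0")
        case True
        then have "(r / R) powr s \<le> 2 powr s"
          using that r R0 by (intro powr_mono2) (auto simp: field_simps)
        then show ?thesis using True by (simp add: c_def)
      next
        case False
        then have "(r / R) powr s \<le> (1/2) powr s"
          using that r R0 by (intro powr_mono2') (auto simp: field_simps)
        also have "\<dots> = 2 powr \<bar>s\<bar>"
          using False by (simp add: powr_divide powr_minus field_simps)
        finally show ?thesis by (simp add: c_def)
      qed
      then show ?thesis
        using r R0 by (simp add: powr_divide field_simps)
    qed
    have pB: "\<bar>p (r / R)\<bar> \<le> B" "\<bar>p' (r / R)\<bar> \<le> B" if "r \<in> {R/2..2*R}" for r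
      using that R0 by (intro B; auto simp: field_simps)+
    have rs1: "r powr (s + 1) \<le> 2 * c * (R * R powr s)" if "r \<in> {R/2..2*R}" for r
    proof -
      have r: "r > 0" using that R0 by auto
      have "r powr (s + 1) = r * r powr s" using r by (simp add: powr_add)
      also have "\<dots> \<le> (2 * R) * (c * R powr s)"
        using that R0 rs[OF that] by (intro mult_mono) auto
      finally show ?thesis by (simp add: mult_ac)
    qed
    have ab: "\<bar>a r\<bar> \<le> 2 * c * (R * R powr s) * B" if "r \<in> {R/2..2*R}" for r
      unfolding a_def abs_mult using rs1[OF that] pB[OF that] R0 c0
      by (intro mult_mono) auto
    have a'b: "\<bar>a' r\<bar> \<le> (\<bar>s + 1\<bar> + 2) * (c * B) * R powr s" if "r \<in> {R/2..2*R}" for r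
    proof -
      have "\<bar>(s + 1) * r powr s * p (r / R)\<bar> \<le> \<bar>s + 1\<bar> * (c * R powr s) * B"
        unfolding abs_mult using rs[OF that] pB[OF that] c0 by (intro mult_mono) auto
      moreover have "\<bar>r powr (s + 1) * (p' (r / R) / R)\<bar> \<le> 2 * c * (R * R powr s) * (B / R)"
        unfolding abs_mult using rs1[OF that] pB[OF that] R0 c0
        by (intro mult_mono) (auto simp: abs_div divide_right_mono)
      moreover have "2 * c * (R * R powr s) * (B / R) = 2 * c * R powr s * B"
        using R0 by simp
      ultimately show ?thesis
        unfolding a'_def by (intro order_trans[OF abs_triangle_ineq]) (simp add: algebra_simps)
    qed
    define \<psi> where "\<psi> r = of_real (a r) * h r" for r
    define \<psi>' where "\<psi>' r = of_real (a r) * h' r + of_real (a' r) * h r" for r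
    have "norm (integral {R/2..2*R} (\<lambda>r. \<psi> r * cis (\<tau> * g r + \<sigma> * r)))
        \<le> D * (A0 * R powr s * m) * (2 * R - R / 2)"
    proof (rule oscillatory_amplitude_bound[where \<psi>'=\<psi>'])
      show "\<psi> (2 * R) = 0"
        using R0 by (simp add: \<psi>_def a_def p_2)
      show "continuous_on {R/2..2*R} (\<lambda>r. cis (\<tau> * g r + \<sigma> * r))"
        by (intro continuous_intros cg)
      show "continuous_on {R/2..2*R} \<psi>'"
        unfolding \<psi>'_def[abs_def] by (intro continuous_intros ca ch ch')
      fix r assume r: "r \<in> {R/2..2*R}"
      show "(\<psi> has_vector_derivative \<psi>' r) (at r)"
        unfolding \<psi>_def[abs_def] \<psi>'_def
        by (intro has_vector_derivative_mult has_vector_derivative_of_real da dh r)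
      have "norm (\<psi>' r) \<le> (2 * c * (R * R powr s) * B) * (m / R) + ((\<bar>s + 1\<bar> + 2) * (c * B) * R powr s) * m"
        unfolding \<psi>'_def
      proof (intro order_trans[OF norm_triangle_ineq] add_mono)
        show "norm (of_real (a r) * h' r) \<le> (2 * c * (R * R powr s) * B) * (m / R)"
          unfolding norm_mult norm_of_real using ab[OF r] h'm[OF r] c0 B0 R0 by (intro mult_mono) auto
        show "norm (of_real (a' r) * h r) \<le> ((\<bar>s + 1\<bar> + 2) * (c * B) * R powr s) * m"
          unfolding norm_mult norm_of_real using a'b[OF r] hm[OF r] c0 B0 by (intro mult_mono) auto
      qed
      also have "(2 * c * (R * R powr s) * B) * (m / R) = 2 * (c * B) * R powr s * m"
        using R0 by simp
      also have "2 * (c * B) * R powr s * m + ((\<bar>s + 1\<bar> + 2) * (c * B) * R powr s) * m = A0 * R powr s * m"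
        by (simp add: A0_def algebra_simps)
      finally show "norm (\<psi>' r) \<le> A0 * R powr s * m" .
    qed (use D R0 in auto)
    also have "D * (A0 * R powr s * m) * (2 * R - R / 2) = 3/2 * A0 * R powr (s + 1) * m * D"
      using R0 by (simp add: powr_add)
    finally show "norm (integral {R/2..2*R} (\<lambda>r. (of_real (r powr (s + 1) * p (r / R)) * h r) * cis (\<tau> * g r + \<sigma> * r)))
        \<le> 3/2 * A0 * R powr (s + 1) * m * D"
      unfolding \<psi>_def a_def .
  qed
qed

text \<open>If R X \<le> 1, the Bessel factor varies on the scale R and belongs to the amplitude. If
  R X \<ge> 1, its two oscillating exponentials join the phase, and the slowly varying factors H
  keep the decay (R X)^(-1/2).\<close>

lemma radial_integral_bound:
  obtains A where "A > 0"
    "\<And>R \<tau> X D. \<lbrakk>R \<ge> 2 * y1; X \<ge> 0; R * X \<le> 1;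
        \<And>r0. r0 \<in> {R/2..2*R} \<Longrightarrow> norm (integral {R/2..r0} (\<lambda>r. cis (\<tau> * g r + 0 * r))) \<le> D\<rbrakk> \<Longrightarrow>
      norm (radial_integral \<tau> X R) \<le> A * R powr (s + 1) * D"
    "\<And>R \<tau> X D. \<lbrakk>R \<ge> 2 * y1; X \<ge> 0; R * X \<ge> 1;
        \<And>\<sigma> r0. \<sigma>\<^sup>2 = 1 \<Longrightarrow> r0 \<in> {R/2..2*R} \<Longrightarrow> norm (integral {R/2..r0} (\<lambda>r. cis (\<tau> * g r + (\<sigma> * X) * r))) \<le> D\<rbrakk> \<Longrightarrow>
      norm (radial_integral \<tau> X R) \<le> A * R powr (s + 1) * D / sqrt (R * X)"
proof -
  obtain A where A: "A > 0" and amp: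
    "\<And>R \<tau> \<sigma> h h' m D. \<lbrakk>R \<ge> 2 * y1; m \<ge> 0;
        \<And>r. r \<in> {R/2..2*R} \<Longrightarrow> (h has_vector_derivative h' r) (at r);
        continuous_on {R/2..2*R} h';
        \<And>r. r \<in> {R/2..2*R} \<Longrightarrow> norm (h r) \<le> m;
        \<And>r. r \<in> {R/2..2*R} \<Longrightarrow> norm (h' r) \<le> m / R;
        \<And>r0. r0 \<in> {R/2..2*R} \<Longrightarrow> norm (integral {R/2..r0} (\<lambda>r. cis (\<tau> * g r + \<sigma> * r))) \<le> D\<rbrakk> \<Longrightarrow>
      norm (integral {R/2..2*R} (\<lambda>r. (of_real (r powr (s + 1) * p (r / R)) * h r) * cis (\<tau> * g r + \<sigma> * r)))
        \<le> A * R powr (s + 1) * m * D"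
    using amplitude_bound by blast
  show thesis
  proof (rule bessel_decomposition)
    fix K :: real and H H' :: "real \<Rightarrow> real \<Rightarrow> complex"
    assume K: "K > 0"
      and H: "\<And>u. u \<ge> 1/2 \<Longrightarrow> bessel_moment 0 u = cis u * H 1 u + cis (- u) * H (-1) u"
      and dH: "\<And>\<sigma> u. \<sigma>\<^sup>2 = 1 \<Longrightarrow> u \<ge> 1/2 \<Longrightarrow> (H \<sigma> has_vector_derivative H' \<sigma> u) (at u)"
      and cH': "\<And>\<sigma>. continuous_on {1/2..} (H' \<sigma>)"
      and Hb: "\<And>\<sigma> u. \<sigma>\<^sup>2 = 1 \<Longrightarrow> u \<ge> 1/2 \<Longrightarrow> norm (H \<sigma> u) \<le> K / sqrt u"
      and H'b: "\<And>\<sigma> u. \<sigma>\<^sup>2 = 1 \<Longrightarrow> u \<ge> 1/2 \<Longrightarrow> norm (H' \<sigma> u) \<le> K / (u * sqrt u)"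
    define A' where "A' = max (A * (2 * pi)) (2 * (A * (4 * K)))"
    show thesis
    proof (rule that[of A'])
      show "A' > 0" using A by (auto simp: A'_def less_max_iff_disj)
    next
      fix R \<tau> X D :: real
      assume R: "R \<ge> 2 * y1" and X: "X \<ge> 0" and RX: "R * X \<le> 1"
        and D: "\<And>r0. r0 \<in> {R/2..2*R} \<Longrightarrow> norm (integral {R/2..r0} (\<lambda>r. cis (\<tau> * g r + 0 * r))) \<le> D"
      have R0: "R > 0" using R y1 by simp
      have "D \<ge> 0" using D[of R] R0 by (auto intro: order_trans[OF norm_ge_zero])
      have "norm (integral {R/2..2*R} (\<lambda>r. (of_real (r powr (s + 1) * p (r / R)) * bessel_moment 0 (r * X)) * cis (\<tau> * g r + 0 * r)))
          \<le> A * R powr (s + 1) * (2 * pi) * D"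
      proof (rule amp[where h'="\<lambda>r. X *\<^sub>R bessel_moment 1 (r * X)", OF R])
        fix r assume "r \<in> {R/2..2*R}"
        have "((bessel_moment 0 \<circ> (\<lambda>r. r * X)) has_vector_derivative X *\<^sub>R bessel_moment (Suc 0) (r * X)) (at r)"
          by (intro vector_diff_chain_at has_vector_derivative_bessel_moment)
            (auto intro!: derivative_eq_intros simp flip: has_real_derivative_iff_has_vector_derivative)
        then show "((\<lambda>r. bessel_moment 0 (r * X)) has_vector_derivative X *\<^sub>R bessel_moment 1 (r * X)) (at r)"
          by (simp add: o_def)
        show "norm (bessel_moment 0 (r * X)) \<le> 2 * pi"
          by (rule bessel_moment_bound)
        have "X \<le> 1 / R" using RX R0 by (simp add: field_simps)
        then have "norm (X *\<^sub>R bessel_moment 1 (r * X)) \<le> 1 / R * (2 * pi)"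
          unfolding norm_scaleR using X R0 by (intro mult_mono bessel_moment_bound) auto
        then show "norm (X *\<^sub>R bessel_moment 1 (r * X)) \<le> 2 * pi / R" by simp
      qed (use D in \<open>auto intro!: continuous_intros\<close>)
      then have "norm (radial_integral \<tau> X R) \<le> A * (2 * pi) * (R powr (s + 1) * D)"
        by (simp add: radial_integral_def mult_ac)
      also have "\<dots> \<le> A' * (R powr (s + 1) * D)"
        using \<open>D \<ge> 0\<close> by (intro mult_right_mono) (auto simp: A'_def)
      finally show "norm (radial_integral \<tau> X R) \<le> A' * R powr (s + 1) * D" by (simp add: mult_ac)
    next
      fix R \<tau> X D :: real
      assume R: "R \<ge> 2 * y1" and X: "X \<ge> 0" and RX: "R * X \<ge> 1"
        and D: "\<And>\<sigma> r0. \<sigma>\<^sup>2 = 1 \<Longrightarrow> r0 \<in> {R/2..2*R} \<Longrightarrow> norm (integral {R/2..r0} (\<lambda>r. cis (\<tau> * g r + (\<sigma> * X) * r))) \<le> D"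
      have R0: "R > 0" using R y1 by simp
      have X0: "X > 0" using RX X by (cases "X = 0") auto
      have "D \<ge> 0" using D[of 1 R] R0 by (auto intro: order_trans[OF norm_ge_zero])
      \<comment> \<open>For r at least R/2 one has 1 / sqrt (r X) \<le> 2 / sqrt (R X) and 1/r \<le>
        2/R; the bound for the derivative of H uses both, hence the 4.\<close>
      let ?m = "4 * K / sqrt (R * X)"
      let ?f = "\<lambda>\<sigma> r. (of_real (r powr (s + 1) * p (r / R)) * H \<sigma> (r * X)) * cis (\<tau> * g r + (\<sigma> * X) * r)"
      have rX: "r * X \<ge> 1/2" "r * X \<ge> R * X / 2" if "r \<in> {R/2..2*R}" for r
      proof -
        have "R / 2 * X \<le> r * X" using that X by (intro mult_right_mono) auto
        then show "r * X \<ge> R * X / 2" by simp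
        then show "r * X \<ge> 1/2" using RX by linarith
      qed
      have part: "norm (integral {R/2..2*R} (?f \<sigma>)) \<le> A * R powr (s + 1) * ?m * D" if \<sigma>: "\<sigma>\<^sup>2 = 1" for \<sigma>
      proof (rule amp[where h'="\<lambda>r. X *\<^sub>R H' \<sigma> (r * X)", OF R])
        show "?m \<ge> 0" using K R0 X0 by simp
        show "continuous_on {R/2..2*R} (\<lambda>r. X *\<^sub>R H' \<sigma> (r * X))"
          using rX by (intro continuous_intros continuous_on_compose2[OF cH']) auto
        fix r assume r: "r \<in> {R/2..2*R}"
        have "((H \<sigma> \<circ> (\<lambda>r. r * X)) has_vector_derivative X *\<^sub>R H' \<sigma> (r * X)) (at r)"
          by (intro vector_diff_chain_at dH \<sigma> rX r)
            (auto intro!: derivative_eq_intros simp flip: has_real_derivative_iff_has_vector_derivative)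
        then show "((\<lambda>r. H \<sigma> (r * X)) has_vector_derivative X *\<^sub>R H' \<sigma> (r * X)) (at r)"
          by (simp add: o_def)
        have sq: "sqrt (R * X) \<le> 2 * sqrt (r * X)"
        proof -
          have "sqrt (R * X) \<le> sqrt (4 * (r * X))"
            using rX[OF r] R0 X0 by (intro real_sqrt_le_mono) auto
          then show ?thesis by (simp add: real_sqrt_mult)
        qed
        have sp: "sqrt (R * X) > 0" "sqrt (r * X) > 0" using R0 X0 rX[OF r] by auto
        have inv: "1 / sqrt (r * X) \<le> 2 / sqrt (R * X)"
          using sq sp by (simp add: field_simps)
        have "norm (H \<sigma> (r * X)) \<le> K * (1 / sqrt (r * X))"
          using Hb[OF \<sigma> rX(1)[OF r]] by simp
        also have "\<dots> \<le> K * (2 / sqrt (R * X))"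
          using inv K by (intro mult_left_mono) auto
        also have "\<dots> \<le> ?m" using K sp by (simp add: field_simps)
        finally show "norm (H \<sigma> (r * X)) \<le> ?m" .
        have r0: "r > 0" using r R0 by auto
        have "norm (X *\<^sub>R H' \<sigma> (r * X)) \<le> X * (K / ((r * X) * sqrt (r * X)))"
          unfolding norm_scaleR using H'b[OF \<sigma> rX(1)[OF r]] X0 by (intro mult_mono) auto
        also have "\<dots> = K * (1 / r * (1 / sqrt (r * X)))"
          using X0 r0 by (simp add: field_simps)
        also have "\<dots> \<le> K * (2 / R * (2 / sqrt (R * X)))"
          using inv K r R0 r0 sp by (intro mult_left_mono mult_mono) (auto simp: field_simps)
        also have "\<dots> = ?m / R" by (simp add: mult.commute)
        finally show "norm (X *\<^sub>R H' \<sigma> (r * X)) \<le> ?m / R" .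
        show "norm (integral {R/2..r} (\<lambda>r. cis (\<tau> * g r + (\<sigma> * X) * r))) \<le> D"
          by (rule D[OF \<sigma> r])
      qed
      have cg: "continuous_on {R/2..2*R} g"
        using R0 by (intro continuous_on_g) auto
      have cp: "continuous_on UNIV p"
        using p' by (meson DERIV_isCont continuous_at_imp_continuous_on)
      have cH: "continuous_on {1/2..} (H \<sigma>)" if "\<sigma>\<^sup>2 = 1" for \<sigma>
        using dH[OF that] by (intro has_vector_derivative_imp_continuous_on) auto
      have int: "?f \<sigma> integrable_on {R/2..2*R}" if "\<sigma>\<^sup>2 = 1" for \<sigma>
        using rX R0 by (intro integrable_continuous_real continuous_intros cg continuous_on_compose2[OF cp]
            continuous_on_compose2[OF cH[OF that]]) auto
      have "radial_integral \<tau> X R = integral {R/2..2*R} (\<lambda>r. ?f 1 r + ?f (-1) r)"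
        unfolding radial_integral_def
      proof (rule integral_cong)
        fix r assume r: "r \<in> {R/2..2*R}"
        have "cis (\<tau> * g r + 1 * X * r) = cis (\<tau> * g r) * cis (r * X)"
          "cis (\<tau> * g r + - 1 * X * r) = cis (\<tau> * g r) * cis (- (r * X))"
          by (simp_all add: cis_mult mult.commute[of r X])
        then show "of_real (r powr (s + 1) * p (r / R)) * cis (\<tau> * g r) * bessel_moment 0 (r * X) = ?f 1 r + ?f (-1) r"
          using H[OF rX(1)[OF r]] by (simp add: algebra_simps)
      qed
      also have "\<dots> = integral {R/2..2*R} (?f 1) + integral {R/2..2*R} (?f (-1))"
        by (intro integral_add int) auto
      finally have "norm (radial_integral \<tau> X R) \<le> A * R powr (s + 1) * ?m * D + A * R powr (s + 1) * ?m * D"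
        by (simp only:) (intro order_trans[OF norm_triangle_ineq] add_mono part; simp)
      also have "\<dots> = (2 * (A * (4 * K))) * (R powr (s + 1) * D / sqrt (R * X))"
        by simp
      also have "\<dots> \<le> A' * (R powr (s + 1) * D / sqrt (R * X))"
        using \<open>D \<ge> 0\<close> R0 X0 by (intro mult_right_mono) (auto simp: A'_def)
      finally show "norm (radial_integral \<tau> X R) \<le> A' * R powr (s + 1) * D / sqrt (R * X)"
        by simp
    qed
  qed
qed

section \<open>Size of one dyadic piece in the different ranges of |x|\<close>

lemma radial_integral_trivial:
  obtains C where "C > 0"
    "\<And>R \<tau> X. R \<ge> 2 * y1 \<Longrightarrow> X \<ge> 0 \<Longrightarrow> norm (radial_integral \<tau> X R) \<le> C * R powr (s + 2)"
proof (rule radial_integral_bound)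
  fix A :: real
  assume A: "A > 0"
    and J1: "\<And>R \<tau> X D. \<lbrakk>R \<ge> 2 * y1; X \<ge> 0; R * X \<le> 1;
        \<And>r0. r0 \<in> {R/2..2*R} \<Longrightarrow> norm (integral {R/2..r0} (\<lambda>r. cis (\<tau> * g r + 0 * r))) \<le> D\<rbrakk> \<Longrightarrow>
      norm (radial_integral \<tau> X R) \<le> A * R powr (s + 1) * D"
    and J2: "\<And>R \<tau> X D. \<lbrakk>R \<ge> 2 * y1; X \<ge> 0; R * X \<ge> 1;
        \<And>\<sigma> r0. \<sigma>\<^sup>2 = 1 \<Longrightarrow> r0 \<in> {R/2..2*R} \<Longrightarrow> norm (integral {R/2..r0} (\<lambda>r. cis (\<tau> * g r + (\<sigma> * X) * r))) \<le> D\<rbrakk> \<Longrightarrow>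
      norm (radial_integral \<tau> X R) \<le> A * R powr (s + 1) * D / sqrt (R * X)"
  show thesis
  proof (rule that[of "2 * A"])
    show "2 * A > 0" using A by simp
    fix R \<tau> X :: real assume R: "R \<ge> 2 * y1" and X: "X \<ge> 0"
    have R0: "R > 0" using R y1 by simp
    have eq: "A * R powr (s + 1) * (2 * R) = 2 * A * R powr (s + 2)"
      using R0 by (simp add: powr_add power2_eq_square)
    show "norm (radial_integral \<tau> X R) \<le> 2 * A * R powr (s + 2)"
    proof (cases "R * X \<le> 1")
      case True
      from J1[OF R X True phase_integral_trivial_bound[OF R]] show ?thesis
        unfolding eq .
    next
      case False
      then have RX: "R * X \<ge> 1" by simp
      have "norm (radial_integral \<tau> X R) \<le> A * R powr (s + 1) * (2 * R) / sqrt (R * X)"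
        by (rule J2[OF R X RX phase_integral_trivial_bound[OF R]])
      also have "\<dots> \<le> A * R powr (s + 1) * (2 * R) / 1"
        using RX A R0 by (intro divide_left_mono) auto
      finally show ?thesis
        using eq by simp
    qed
  qed
qed

text \<open>Either no linear phase is split off, or it removes at most half of |\<tau> g'|, which is
  at least lam |\<tau>|. The first derivative test then gives the full power of \<tau>, and the
  Bessel decay is discarded.\<close>

lemma radial_integral_low:
  obtains C where "C > 0"
    "\<And>R \<tau> X. \<lbrakk>R \<ge> 2 * y1; X \<ge> 0; \<tau> \<noteq> 0; R * X \<le> 1 \<or> X \<le> lam * \<bar>\<tau>\<bar> / 2\<rbrakk> \<Longrightarrow>
      norm (radial_integral \<tau> X R) \<le> C * R powr (s + 1) / \<bar>\<tau>\<bar>"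
proof (rule radial_integral_bound)
  fix A :: real
  assume A: "A > 0"
    and J1: "\<And>R \<tau> X D. \<lbrakk>R \<ge> 2 * y1; X \<ge> 0; R * X \<le> 1;
        \<And>r0. r0 \<in> {R/2..2*R} \<Longrightarrow> norm (integral {R/2..r0} (\<lambda>r. cis (\<tau> * g r + 0 * r))) \<le> D\<rbrakk> \<Longrightarrow>
      norm (radial_integral \<tau> X R) \<le> A * R powr (s + 1) * D"
    and J2: "\<And>R \<tau> X D. \<lbrakk>R \<ge> 2 * y1; X \<ge> 0; R * X \<ge> 1;
        \<And>\<sigma> r0. \<sigma>\<^sup>2 = 1 \<Longrightarrow> r0 \<in> {R/2..2*R} \<Longrightarrow> norm (integral {R/2..r0} (\<lambda>r. cis (\<tau> * g r + (\<sigma> * X) * r))) \<le> D\<rbrakk> \<Longrightarrow>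
      norm (radial_integral \<tau> X R) \<le> A * R powr (s + 1) * D / sqrt (R * X)"
  show thesis
  proof (rule that[of "A * (8 / lam)"])
    show "A * (8 / lam) > 0" using A lam by simp
    fix R \<tau> X :: real
    assume R: "R \<ge> 2 * y1" and X: "X \<ge> 0" and \<tau>: "\<tau> \<noteq> 0" and low: "R * X \<le> 1 \<or> X \<le> lam * \<bar>\<tau>\<bar> / 2"
    have R0: "R > 0" using R y1 by simp
    let ?\<mu> = "lam * \<bar>\<tau>\<bar> / 2"
    have \<mu>: "?\<mu> > 0" using lam \<tau> by simp
    have g1: "2 * ?\<mu> \<le> \<bar>\<tau> * g1 r\<bar>" if "r \<in> {R/2..2*R}" for r
    proof -
      have "lam * \<bar>\<tau>\<bar> \<le> \<bar>g1 r\<bar> * \<bar>\<tau>\<bar>"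
        using that R by (intro mult_right_mono g1_ge) auto
      then show ?thesis by (simp add: abs_mult mult.commute)
    qed
    have eq: "A * R powr (s + 1) * (4 / ?\<mu>) = A * (8 / lam) * R powr (s + 1) / \<bar>\<tau>\<bar>"
      by simp
    show "norm (radial_integral \<tau> X R) \<le> A * (8 / lam) * R powr (s + 1) / \<bar>\<tau>\<bar>"
    proof (cases "R * X \<le> 1")
      case True
      have "?\<mu> \<le> \<bar>\<tau> * g1 r + 0\<bar>" if "r \<in> {R/2..2*R}" for r
        using g1[OF that] \<mu> by simp
      then have "norm (radial_integral \<tau> X R) \<le> A * R powr (s + 1) * (4 / ?\<mu>)"
        by (intro J1[OF R X True] phase_integral_bound_1[OF R _ \<mu>])
      then show ?thesis unfolding eq .
    next
      case False
      then have RX: "R * X \<ge> 1" and Xl: "X \<le> ?\<mu>" using low by simp_all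
      have "?\<mu> \<le> \<bar>\<tau> * g1 r + \<sigma> * X\<bar>" if "r \<in> {R/2..2*R}" "\<sigma>\<^sup>2 = 1" for r \<sigma>
      proof -
        have "\<bar>\<sigma> * X\<bar> = X" using that(2) X by (auto simp: power2_eq_1_iff)
        then show ?thesis using g1[OF that(1)] Xl by linarith
      qed
      then have "norm (radial_integral \<tau> X R) \<le> A * R powr (s + 1) * (4 / ?\<mu>) / sqrt (R * X)"
        by (intro J2[OF R X RX] phase_integral_bound_1[OF R _ \<mu>])
      also have "\<dots> \<le> A * R powr (s + 1) * (4 / ?\<mu>) / 1"
        using RX A R0 \<mu> by (intro divide_left_mono) auto
      finally show ?thesis unfolding eq div_by_1 .
    qed
  qed
qed

text \<open>In this range X is at least a multiple of |\<tau>|, which converts the Bessel decay (R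
  X)^(-1/2) into (R |\<tau>|)^(-1/2), independent of x.\<close>

lemma radial_integral_high:
  obtains A where "A > 0"
    "\<And>R \<tau> X D. \<lbrakk>R \<ge> 2 * y1; R * X \<ge> 1; X \<ge> lam * \<bar>\<tau>\<bar> / 2; \<tau> \<noteq> 0; 
        \<And>\<sigma> r0. \<sigma>\<^sup>2 = 1 \<Longrightarrow> r0 \<in> {R/2..2*R} \<Longrightarrow> norm (integral {R/2..r0} (\<lambda>r. cis (\<tau> * g r + (\<sigma> * X) * r))) \<le> D\<rbrakk> \<Longrightarrow>
      norm (radial_integral \<tau> X R) \<le> A * R powr (s + 1/2) * \<bar>\<tau>\<bar> powr (-1/2) * D"
proof (rule radial_integral_bound)
  fix A :: real
  assume A: "A > 0"
    and J2: "\<And>R \<tau> X D. \<lbrakk>R \<ge> 2 * y1; X \<ge> 0; R * X \<ge> 1;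
        \<And>\<sigma> r0. \<sigma>\<^sup>2 = 1 \<Longrightarrow> r0 \<in> {R/2..2*R} \<Longrightarrow> norm (integral {R/2..r0} (\<lambda>r. cis (\<tau> * g r + (\<sigma> * X) * r))) \<le> D\<rbrakk> \<Longrightarrow>
      norm (radial_integral \<tau> X R) \<le> A * R powr (s + 1) * D / sqrt (R * X)"
  show thesis
  proof (rule that[of "A / sqrt (lam / 2)"])
    show "A / sqrt (lam / 2) > 0" using A lam by simp
    fix R \<tau> X D :: real
    assume R: "R \<ge> 2 * y1" and RX: "R * X \<ge> 1" and Xl: "X \<ge> lam * \<bar>\<tau>\<bar> / 2" and \<tau>: "\<tau> \<noteq> 0"
      and D: "\<And>\<sigma> r0. \<sigma>\<^sup>2 = 1 \<Longrightarrow> r0 \<in> {R/2..2*R} \<Longrightarrow> norm (integral {R/2..r0} (\<lambda>r. cis (\<tau> * g r + (\<sigma> * X) * r))) \<le> D"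
    have R0: "R > 0" using R y1 by simp
    have X: "X \<ge> 0" using Xl lam by (intro order_trans[OF _ Xl]) auto
    have D0: "D \<ge> 0" using D[of 1 R] R0 by (auto intro: order_trans[OF norm_ge_zero])
    have pos: "lam / 2 * \<bar>\<tau>\<bar> * R > 0" using lam \<tau> R0 by simp
    have "norm (radial_integral \<tau> X R) \<le> A * R powr (s + 1) * D / sqrt (R * X)"
      by (rule J2[OF R X RX D])
    also have "\<dots> \<le> A * R powr (s + 1) * D / sqrt (lam / 2 * \<bar>\<tau>\<bar> * R)"
    proof (intro divide_left_mono real_sqrt_le_mono)
      have "lam * \<bar>\<tau>\<bar> / 2 * R \<le> X * R"
        using Xl R0 by (intro mult_right_mono) auto
      then show "lam / 2 * \<bar>\<tau>\<bar> * R \<le> R * X" by (simp add: mult_ac)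
      show "0 \<le> A * R powr (s + 1) * D" using A D0 by simp
      show "0 < sqrt (R * X) * sqrt (lam / 2 * \<bar>\<tau>\<bar> * R)"
        using pos RX by (intro mult_pos_pos) auto
    qed
    also have "\<dots> = A * R powr (s + 1) * D / (sqrt (lam / 2) * \<bar>\<tau>\<bar> powr (1/2) * R powr (1/2))"
      using R0 by (simp only: real_sqrt_mult powr_half_sqrt abs_ge_zero less_imp_le)
    also have "\<dots> = A / sqrt (lam / 2) * (R powr (s + 1) / R powr (1/2)) * (1 / \<bar>\<tau>\<bar> powr (1/2)) * D"
      by simp
    also have "R powr (s + 1) / R powr (1/2) = R powr (s + 1/2)"
      unfolding powr_diff[symmetric] by (rule arg_cong[where f="(powr) R"]) simp
    also have "1 / \<bar>\<tau>\<bar> powr (1/2) = \<bar>\<tau>\<bar> powr (-1/2)"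
      by (simp add: powr_minus_divide[symmetric])
    finally show "norm (radial_integral \<tau> X R) \<le> A / sqrt (lam / 2) * R powr (s + 1/2) * \<bar>\<tau>\<bar> powr (-1/2) * D" .
  qed
qed

text \<open>For large X the second derivative test contributes (|\<tau>| R^\<alpha>)^(-1/2), and s +
  1/2 - \<alpha>/2 is the claimed exponent of R.\<close>

lemma radial_integral_decay:
  obtains C where "C > 0"
    "\<And>R \<tau> X. \<lbrakk>R \<ge> 2 * y1; X \<ge> 0; \<tau> \<noteq> 0\<rbrakk> \<Longrightarrow> norm (radial_integral \<tau> X R) \<le> C * R powr (s - (\<alpha> - 1) / 2) / \<bar>\<tau>\<bar>"
proof (rule radial_integral_low)
  fix C0 :: real
  assume C0: "C0 > 0" and low: "\<And>R \<tau> X. \<lbrakk>R \<ge> 2 * y1; X \<ge> 0; \<tau> \<noteq> 0; R * X \<le> 1 \<or> X \<le> lam * \<bar>\<tau>\<bar> / 2\<rbrakk> \<Longrightarrow>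
      norm (radial_integral \<tau> X R) \<le> C0 * R powr (s + 1) / \<bar>\<tau>\<bar>"
  show thesis
  proof (rule radial_integral_high)
    fix A :: real
    assume A: "A > 0" and high: "\<And>R \<tau> X D. \<lbrakk>R \<ge> 2 * y1; R * X \<ge> 1; X \<ge> lam * \<bar>\<tau>\<bar> / 2; \<tau> \<noteq> 0; 
        \<And>\<sigma> r0. \<sigma>\<^sup>2 = 1 \<Longrightarrow> r0 \<in> {R/2..2*R} \<Longrightarrow> norm (integral {R/2..r0} (\<lambda>r. cis (\<tau> * g r + (\<sigma> * X) * r))) \<le> D\<rbrakk> \<Longrightarrow>
      norm (radial_integral \<tau> X R) \<le> A * R powr (s + 1/2) * \<bar>\<tau>\<bar> powr (-1/2) * D"
    \<comment> \<open>For small X the bound R^(s+1) exceeds the claimed power by R^((\<alpha>+1)/2).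
      This exponent is negative, so the excess is largest at R = 2 y1.\<close>
    define M where "M = (2 * y1) powr ((\<alpha> + 1) / 2)"
    define q where "q = sqrt (lam * 2 powr \<alpha>)"
    have q0: "q > 0" using lam by (simp add: q_def)
    have M0: "M > 0" using y1 by (simp add: M_def)
    define C where "C = max (C0 * M) (A * (10 / q))"
    show thesis
    proof (rule that[of C])
      show "C > 0" using C0 M0 by (simp add: C_def less_max_iff_disj)
      fix R \<tau> X :: real
      assume R: "R \<ge> 2 * y1" and X: "X \<ge> 0" and \<tau>: "\<tau> \<noteq> 0"
      have R0: "R > 0" using R y1 by simp
      define W where "W = R powr (s - (\<alpha> - 1) / 2)"
      have WC: "(C0 * M) * (W / \<bar>\<tau>\<bar>) \<le> C * (W / \<bar>\<tau>\<bar>)" "(A * (10 / q)) * (W / \<bar>\<tau>\<bar>) \<le> C * (W / \<bar>\<tau>\<bar>)"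
        by (intro mult_right_mono; simp add: C_def W_def)+
      show "norm (radial_integral \<tau> X R) \<le> C * R powr (s - (\<alpha> - 1) / 2) / \<bar>\<tau>\<bar>"
      proof (cases "R * X \<le> 1 \<or> X \<le> lam * \<bar>\<tau>\<bar> / 2")
        case True
        have We: "R powr (s + 1) = W * R powr ((\<alpha> + 1) / 2)"
          unfolding W_def powr_add[symmetric] by (rule arg_cong[where f="(powr) R"]) (simp add: field_simps)
        have "R powr ((\<alpha> + 1) / 2) \<le> M"
          unfolding M_def using R y1 \<alpha> by (intro powr_mono2') auto
        then have "R powr (s + 1) \<le> W * M"
          unfolding We by (intro mult_left_mono) (auto simp: W_def)
        then have "C0 * R powr (s + 1) / \<bar>\<tau>\<bar> \<le> C0 * (W * M) / \<bar>\<tau>\<bar>"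
          using C0 by (intro divide_right_mono mult_left_mono) auto
        then show ?thesis
          using low[OF R X \<tau> True] WC(1) unfolding W_def by (simp add: mult_ac)
      next
        case False
        then have RX: "R * X \<ge> 1" and Xl: "X \<ge> lam * \<bar>\<tau>\<bar> / 2" by simp_all
        have "norm (radial_integral \<tau> X R) \<le> A * R powr (s + 1/2) * \<bar>\<tau>\<bar> powr (-1/2) * (10 / sqrt (\<bar>\<tau>\<bar> * (lam * (2 * R) powr \<alpha>)))"
          by (intro high[OF R RX Xl \<tau>] phase_integral_bound_2[OF R _ \<tau>])
        also have "sqrt (\<bar>\<tau>\<bar> * (lam * (2 * R) powr \<alpha>)) = \<bar>\<tau>\<bar> powr (1/2) * q * R powr (\<alpha> / 2)"
        proof -
          have "sqrt (R powr \<alpha>) = R powr (\<alpha> / 2)"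
            by (simp add: powr_half_sqrt[symmetric] powr_powr)
          then show ?thesis
            using R0 by (simp add: q_def powr_mult real_sqrt_mult powr_half_sqrt)
        qed
        also have "A * R powr (s + 1/2) * \<bar>\<tau>\<bar> powr (-1/2) * (10 / (\<bar>\<tau>\<bar> powr (1/2) * q * R powr (\<alpha> / 2)))
            = A * (10 / q) * (R powr (s + 1/2) / R powr (\<alpha> / 2)) * (\<bar>\<tau>\<bar> powr (-1/2) / \<bar>\<tau>\<bar> powr (1/2))"
          by (simp add: mult_ac)
        also have "R powr (s + 1/2) / R powr (\<alpha> / 2) = W"
          unfolding W_def powr_diff[symmetric] by (rule arg_cong[where f="(powr) R"]) (simp add: field_simps)
        also have "\<bar>\<tau>\<bar> powr (-1/2) / \<bar>\<tau>\<bar> powr (1/2) = 1 / \<bar>\<tau>\<bar>"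
          using \<tau> unfolding powr_diff[symmetric] by (simp add: powr_minus_divide)
        finally show ?thesis
          using WC(2) unfolding W_def by simp
      qed
    qed
  qed
qed

text \<open>The three summands stand for small X, for shells without resonance, and for resonant
  shells. With v = R^(\<alpha>+1) and m = |l + \<sigma> X / \<tau>|, the quantity min (v / m) (m /
  v) replaces an indicator of the resonant window: it is bounded below there and decays
  geometrically in k on both sides, with a sum that does not depend on m. For m = 0 there is no
  resonant shell, whence the value 0.\<close>

lemma radial_integral_critical:
  fixes l Lam :: real
  assumes s: "s = (\<alpha> - 1) / 2"
    and Lam: "Lam > 0"
    and near: "\<And>y. y \<ge> y1 \<Longrightarrow> lam * y powr (\<alpha> + 1) \<le> \<bar>g1 y - l\<bar> \<and> \<bar>g1 y - l\<bar> \<le> Lam * y powr (\<alpha> + 1)"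
  obtains C where "C > 0"
    "\<And>R \<tau> X. \<lbrakk>R \<ge> 2 * y1; X \<ge> 0; \<tau> \<noteq> 0\<rbrakk> \<Longrightarrow> norm (radial_integral \<tau> X R) \<le> C / \<bar>\<tau>\<bar> *
       (R powr ((\<alpha> + 1) / 2)
        + min (\<bar>\<tau>\<bar> powr (1/2) * R powr ((\<alpha> + 2) / 2)) (\<bar>\<tau>\<bar> powr (-1/2) * R powr (- (\<alpha> + 2) / 2))
        + (\<Sum>\<sigma>\<in>{1,-1}. if l + \<sigma> * X / \<tau> = 0 then 0
             else min (1 / \<bar>l + \<sigma> * X / \<tau>\<bar> * R powr (\<alpha> + 1)) (\<bar>l + \<sigma> * X / \<tau>\<bar> * R powr (- (\<alpha> + 1)))))"
proof (rule radial_integral_low)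
  fix C0 :: real
  assume C0: "C0 > 0" and low: "\<And>R \<tau> X. \<lbrakk>R \<ge> 2 * y1; X \<ge> 0; \<tau> \<noteq> 0; R * X \<le> 1 \<or> X \<le> lam * \<bar>\<tau>\<bar> / 2\<rbrakk> \<Longrightarrow>
      norm (radial_integral \<tau> X R) \<le> C0 * R powr (s + 1) / \<bar>\<tau>\<bar>"
  show thesis
  proof (rule radial_integral_decay)
    fix C2 :: real
    assume C2: "C2 > 0" and decay: "\<And>R \<tau> X. \<lbrakk>R \<ge> 2 * y1; X \<ge> 0; \<tau> \<noteq> 0\<rbrakk> \<Longrightarrow>
        norm (radial_integral \<tau> X R) \<le> C2 * R powr (s - (\<alpha> - 1) / 2) / \<bar>\<tau>\<bar>"
    show thesis
    proof (rule radial_integral_high)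
      fix A :: real
      assume A: "A > 0" and high: "\<And>R \<tau> X D. \<lbrakk>R \<ge> 2 * y1; R * X \<ge> 1; X \<ge> lam * \<bar>\<tau>\<bar> / 2; \<tau> \<noteq> 0; 
          \<And>\<sigma> r0. \<sigma>\<^sup>2 = 1 \<Longrightarrow> r0 \<in> {R/2..2*R} \<Longrightarrow> norm (integral {R/2..r0} (\<lambda>r. cis (\<tau> * g r + (\<sigma> * X) * r))) \<le> D\<rbrakk> \<Longrightarrow>
        norm (radial_integral \<tau> X R) \<le> A * R powr (s + 1/2) * \<bar>\<tau>\<bar> powr (-1/2) * D"
      \<comment> \<open>On the shell |g1 - l| lies between \<open>c1 * v\<close> and
        \<open>c2 * v\<close>; since \<alpha> + 1 is negative, the lower bound is attained at r = 2
        R and the upper one at r = R/2.\<close>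
      define c1 where "c1 = lam * 2 powr (\<alpha> + 1)"
      define c2 where "c2 = Lam * (1/2) powr (\<alpha> + 1)"
      have c1: "c1 > 0" and c2: "c2 > 0" using lam Lam by (simp_all add: c1_def c2_def)
      define c where "c = min (c1 / 2) c2"
      have c: "c > 0" using c1 c2 by (simp add: c_def)
      \<comment> \<open>The least value that min (v / m) (m / v) can take while m lies between c1 v
        / 2 and 2 c2 v.\<close>
      define \<kappa> where "\<kappa> = min (1 / (2 * c2)) (c1 / 2)"
      have \<kappa>: "\<kappa> > 0" using c1 c2 by (simp add: \<kappa>_def)
      define C where "C = C0 + C2 / \<kappa> + A * 2 + A * (4 / c)"
      have Cs: "C \<ge> C0" "C \<ge> C2 / \<kappa>" "C \<ge> A * 2" "C \<ge> A * (4 / c)" "C > 0"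
        using C0 C2 \<kappa> A c by (auto simp: C_def intro!: add_pos_pos add_nonneg_nonneg)
      show thesis
      proof (rule that[of C])
        show "C > 0" by fact
        fix R \<tau> X :: real
        assume R: "R \<ge> 2 * y1" and X: "X \<ge> 0" and \<tau>: "\<tau> \<noteq> 0"
        have R0: "R > 0" using R y1 by simp
        define v where "v = R powr (\<alpha> + 1)"
        have v: "v > 0" "R powr (- (\<alpha> + 1)) = 1 / v"
          using R0 by (simp_all add: v_def powr_minus_divide del: minus_add_distrib)
        define m where "m \<sigma> = \<bar>l + \<sigma> * X / \<tau>\<bar>" for \<sigma>
        define T1 where "T1 = R powr ((\<alpha> + 1) / 2)"
        define T2 where "T2 = min (\<bar>\<tau>\<bar> powr (1/2) * R powr ((\<alpha> + 2) / 2)) (\<bar>\<tau>\<bar> powr (-1/2) * R powr (- (\<alpha> + 2) / 2))"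
        define T3 where "T3 \<sigma> = (if m \<sigma> = 0 then 0 else min (1 / m \<sigma> * v) (m \<sigma> * (1 / v)))" for \<sigma>
        have T: "T1 \<ge> 0" "T2 \<ge> 0" "T3 \<sigma> \<ge> 0" for \<sigma>
          using v by (auto simp: T1_def T2_def T3_def m_def)
        have reduce: "norm (radial_integral \<tau> X R) \<le> C / \<bar>\<tau>\<bar> * (T1 + T2 + (T3 1 + T3 (-1)))"
          if "norm (radial_integral \<tau> X R) \<le> c' / \<bar>\<tau>\<bar> * t" "0 \<le> c'" "c' \<le> C" "0 \<le> t" "t \<le> T1 + T2 + (T3 1 + T3 (-1))" for c' t
        proof -
          have "c' / \<bar>\<tau>\<bar> * t \<le> C / \<bar>\<tau>\<bar> * (T1 + T2 + (T3 1 + T3 (-1)))"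
            using that \<open>C > 0\<close> by (intro mult_mono divide_right_mono) auto
          with that(1) show ?thesis by simp
        qed
        have "norm (radial_integral \<tau> X R) \<le> C / \<bar>\<tau>\<bar> * (T1 + T2 + (T3 1 + T3 (-1)))"
        proof (cases "R * X \<le> 1 \<or> X \<le> lam * \<bar>\<tau>\<bar> / 2")
          case True
          have "(\<alpha> + 1) / 2 = s + 1" using s by (simp add: field_simps)
          then have "norm (radial_integral \<tau> X R) \<le> C0 / \<bar>\<tau>\<bar> * T1"
            using low[OF R X \<tau> True] unfolding T1_def by (simp only: times_divide_eq_left)
          then show ?thesis
            using C0 Cs(1) T(1,2) T(3)[of 1] T(3)[of "-1"]
            by (intro reduce[of C0 T1]) auto
        next
          case False
          then have RX: "R * X \<ge> 1" and Xl: "X \<ge> lam * \<bar>\<tau>\<bar> / 2" by simp_all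
          show ?thesis
          \<comment> \<open>A resonance of either sign suffices for the first case, where the bound
            of order 1/|\<tau>| is kept. In the other case both phases are nonstationary, and the
            trivial bound competes with the first derivative test.\<close>
          proof (cases "\<exists>\<sigma>\<in>{1,-1}. c1 * v / 2 < m \<sigma> \<and> m \<sigma> < 2 * c2 * v")
            case True
            then obtain \<sigma> where \<sigma>: "\<sigma> \<in> {1,-1}" and m: "c1 * v / 2 < m \<sigma>" "m \<sigma> < 2 * c2 * v" by blast
            have m0: "m \<sigma> > 0" using m(1) c1 v by (intro less_trans[OF _ m(1)]) auto
            have "1 / (2 * c2) \<le> 1 / m \<sigma> * v" "c1 / 2 \<le> m \<sigma> * (1 / v)"
              using m m0 c2 v by (simp_all add: field_simps)
            then have "\<kappa> \<le> min (1 / m \<sigma> * v) (m \<sigma> * (1 / v))"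
              unfolding \<kappa>_def by (intro min.mono)
            also have "\<dots> = T3 \<sigma>"
              using m0 by (simp add: T3_def)
            also have "T3 \<sigma> \<le> T1 + T2 + (T3 1 + T3 (-1))"
              using \<sigma> T(1,2) T(3)[of 1] T(3)[of "-1"] by auto
            finally show ?thesis
              using decay[OF R X \<tau>] C2 \<kappa> Cs(2) R0 by (intro reduce[of "C2 / \<kappa>" \<kappa>]) (auto simp: s)
          next
            case False
            have e1: "R powr (s + 1/2) * R = R powr ((\<alpha> + 2) / 2)"
            proof -
              have "R powr (s + 1/2) * R = R powr (s + 1/2) * R powr 1" using R0 by simp
              also have "\<dots> = R powr ((\<alpha> + 2) / 2)"
                unfolding powr_add[symmetric] by (rule arg_cong[where f="(powr) R"]) (simp add: s field_simps)
              finally show ?thesis .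
            qed
            have e2: "\<bar>\<tau>\<bar> powr (-1/2) = 1 / \<bar>\<tau>\<bar> * \<bar>\<tau>\<bar> powr (1/2)"
            proof -
              have "\<bar>\<tau>\<bar> powr (-1/2) = \<bar>\<tau>\<bar> powr (-1) * \<bar>\<tau>\<bar> powr (1/2)"
                unfolding powr_add[symmetric] by simp
              then show ?thesis using \<tau> by (simp add: powr_minus_divide)
            qed
            have "norm (radial_integral \<tau> X R) \<le> A * R powr (s + 1/2) * \<bar>\<tau>\<bar> powr (-1/2) * (2 * R)"
              by (intro high[OF R RX Xl \<tau>] phase_integral_trivial_bound[OF R])
            also have "\<dots> = A * 2 * (R powr (s + 1/2) * R) * \<bar>\<tau>\<bar> powr (-1/2)"
              by (simp add: mult_ac)
            also have "\<dots> = A * 2 / \<bar>\<tau>\<bar> * (\<bar>\<tau>\<bar> powr (1/2) * R powr ((\<alpha> + 2) / 2))"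
              unfolding e1 e2 by simp
            finally have b1: "norm (radial_integral \<tau> X R) \<le> A * 2 / \<bar>\<tau>\<bar> * (\<bar>\<tau>\<bar> powr (1/2) * R powr ((\<alpha> + 2) / 2))" .
            let ?\<mu> = "\<bar>\<tau>\<bar> * (c * v)"
            have \<mu>: "?\<mu> > 0" using \<tau> c v by simp
            have lb: "?\<mu> \<le> \<bar>\<tau> * g1 r + \<sigma> * X\<bar>" if r: "r \<in> {R/2..2*R}" and \<sigma>: "\<sigma>\<^sup>2 = 1" for r \<sigma>
            proof -
              have r0: "r > 0" "r \<ge> y1" using r R0 R by auto
              have "c1 * v = lam * (2 * R) powr (\<alpha> + 1)"
                using R0 by (simp add: c1_def v_def powr_mult)
              also have "\<dots> \<le> lam * r powr (\<alpha> + 1)"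
                using r r0 lam \<alpha> by (intro mult_left_mono powr_mono2') auto
              finally have lo: "c1 * v \<le> \<bar>g1 r - l\<bar>" using near[OF r0(2)] by linarith
              have "Lam * r powr (\<alpha> + 1) \<le> Lam * (1/2 * R) powr (\<alpha> + 1)"
                using r r0 R0 Lam \<alpha> by (intro mult_left_mono powr_mono2') auto
              also have "\<dots> = c2 * v"
                using R0 by (simp only: c2_def v_def powr_mult mult.assoc)
              finally have up: "\<bar>g1 r - l\<bar> \<le> c2 * v" using near[OF r0(2)] by linarith
              have "\<sigma> \<in> {1,-1}" using \<sigma> by (auto simp: power2_eq_1_iff)
              then have "m \<sigma> \<le> c1 * v / 2 \<or> m \<sigma> \<ge> 2 * c2 * v"
                using False by force
              \<comment> \<open>One of the two summands is at least twice as large as the other: g1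
                - l if m is below the window, l + \<sigma> X / \<tau> if m is above it. Half of the
                larger one therefore survives.\<close>
              then have "c1 * v / 2 \<le> \<bar>(g1 r - l) + (l + \<sigma> * X / \<tau>)\<bar> \<or> c2 * v \<le> \<bar>(g1 r - l) + (l + \<sigma> * X / \<tau>)\<bar>"
              proof -
                have *: "u / 2 \<le> \<bar>d + e\<bar> \<or> w \<le> \<bar>d + e\<bar>"
                  if "\<bar>e\<bar> \<le> u / 2 \<or> 2 * w \<le> \<bar>e\<bar>" "u \<le> \<bar>d\<bar>" "\<bar>d\<bar> \<le> w" for d e u w :: real
                  using that by (elim disjE) linarith+
                show "m \<sigma> \<le> c1 * v / 2 \<or> m \<sigma> \<ge> 2 * c2 * v \<Longrightarrow> ?thesis"
                  unfolding m_def mult.assoc[of 2 c2 v] by (rule *[OF _ lo up])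
              qed
              moreover have "c * v \<le> c1 * v / 2" "c * v \<le> c2 * v"
                using mult_right_mono[of c "c1 / 2" v] mult_right_mono[of c c2 v] v by (simp_all add: c_def)
              ultimately have "c * v \<le> \<bar>g1 r + \<sigma> * X / \<tau>\<bar>"
                by auto
              then have "?\<mu> \<le> \<bar>\<tau>\<bar> * \<bar>g1 r + \<sigma> * X / \<tau>\<bar>"
                by (intro mult_left_mono) auto
              also have "\<dots> = \<bar>\<tau> * g1 r + \<sigma> * X\<bar>"
                unfolding abs_mult[symmetric] using \<tau> by (simp add: distrib_left)
              finally show ?thesis .
            qed
            have e3: "R powr (s + 1/2) / v = R powr (- (\<alpha> + 2) / 2)"
              unfolding v_def powr_diff[symmetric] by (rule arg_cong[where f="(powr) R"]) (simp add: s field_simps)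
            have "norm (radial_integral \<tau> X R) \<le> A * R powr (s + 1/2) * \<bar>\<tau>\<bar> powr (-1/2) * (4 / ?\<mu>)"
              by (intro high[OF R RX Xl \<tau>] phase_integral_bound_1[OF R _ \<mu> lb])
            also have "\<dots> = A * (4 / c) / \<bar>\<tau>\<bar> * (\<bar>\<tau>\<bar> powr (-1/2) * (R powr (s + 1/2) / v))"
              by (simp add: mult_ac)
            finally have b2: "norm (radial_integral \<tau> X R) \<le> A * (4 / c) / \<bar>\<tau>\<bar> * (\<bar>\<tau>\<bar> powr (-1/2) * R powr (- (\<alpha> + 2) / 2))"
              unfolding e3 .
            have le: "a / \<bar>\<tau>\<bar> * t \<le> C / \<bar>\<tau>\<bar> * t" if "a \<le> C" "t \<ge> 0" for a t
              using that by (intro mult_right_mono divide_right_mono) auto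
            have "norm (radial_integral \<tau> X R) \<le> C / \<bar>\<tau>\<bar> * (\<bar>\<tau>\<bar> powr (1/2) * R powr ((\<alpha> + 2) / 2))"
              by (rule order_trans[OF b1 le[OF Cs(3)]]) simp
            moreover have "norm (radial_integral \<tau> X R) \<le> C / \<bar>\<tau>\<bar> * (\<bar>\<tau>\<bar> powr (-1/2) * R powr (- (\<alpha> + 2) / 2))"
              by (rule order_trans[OF b2 le[OF Cs(4)]]) simp
            ultimately have "norm (radial_integral \<tau> X R) \<le> C / \<bar>\<tau>\<bar> * T2"
              unfolding T2_def by (simp only: min_def split: if_split) blast
            then show ?thesis
              using T(1,2) T(3)[of 1] T(3)[of "-1"] \<open>C > 0\<close> by (intro reduce[of C T2]) auto
          qed
        qed
        also have "T3 1 + T3 (-1) = (\<Sum>\<sigma>\<in>{1,-1}. if l + \<sigma> * X / \<tau> = 0 then 0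
               else min (1 / \<bar>l + \<sigma> * X / \<tau>\<bar> * R powr (\<alpha> + 1)) (\<bar>l + \<sigma> * X / \<tau>\<bar> * R powr (- (\<alpha> + 1))))"
          unfolding v(2) by (simp add: T3_def m_def v_def)
        finally show "norm (radial_integral \<tau> X R) \<le> C / \<bar>\<tau>\<bar> *
         (R powr ((\<alpha> + 1) / 2)
          + min (\<bar>\<tau>\<bar> powr (1/2) * R powr ((\<alpha> + 2) / 2)) (\<bar>\<tau>\<bar> powr (-1/2) * R powr (- (\<alpha> + 2) / 2))
          + (\<Sum>\<sigma>\<in>{1,-1}. if l + \<sigma> * X / \<tau> = 0 then 0
               else min (1 / \<bar>l + \<sigma> * X / \<tau>\<bar> * R powr (\<alpha> + 1)) (\<bar>l + \<sigma> * X / \<tau>\<bar> * R powr (- (\<alpha> + 1)))))"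
          unfolding T1_def T2_def .
      qed
    qed
  qed
qed

end

section \<open>Summation over the scales\<close>

text \<open>With reciprocal coefficients the crossing value is 1 whatever A is. Changing A only
  moves the peak, so the bound is uniform in every parameter hidden in A.\<close>

lemma sum_min_powr_sym_le:
  fixes a :: real
  assumes a: "a \<noteq> 0"
  obtains C where "C > 0"
    "\<And>A F. A > 0 \<Longrightarrow> finite F \<Longrightarrow>
      (\<Sum>k\<in>F. min (A * 2 powr (real_of_int k * a)) (1 / A * 2 powr (real_of_int k * - a))) \<le> C"
proof (rule sum_min_powr_le[of a "- a"])
  show "a * - a < 0" using a by (auto simp: zero_less_mult_iff)
  fix C :: real
  assume C: "C > 0" and bound: "\<And>A B F. A > 0 \<Longrightarrow> B > 0 \<Longrightarrow> finite F \<Longrightarrow>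
      (\<Sum>k\<in>F. min (A * 2 powr (real_of_int k * a)) (B * 2 powr (real_of_int k * - a)))
        \<le> C * (A powr (- a / (- a - a)) * B powr (- a / (- a - a)))"
  show thesis
  proof (rule that[OF C])
    fix A :: real and F :: "int set" assume A: "A > 0" and F: "finite F"
    have "A powr e * (1 / A) powr e = 1" for e
      using A by (simp add: powr_mult[symmetric])
    then show "(\<Sum>k\<in>F. min (A * 2 powr (real_of_int k * a)) (1 / A * 2 powr (real_of_int k * - a))) \<le> C"
      using bound[OF A _ F, of "1 / A"] A by (simp only: divide_pos_pos zero_less_one mult_1_right)
  qed
qed

lemma dyadic_rangeD: "k \<in> dyadic_range y\<^sub>1 \<Longrightarrow> 2 * y\<^sub>1 \<le> 2 powi k"
  by (simp add: dyadic_range_def)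

lemma two_powi_powr: "(2 powi k :: real) powr a = 2 powr (real_of_int k * a)"
  by (simp add: powr_real_of_int'[symmetric] powr_powr)

lemma osc_integrand_eq:
  "osc_integrand g a s t \<delta> x \<xi>
    = cis (x \<bullet> \<xi>) * (cis (t / \<delta> * g (\<delta> * norm \<xi>)) * of_real (a (\<delta> * norm \<xi>) * norm \<xi> powr s))"
  by (simp add: osc_integrand_def cis_conv_exp)

section \<open>Rescaling the plane integrals and summing the dyadic bounds\<close>

context dyadic_oscillation begin

text \<open>Substituting r = \<delta> |\<xi>| turns the measure and the factor |\<xi>|^s into
  \<delta>^(-(s+2)) times their rescaled versions, and the phase x \<bullet> \<xi> into one of
  frequency |x| / \<delta>.\<close>

lemma osc_I_eq:
  fixes k :: int
  assumes \<delta>: "\<delta> > 0"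
  shows "integrable lborel (osc_integrand g (\<lambda>y. p (y / 2 powi k)) s t \<delta> x)"
    and "osc_I g p s t \<delta> x k = of_real (\<delta> powr (- (s + 2))) * radial_integral (t / \<delta>) (norm x / \<delta>) (2 powi k)"
proof -
  define R :: real where "R = 2 powi k"
  have R0: "R > 0" by (simp add: R_def)
  define F where "F \<rho> = cis (t / \<delta> * g (\<delta> * \<rho>)) * of_real (p (\<delta> * \<rho> / R) * \<rho> powr s)" for \<rho>
  let ?I = "{R / 2 / \<delta>..2 * R / \<delta>}"
  have pos: "\<rho> > 0" if "\<rho> \<in> ?I" for \<rho>
    using that R0 \<delta> by (auto intro: less_le_trans[of 0 "R / 2 / \<delta>"])
  have cp: "continuous_on UNIV p"
    using p' by (meson DERIV_isCont continuous_at_imp_continuous_on)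
  have cF: "continuous_on ?I F"
    unfolding F_def using pos R0 \<delta>
    by (intro continuous_intros continuous_on_compose2[OF continuous_on_g[OF order_refl]]
        continuous_on_compose2[OF cp]) force+
  have F0: "F \<rho> = 0" if "\<rho> \<ge> 0" "\<rho> \<notin> ?I" for \<rho>
  \<comment> \<open>At \<rho> = 0 the factor \<open>0 powr s\<close> is 0, whatever the value of
    \<open>p 0\<close>; \<open>p_supp\<close> settles the positive radii.\<close>
  proof (cases "\<rho> = 0")
    case False
    then have "\<delta> * \<rho> / R > 0" using that \<delta> R0 by simp
    moreover have "\<delta> * \<rho> / R \<notin> {1/2..2}"
      using that(2) \<delta> R0 by (auto simp: field_simps)
    ultimately have "p (\<delta> * \<rho> / R) = 0" by (rule p_supp)
    then show ?thesis by (simp add: F_def)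
  qed (simp add: F_def)
  have a: "0 < R / 2 / \<delta>" using R0 \<delta> by simp
  have eq: "osc_integrand g (\<lambda>y. p (y / 2 powi k)) s t \<delta> x = (\<lambda>\<xi>. cis (x \<bullet> \<xi>) * F (norm \<xi>))"
    by (simp add: fun_eq_iff osc_integrand_eq F_def R_def)
  show "integrable lborel (osc_integrand g (\<lambda>y. p (y / 2 powi k)) s t \<delta> x)"
    unfolding eq by (rule radial_fourier_integral(1)[OF a cF F0])
  let ?f = "\<lambda>r. of_real (r powr (s + 1) * p (r / R)) * cis (t / \<delta> * g r) * bessel_moment 0 (r * (norm x / \<delta>))"
  have "continuous_on {R/2..2*R} ?f"
    using R0 by (intro continuous_intros continuous_on_g continuous_on_compose2[OF cp]) auto
  then have "(?f has_integral radial_integral (t / \<delta>) (norm x / \<delta>) R) {R/2..2*R}"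
    unfolding radial_integral_def by (intro integrable_integral integrable_continuous_real)
  then have "((\<lambda>\<rho>. ?f (\<delta> * \<rho>)) has_integral (1 / \<bar>\<delta>\<bar>) *\<^sub>R radial_integral (t / \<delta>) (norm x / \<delta>) R) ?I"
    using has_integral_stretch_real[of ?f _ "R / 2" "2 * R" \<delta>] \<delta>
    by (simp add: image_divide_atLeastAtMost)
  moreover have "?f (\<delta> * \<rho>) = of_real (\<delta> powr (s + 1)) * (of_real \<rho> * F \<rho> * bessel_moment 0 (\<rho> * norm x))"
    if "\<rho> \<in> ?I" for \<rho>
  proof -
    have "(\<delta> * \<rho>) powr (s + 1) = \<delta> powr (s + 1) * (\<rho> * \<rho> powr s)"
      using pos[OF that] \<delta> by (simp add: powr_mult powr_add)
    moreover have "\<delta> * \<rho> * (norm x / \<delta>) = \<rho> * norm x"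
      using \<delta> by simp
    ultimately show ?thesis
      by (simp add: F_def mult_ac)
  qed
  ultimately have "((\<lambda>\<rho>. of_real (\<delta> powr (s + 1)) * (of_real \<rho> * F \<rho> * bessel_moment 0 (\<rho> * norm x)))
      has_integral (1 / \<bar>\<delta>\<bar>) *\<^sub>R radial_integral (t / \<delta>) (norm x / \<delta>) R) ?I"
    by (simp only: cong: has_integral_cong)
  \<comment> \<open>The factor \<delta>^(s+1) is moved to the other side, where it joins the
    1/\<delta> of the stretching.\<close>
  then have "((\<lambda>\<rho>. of_real (\<delta> powr (- (s + 1))) * (of_real (\<delta> powr (s + 1)) * (of_real \<rho> * F \<rho> * bessel_moment 0 (\<rho> * norm x))))
      has_integral of_real (\<delta> powr (- (s + 1))) * ((1 / \<bar>\<delta>\<bar>) *\<^sub>R radial_integral (t / \<delta>) (norm x / \<delta>) R)) ?I"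
    by (rule has_integral_mult_right)
  moreover have "complex_of_real (\<delta> powr (- (s + 1))) * (of_real (\<delta> powr (s + 1)) * z) = z" for z
  proof -
    have "\<delta> powr (- (s + 1)) * \<delta> powr (s + 1) = 1"
      using \<delta> unfolding powr_add[symmetric] by simp
    then show ?thesis
      by (simp only: mult.assoc[symmetric] of_real_mult[symmetric]) simp
  qed
  moreover have "of_real (\<delta> powr (- (s + 1))) * ((1 / \<bar>\<delta>\<bar>) *\<^sub>R z) = of_real (\<delta> powr (- (s + 2))) * z" for z :: complex
  proof -
    have "\<delta> powr (- (s + 1)) * (1 / \<bar>\<delta>\<bar>) = \<delta> powr (- (s + 1)) * \<delta> powr (-1)"
      using \<delta> by (simp add: powr_minus_divide)
    also have "\<dots> = \<delta> powr (- (s + 2))"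
      unfolding powr_add[symmetric] by (rule arg_cong[where f="(powr) \<delta>"]) simp
    finally have eq: "\<delta> powr (- (s + 1)) * (1 / \<bar>\<delta>\<bar>) = \<delta> powr (- (s + 2))" .
    have "of_real (\<delta> powr (- (s + 1))) * ((1 / \<bar>\<delta>\<bar>) *\<^sub>R z) = of_real (\<delta> powr (- (s + 1)) * (1 / \<bar>\<delta>\<bar>)) * z"
      by (simp add: scaleR_conv_of_real)
    then show ?thesis
      unfolding eq .
  qed
  ultimately have "((\<lambda>\<rho>. of_real \<rho> * F \<rho> * bessel_moment 0 (\<rho> * norm x))
      has_integral of_real (\<delta> powr (- (s + 2))) * radial_integral (t / \<delta>) (norm x / \<delta>) R) ?I"
    by (simp only:)
  moreover have "osc_I g p s t \<delta> x k = integral ?I (\<lambda>\<rho>. of_real \<rho> * F \<rho> * bessel_moment 0 (\<rho> * norm x))"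
    unfolding osc_I_def eq by (rule radial_fourier_integral(2)[OF a cF F0])
  ultimately show "osc_I g p s t \<delta> x k = of_real (\<delta> powr (- (s + 2))) * radial_integral (t / \<delta>) (norm x / \<delta>) (2 powi k)"
    unfolding R_def[symmetric] by (simp only: integral_unique)
qed

lemma norm_osc_I:
  fixes k :: int
  assumes "\<delta> > 0"
  shows "norm (osc_I g p s t \<delta> x k) = \<delta> powr (- (s + 2)) * norm (radial_integral (t / \<delta>) (norm x / \<delta>) (2 powi k))"
  unfolding osc_I_eq(2)[OF assms] by (simp add: norm_mult)

text \<open>The majorant B depends on k but not on x, which is what a supremum inside the sum
  requires. It is the minimum of the trivial and the decay bound, growing in k and decaying in k or
  conversely.\<close>

lemma osc_I_sum_sup:
  assumes s: "((\<alpha> - 1) / 2 < s \<and> s < -2) \<or> ((\<alpha> - 1) / 2 > s \<and> s > -2)"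
  obtains C where "C > 0"
    "\<And>t \<delta>. t \<noteq> 0 \<Longrightarrow> \<delta> > 0 \<Longrightarrow> \<exists>B. (\<forall>k\<in>dyadic_range y1. \<forall>x. norm (osc_I g p s t \<delta> x k) \<le> B k) \<and>
      (\<forall>F. finite F \<and> F \<subseteq> dyadic_range y1 \<longrightarrow>
        sum B F \<le> C * (\<delta> powr (- ((\<alpha> + 1) * (s + 2) / (\<alpha> + 3))) / \<bar>t\<bar> powr (2 * (s + 2) / (\<alpha> + 3))))"
proof (rule radial_integral_trivial)
  fix C1 :: real
  assume C1: "C1 > 0" and triv: "\<And>R \<tau> X. R \<ge> 2 * y1 \<Longrightarrow> X \<ge> 0 \<Longrightarrow> norm (radial_integral \<tau> X R) \<le> C1 * R powr (s + 2)"
  show thesis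
  proof (rule radial_integral_decay)
    fix C2 :: real
    assume C2: "C2 > 0" and decay: "\<And>R \<tau> X. \<lbrakk>R \<ge> 2 * y1; X \<ge> 0; \<tau> \<noteq> 0\<rbrakk> \<Longrightarrow>
        norm (radial_integral \<tau> X R) \<le> C2 * R powr (s - (\<alpha> - 1) / 2) / \<bar>\<tau>\<bar>"
    let ?a = "s + 2" and ?b = "s - (\<alpha> - 1) / 2"
    have ab: "?a * ?b < 0" using s by (auto simp: mult_less_0_iff)
    have ba: "?b - ?a = - (\<alpha> + 3) / 2" by (simp add: field_simps)
    \<comment> \<open>For \<alpha> = -3 the two exponents coincide and the hypothesis on s is
      empty.\<close>
    have \<alpha>3: "\<alpha> + 3 \<noteq> 0" using s by auto
    define e where "e = 2 * (s + 2) / (\<alpha> + 3)"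
    have e: "- ?a / (?b - ?a) = e" unfolding ba e_def using \<alpha>3 by (simp add: field_simps)
    show thesis
    proof (rule sum_min_powr_le[OF ab])
      fix C3 :: real
      assume C3: "C3 > 0" and sm: "\<And>A B F. A > 0 \<Longrightarrow> B > 0 \<Longrightarrow> finite F \<Longrightarrow>
        (\<Sum>k\<in>F. min (A * 2 powr (real_of_int k * ?a)) (B * 2 powr (real_of_int k * ?b)))
          \<le> C3 * (A powr (?b / (?b - ?a)) * B powr (- ?a / (?b - ?a)))"
      let ?C = "C3 * C1 powr (?b / (?b - ?a)) * C2 powr e"
      show thesis
      proof (rule that[of ?C])
        show "?C > 0" using C1 C2 C3 by simp
        fix t \<delta> :: real assume t: "t \<noteq> 0" and \<delta>: "\<delta> > 0"
        define \<tau> where "\<tau> = t / \<delta>"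
        have \<tau>: "\<tau> \<noteq> 0" using t \<delta> by (simp add: \<tau>_def)
        define B where "B k = \<delta> powr (- (s + 2)) * min (C1 * 2 powr (real_of_int k * ?a)) (C2 / \<bar>\<tau>\<bar> * 2 powr (real_of_int k * ?b))" for k
        have "norm (osc_I g p s t \<delta> x k) \<le> B k" if "k \<in> dyadic_range y1" for k x
        proof -
          have X: "norm x / \<delta> \<ge> 0" using \<delta> by simp
          have "norm (radial_integral \<tau> (norm x / \<delta>) (2 powi k)) \<le> min (C1 * 2 powr (real_of_int k * ?a)) (C2 / \<bar>\<tau>\<bar> * 2 powr (real_of_int k * ?b))"
            using triv[OF dyadic_rangeD[OF that] X, of \<tau>] decay[OF dyadic_rangeD[OF that] X \<tau>]
            unfolding two_powi_powr by simp
          then show ?thesis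
            unfolding norm_osc_I[OF \<delta>] B_def \<tau>_def[symmetric] by (intro mult_left_mono) auto
        qed
        moreover have "sum B F \<le> ?C * (\<delta> powr (- ((\<alpha> + 1) * (s + 2) / (\<alpha> + 3))) / \<bar>t\<bar> powr (2 * (s + 2) / (\<alpha> + 3)))"
          if "finite F" for F
        proof -
          have "sum B F = \<delta> powr (- (s + 2)) * (\<Sum>k\<in>F. min (C1 * 2 powr (real_of_int k * ?a)) (C2 / \<bar>\<tau>\<bar> * 2 powr (real_of_int k * ?b)))"
            by (simp add: B_def sum_distrib_left)
          also have "\<dots> \<le> \<delta> powr (- (s + 2)) * (C3 * (C1 powr (?b / (?b - ?a)) * (C2 / \<bar>\<tau>\<bar>) powr (- ?a / (?b - ?a))))"
            using C1 C2 \<tau> that by (intro mult_left_mono sm) auto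
          also have "(C2 / \<bar>\<tau>\<bar>) powr (- ?a / (?b - ?a)) = C2 powr e * (\<delta> powr e / \<bar>t\<bar> powr e)"
            unfolding e \<tau>_def using \<delta> C2 by (simp add: abs_div powr_divide powr_mult)
          also have "\<delta> powr (- (s + 2)) * (C3 * (C1 powr (?b / (?b - ?a)) * (C2 powr e * (\<delta> powr e / \<bar>t\<bar> powr e))))
              = ?C * ((\<delta> powr (- (s + 2)) * \<delta> powr e) / \<bar>t\<bar> powr e)"
            by (simp add: mult_ac)
          \<comment> \<open>The rescaling contributes -(s+2), and \<tau> = t / \<delta> contributes
            2 (s+2) / (\<alpha>+3).\<close>
          also have "\<delta> powr (- (s + 2)) * \<delta> powr e = \<delta> powr (- ((\<alpha> + 1) * (s + 2) / (\<alpha> + 3)))"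
            unfolding powr_add[symmetric] e_def
            by (rule arg_cong[where f="(powr) \<delta>"]) (use \<alpha>3 in \<open>simp add: divide_simps, simp add: algebra_simps\<close>)
          finally show ?thesis unfolding e_def .
        qed
        ultimately show "\<exists>B. (\<forall>k\<in>dyadic_range y1. \<forall>x. norm (osc_I g p s t \<delta> x k) \<le> B k) \<and>
          (\<forall>F. finite F \<and> F \<subseteq> dyadic_range y1 \<longrightarrow>
            sum B F \<le> ?C * (\<delta> powr (- ((\<alpha> + 1) * (s + 2) / (\<alpha> + 3))) / \<bar>t\<bar> powr (2 * (s + 2) / (\<alpha> + 3))))"
          by blast
      qed
    qed
  qed
qed

text \<open>Each of the three summands of the critical bound is summed separately. The sums are
  bounded independently of \<tau> and X although their peaks are not located independently of them,
  so x has to be fixed before summing.\<close>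

lemma osc_I_sum_critical:
  fixes l Lam :: real
  assumes s: "s = (\<alpha> - 1) / 2" and \<alpha>2: "\<alpha> \<noteq> -2"
    and Lam: "Lam > 0"
    and near: "\<And>y. y \<ge> y1 \<Longrightarrow> lam * y powr (\<alpha> + 1) \<le> \<bar>g1 y - l\<bar> \<and> \<bar>g1 y - l\<bar> \<le> Lam * y powr (\<alpha> + 1)"
  obtains C where "C > 0"
    "\<And>t \<delta> x F. \<lbrakk>t \<noteq> 0; \<delta> > 0; finite F; F \<subseteq> dyadic_range y1\<rbrakk> \<Longrightarrow>
      (\<Sum>k\<in>F. norm (osc_I g p s t \<delta> x k)) \<le> C * (\<delta> powr (- ((\<alpha> + 1) / 2)) / \<bar>t\<bar>)"
proof (rule radial_integral_critical[OF s Lam near])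
  fix C0 :: real
  assume C0: "C0 > 0"
    and crit: "\<And>R \<tau> X. \<lbrakk>R \<ge> 2 * y1; X \<ge> 0; \<tau> \<noteq> 0\<rbrakk> \<Longrightarrow> norm (radial_integral \<tau> X R) \<le> C0 / \<bar>\<tau>\<bar> *
       (R powr ((\<alpha> + 1) / 2)
        + min (\<bar>\<tau>\<bar> powr (1/2) * R powr ((\<alpha> + 2) / 2)) (\<bar>\<tau>\<bar> powr (-1/2) * R powr (- (\<alpha> + 2) / 2))
        + (\<Sum>\<sigma>\<in>{1,-1}. if l + \<sigma> * X / \<tau> = 0 then 0
             else min (1 / \<bar>l + \<sigma> * X / \<tau>\<bar> * R powr (\<alpha> + 1)) (\<bar>l + \<sigma> * X / \<tau>\<bar> * R powr (- (\<alpha> + 1)))))"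
  have a1: "(\<alpha> + 1) / 2 \<noteq> 0" and a2: "(\<alpha> + 2) / 2 \<noteq> 0" and a3: "\<alpha> + 1 \<noteq> 0"
    using \<alpha> \<alpha>2 by auto
  obtain N1 where N1: "N1 > 0" "\<And>A F. A > 0 \<Longrightarrow> finite F \<Longrightarrow>
      (\<Sum>k\<in>F. min (A * 2 powr (real_of_int k * ((\<alpha> + 1) / 2))) (1 / A * 2 powr (real_of_int k * - ((\<alpha> + 1) / 2)))) \<le> N1"
    using sum_min_powr_sym_le[OF a1] by blast
  obtain N2 where N2: "N2 > 0" "\<And>A F. A > 0 \<Longrightarrow> finite F \<Longrightarrow>
      (\<Sum>k\<in>F. min (A * 2 powr (real_of_int k * ((\<alpha> + 2) / 2))) (1 / A * 2 powr (real_of_int k * - ((\<alpha> + 2) / 2)))) \<le> N2"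
    using sum_min_powr_sym_le[OF a2] by blast
  obtain N3 where N3: "N3 > 0" "\<And>A F. A > 0 \<Longrightarrow> finite F \<Longrightarrow>
      (\<Sum>k\<in>F. min (A * 2 powr (real_of_int k * (\<alpha> + 1))) (1 / A * 2 powr (real_of_int k * - (\<alpha> + 1)))) \<le> N3"
    using sum_min_powr_sym_le[OF a3] by blast
  define M where "M = (2 * y1) powr ((\<alpha> + 1) / 2)"
  have M: "M > 0" using y1 by (simp add: M_def)
  let ?N = "M * N1 + N2 + (N3 + N3)"
  show thesis
  proof (rule that[of "C0 * ?N"])
    show "C0 * ?N > 0" using C0 M N1(1) N2(1) N3(1) by (intro mult_pos_pos add_pos_pos)
    fix t \<delta> :: real and x :: "real^2" and F :: "int set"
    assume t: "t \<noteq> 0" and \<delta>: "\<delta> > 0" and F: "finite F" "F \<subseteq> dyadic_range y1"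
    define \<tau> where "\<tau> = t / \<delta>"
    define X where "X = norm x / \<delta>"
    have \<tau>: "\<tau> \<noteq> 0" using t \<delta> by (simp add: \<tau>_def)
    have X: "X \<ge> 0" using \<delta> by (simp add: X_def)
    define m where "m \<sigma> = \<bar>l + \<sigma> * X / \<tau>\<bar>" for \<sigma>
    define T1 where "T1 k = (2 powi k :: real) powr ((\<alpha> + 1) / 2)" for k
    define T2 where "T2 k = min (\<bar>\<tau>\<bar> powr (1/2) * (2 powi k) powr ((\<alpha> + 2) / 2)) (\<bar>\<tau>\<bar> powr (-1/2) * (2 powi k) powr (- (\<alpha> + 2) / 2))" for k
    define T3 where "T3 \<sigma> k = (if l + \<sigma> * X / \<tau> = 0 then 0
             else min (1 / \<bar>l + \<sigma> * X / \<tau>\<bar> * (2 powi k) powr (\<alpha> + 1)) (\<bar>l + \<sigma> * X / \<tau>\<bar> * (2 powi k) powr (- (\<alpha> + 1))))" for \<sigma> k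
    have S1: "sum T1 F \<le> M * N1"
    proof -
      \<comment> \<open>A one-sided geometric sum is fitted to the two-sided lemma: since
        \<open>T1 k\<close> is at most M, the quotient \<open>T1 k / M\<close> is the smaller of
        itself and its inverse.\<close>
      have "T1 k \<le> M * min (1 / M * 2 powr (real_of_int k * ((\<alpha> + 1) / 2))) (1 / (1 / M) * 2 powr (real_of_int k * - ((\<alpha> + 1) / 2)))"
        if "k \<in> F" for k
      proof -
        have k: "2 * y1 \<le> 2 powi k" using that F(2) dyadic_rangeD by blast
        have le: "T1 k \<le> M"
          unfolding T1_def M_def using k y1 \<alpha> by (intro powr_mono2') auto
        have T1: "T1 k = 2 powr (real_of_int k * ((\<alpha> + 1) / 2))"
          unfolding T1_def two_powi_powr ..
        have T1i: "2 powr (real_of_int k * - ((\<alpha> + 1) / 2)) = 1 / T1 k"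
          unfolding T1 mult_minus_right by (simp only: powr_minus_divide)
        have T1p: "T1 k > 0" by (simp add: T1)
        have "T1 k * T1 k \<le> M * M" using le T1p by (intro mult_mono) auto
        then show ?thesis
          unfolding T1i T1[symmetric] using M T1p by (simp add: min_def field_simps)
      qed
      then have "sum T1 F \<le> (\<Sum>k\<in>F. M * min (1 / M * 2 powr (real_of_int k * ((\<alpha> + 1) / 2))) (1 / (1 / M) * 2 powr (real_of_int k * - ((\<alpha> + 1) / 2))))"
        by (rule sum_mono)
      also have "\<dots> \<le> M * N1"
        unfolding sum_distrib_left[symmetric] using M F by (intro mult_left_mono N1(2)) auto
      finally show ?thesis .
    qed
    have S2: "sum T2 F \<le> N2"
    proof -
      have "\<bar>\<tau>\<bar> powr (-1/2) = 1 / \<bar>\<tau>\<bar> powr (1/2)"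
        by (simp add: powr_minus_divide)
      then show ?thesis
        using N2(2)[of "\<bar>\<tau>\<bar> powr (1/2)", OF _ F(1)] \<tau> unfolding T2_def two_powi_powr minus_divide_left by simp
    qed
    \<comment> \<open>Here A is 1 / |l + \<sigma> X / \<tau>|, which may be arbitrarily large or
      small; the uniformity of N3 in A is essential.\<close>
    have S3: "sum (T3 \<sigma>) F \<le> N3" for \<sigma>
    proof (cases "l + \<sigma> * X / \<tau> = 0")
      case True
      then show ?thesis using N3(1) by (simp add: T3_def)
    next
      case False
      then show ?thesis
        using N3(2)[of "1 / \<bar>l + \<sigma> * X / \<tau>\<bar>", OF _ F(1)] unfolding T3_def two_powi_powr by simp
    qed
    have "(\<Sum>k\<in>F. norm (osc_I g p s t \<delta> x k)) = \<delta> powr (- (s + 2)) * (\<Sum>k\<in>F. norm (radial_integral \<tau> X (2 powi k)))"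
      unfolding norm_osc_I[OF \<delta>] \<tau>_def X_def by (simp add: sum_distrib_left)
    also have "(\<Sum>k\<in>F. norm (radial_integral \<tau> X (2 powi k))) \<le> (\<Sum>k\<in>F. C0 / \<bar>\<tau>\<bar> * (T1 k + T2 k + (T3 1 k + T3 (-1) k)))"
    proof (rule sum_mono)
      fix k assume "k \<in> F"
      then have k: "2 * y1 \<le> 2 powi k" using F(2) dyadic_rangeD by blast
      show "norm (radial_integral \<tau> X (2 powi k)) \<le> C0 / \<bar>\<tau>\<bar> * (T1 k + T2 k + (T3 1 k + T3 (-1) k))"
        using crit[OF k X \<tau>] unfolding T1_def T2_def T3_def by simp
    qed
    also have "\<dots> = C0 / \<bar>\<tau>\<bar> * (sum T1 F + sum T2 F + (sum (T3 1) F + sum (T3 (-1)) F))"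
      unfolding sum_distrib_left[symmetric] by (simp only: sum.distrib)
    also have "\<dots> \<le> C0 / \<bar>\<tau>\<bar> * ?N"
      using C0 S1 S2 S3[of 1] S3[of "-1"] by (intro mult_left_mono add_mono) auto
    finally have "(\<Sum>k\<in>F. norm (osc_I g p s t \<delta> x k)) \<le> \<delta> powr (- (s + 2)) * (C0 / \<bar>\<tau>\<bar> * ?N)"
      by (simp add: mult_left_mono)
    also have "\<dots> = C0 * ?N * ((\<delta> powr (- (s + 2)) * \<delta> powr 1) / \<bar>t\<bar>)"
      unfolding \<tau>_def using \<delta> by (simp add: abs_div)
    also have "\<delta> powr (- (s + 2)) * \<delta> powr 1 = \<delta> powr (- ((\<alpha> + 1) / 2))"
      unfolding powr_add[symmetric] s by (rule arg_cong[where f="(powr) \<delta>"]) (simp add: field_simps)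
    finally show "(\<Sum>k\<in>F. norm (osc_I g p s t \<delta> x k)) \<le> C0 * ?N * (\<delta> powr (- ((\<alpha> + 1) / 2)) / \<bar>t\<bar>)" .
  qed
qed

end

section \<open>Littlewood--Paley sums\<close>

text \<open>All Littlewood-Paley functions are dilates of Q_0, so their integrals are
  \<open>osc_I\<close> with Q_0 in the place of P.\<close>

lemma LP_Q_eq: "LP_Q \<phi>\<^sub>0 k = (\<lambda>y. LP_Q \<phi>\<^sub>0 0 (y / 2 powi k))"
proof
  fix y :: real
  have "(2::real) powi (- k - 1) = 2 powi (- 0 - 1) / 2 powi k"
    by (simp add: power_int_diff power_int_minus field_simps)
  then have "2 powi (- k - 1) * y = 2 powi (- 0 - 1) * (y / 2 powi k)" by simp
  moreover have "2 powi (- k) * y = 2 powi (- 0) * (y / 2 powi k)"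
    by (simp add: power_int_minus field_simps)
  ultimately show "LP_Q \<phi>\<^sub>0 k y = LP_Q \<phi>\<^sub>0 0 (y / 2 powi k)"
    unfolding LP_Q_def by (simp only:)
qed

lemma LP_piece_eq: "LP_piece g \<phi>\<^sub>0 s t \<delta> x k = osc_I g (LP_Q \<phi>\<^sub>0 0) s t \<delta> x k"
  unfolding LP_piece_def osc_I_def by (subst LP_Q_eq) simp

lemma osc_integrand_sum:
  "(\<Sum>k\<in>F. osc_integrand g (a k) s t \<delta> x \<xi>) = osc_integrand g (\<lambda>y. \<Sum>k\<in>F. a k y) s t \<delta> x \<xi>"
  by (simp add: osc_integrand_def sum_distrib_left sum_distrib_right of_real_sum)

lemma norm_osc_integrand: "norm (osc_integrand g a s t \<delta> x \<xi>) = \<bar>a (\<delta> * norm \<xi>)\<bar> * norm \<xi> powr s"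
  by (simp add: osc_integrand_eq norm_mult abs_mult)

text \<open>For y > 0 the support confines k to within distance 1 of log 2 y. At y = 0 every scale
  is evaluated at the same point, so finiteness rests on the value of Q there.\<close>

lemma finite_dyadic_support:
  fixes Q :: "real \<Rightarrow> real"
  assumes supp: "\<And>z. z > 0 \<Longrightarrow> z \<notin> {1/2..2} \<Longrightarrow> Q z = 0" and "y \<ge> 0" and "Q 0 = 0"
  shows "finite {k::int. Q (y / 2 powi k) \<noteq> 0}"
proof (cases "y = 0")
  case False
  then have y: "y > 0" using assms by simp
  have "{k::int. Q (y / 2 powi k) \<noteq> 0} \<subseteq> {\<lfloor>log 2 y\<rfloor> - 1..\<lceil>log 2 y\<rceil> + 1}"
  proof
    fix k :: int assume "k \<in> {k::int. Q (y / 2 powi k) \<noteq> 0}"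
    then have "y / 2 powi k \<in> {1/2..2}"
      using supp[of "y / 2 powi k"] y by auto
    then have "log 2 (1/2) \<le> log 2 (y / 2 powi k)" "log 2 (y / 2 powi k) \<le> log 2 2"
      using y by (auto simp del: log_eq_one)
    moreover have "log 2 (y / 2 powi k) = log 2 y - k"
      using y by (simp add: log_divide powr_real_of_int'[symmetric])
    moreover have "log 2 (1/2) = (-1::real)"
      by (simp add: log_divide)
    ultimately have "-1 \<le> log 2 y - k" "log 2 y - k \<le> 1" by simp_all
    then show "k \<in> {\<lfloor>log 2 y\<rfloor> - 1..\<lceil>log 2 y\<rceil> + 1}"
      by simp linarith
  qed
  then show ?thesis
    by (rule finite_subset) simp
qed (simp add: assms)

text \<open>When the summed amplitude is integrable, the finite partial sums are dominated by it because
  the dyadic cutoffs are nonnegative.\<close>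

lemma LP_integral_bound:
  fixes \<phi>\<^sub>0 Q0 :: "real \<Rightarrow> real"
  defines "Q0 \<equiv> LP_Q \<phi>\<^sub>0 0"
  assumes \<delta>: "\<delta> > 0"
    and Q_nonneg: "\<And>z. z \<ge> 0 \<Longrightarrow> Q0 z \<ge> 0"
    and supp: "\<And>z. z > 0 \<Longrightarrow> z \<notin> {1/2..2} \<Longrightarrow> Q0 z = 0"
    and int: "\<And>k::int. integrable lborel (osc_integrand g (\<lambda>y. Q0 (y / 2 powi k)) s t \<delta> x)"
    and bound: "\<And>F. finite F \<Longrightarrow> F \<subseteq> dyadic_range y\<^sub>1 \<Longrightarrow> (\<Sum>k\<in>F. norm (osc_I g Q0 s t \<delta> x k)) \<le> M"
  shows "LP_converges g \<phi>\<^sub>0 y\<^sub>1 s t \<delta> x" and "norm (LP_integral g \<phi>\<^sub>0 y\<^sub>1 s t \<delta> x) \<le> M"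
proof -
  let ?K = "dyadic_range y\<^sub>1"
  have piece: "LP_piece g \<phi>\<^sub>0 s t \<delta> x = osc_I g Q0 s t \<delta> x"
    unfolding Q0_def by (simp add: fun_eq_iff LP_piece_eq)
  have Q: "LP_Q \<phi>\<^sub>0 k y = Q0 (y / 2 powi k)" for k y
    unfolding Q0_def by (subst LP_Q_eq) simp
  \<comment> \<open>The pieces are absolutely summable whether or not the full integrand is
    integrable, so the second alternative of \<open>LP_converges\<close> always holds.\<close>
  have abs: "(\<lambda>k. norm (osc_I g Q0 s t \<delta> x k)) summable_on ?K"
    using bound by (intro nonneg_bdd_above_summable_on bdd_aboveI[of _ M]) auto
  then show "LP_converges g \<phi>\<^sub>0 y\<^sub>1 s t \<delta> x"
    unfolding LP_converges_def piece using abs_summable_summable by blast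
  show "norm (LP_integral g \<phi>\<^sub>0 y\<^sub>1 s t \<delta> x) \<le> M"
  proof (cases "integrable lborel (LP_integrand g \<phi>\<^sub>0 y\<^sub>1 s t \<delta> x)")
    case False
    then have "norm (LP_integral g \<phi>\<^sub>0 y\<^sub>1 s t \<delta> x) = norm (\<Sum>\<^sub>\<infinity>k\<in>?K. osc_I g Q0 s t \<delta> x k)"
      by (simp add: LP_integral_def piece)
    also have "\<dots> \<le> (\<Sum>\<^sub>\<infinity>k\<in>?K. norm (osc_I g Q0 s t \<delta> x k))"
      by (rule norm_infsum_bound[OF abs])
    also have "\<dots> \<le> M"
      by (rule infsum_le_finite_sums[OF abs bound])
    finally show ?thesis .
  next
    case True
    \<comment> \<open>Truncation to |k| \<le> n. For fixed y \<ge> 0 only finitely many scales are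
      active, so the truncated amplitude equals the full one from some n on.\<close>
    define F where "F n = ?K \<inter> {- int n..int n}" for n
    have F: "finite (F n)" "F n \<subseteq> ?K" for n by (auto simp: F_def)
    define A where "A y = (\<Sum>\<^sub>\<infinity>k\<in>?K. Q0 (y / 2 powi k))" for y
    define S where "S n y = (\<Sum>k\<in>F n. Q0 (y / 2 powi k))" for n y
    have LPA: "LP_integrand g \<phi>\<^sub>0 y\<^sub>1 s t \<delta> x = osc_integrand g A s t \<delta> x"
      unfolding LP_integrand_def A_def Q ..
    have fin: "finite {k::int. Q0 (y / 2 powi k) \<noteq> 0}" if "y \<ge> 0" for y
      by (rule finite_dyadic_support[OF supp that]) (simp_all add: Q0_def LP_Q_def)
    have A_sum: "A y = sum (\<lambda>k. Q0 (y / 2 powi k)) G"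
      if "y \<ge> 0" "finite G" "G \<subseteq> ?K" "{k \<in> ?K. Q0 (y / 2 powi k) \<noteq> 0} \<subseteq> G" for y G
    proof -
      have "A y = (\<Sum>\<^sub>\<infinity>k\<in>G. Q0 (y / 2 powi k))"
        unfolding A_def using that by (intro infsum_cong_neutral) auto
      then show ?thesis using that by simp
    qed
    have SA: "S n y \<le> A y" "0 \<le> S n y" if "y \<ge> 0" for n y
    proof -
      \<comment> \<open>Adding the active scales outside the truncation gives \<open>A y\<close>
        exactly, and the added terms are nonnegative.\<close>
      let ?G = "F n \<union> {k \<in> ?K. Q0 (y / 2 powi k) \<noteq> 0}"
      have "finite ?G" using F fin[OF that] by (auto intro: finite_subset[OF _ fin[OF that]])
      moreover have nn: "Q0 (y / 2 powi k) \<ge> 0" for k :: int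
        using that by (intro Q_nonneg) simp
      ultimately have "S n y \<le> sum (\<lambda>k. Q0 (y / 2 powi k)) ?G"
        unfolding S_def by (intro sum_mono2) auto
      also have "\<dots> = A y"
        using \<open>finite ?G\<close> F(2)[of n] by (intro A_sum[OF that, symmetric]) auto
      finally show "S n y \<le> A y" .
      show "0 \<le> S n y" unfolding S_def using nn by (intro sum_nonneg)
    qed
    have conv: "(\<lambda>n. S n y) \<longlonglongrightarrow> A y" if "y \<ge> 0" for y
    proof (rule tendsto_eventually)
      let ?G = "{k \<in> ?K. Q0 (y / 2 powi k) \<noteq> 0}"
      have fG: "finite ?G" by (rule finite_subset[OF _ fin[OF that]]) auto
      obtain N where N: "\<And>k. k \<in> ?G \<Longrightarrow> nat \<bar>k\<bar> \<le> N"
        using finite_nat_set_iff_bounded_le[of "(\<lambda>k. nat \<bar>k\<bar>) ` ?G"] fG by auto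
      have "S n y = A y" if "n \<ge> N" for n
      proof -
        have "?G \<subseteq> F n"
          using N that unfolding F_def by fastforce
        then show ?thesis
          unfolding S_def using A_sum[OF \<open>y \<ge> 0\<close> F, of n] by simp
      qed
      then show "\<forall>\<^sub>F n in sequentially. S n y = A y"
        unfolding eventually_sequentially by blast
    qed
    have intS: "integrable lborel (osc_integrand g (S n) s t \<delta> x)"
      and LS: "(LINT \<xi>|lborel. osc_integrand g (S n) s t \<delta> x \<xi>) = (\<Sum>k\<in>F n. osc_I g Q0 s t \<delta> x k)" for n
    proof -
      have eq: "osc_integrand g (S n) s t \<delta> x
          = (\<lambda>\<xi>. \<Sum>k\<in>F n. osc_integrand g (\<lambda>y. Q0 (y / 2 powi k)) s t \<delta> x \<xi>)"
        unfolding osc_integrand_sum S_def[abs_def] ..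
      show "integrable lborel (osc_integrand g (S n) s t \<delta> x)"
        unfolding eq by (intro Bochner_Integration.integrable_sum int)
      show "(LINT \<xi>|lborel. osc_integrand g (S n) s t \<delta> x \<xi>) = (\<Sum>k\<in>F n. osc_I g Q0 s t \<delta> x k)"
        unfolding eq osc_I_def by (intro Bochner_Integration.integral_sum int)
    qed
    have "(\<lambda>n. LINT \<xi>|lborel. osc_integrand g (S n) s t \<delta> x \<xi>) \<longlonglongrightarrow> (LINT \<xi>|lborel. osc_integrand g A s t \<delta> x \<xi>)"
    proof (rule integral_dominated_convergence)
      show "integrable lborel (\<lambda>\<xi>. norm (osc_integrand g A s t \<delta> x \<xi>))"
        using True unfolding LPA by (rule integrable_norm)
      show "osc_integrand g A s t \<delta> x \<in> borel_measurable lborel"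
        using True unfolding LPA by (rule borel_measurable_integrable)
      show "osc_integrand g (S n) s t \<delta> x \<in> borel_measurable lborel" for n
        using intS by (rule borel_measurable_integrable)
      show "AE \<xi> in lborel. (\<lambda>n. osc_integrand g (S n) s t \<delta> x \<xi>) \<longlonglongrightarrow> osc_integrand g A s t \<delta> x \<xi>"
        unfolding osc_integrand_def using \<delta> by (intro AE_I2 tendsto_intros conv) simp
      show "AE \<xi> in lborel. norm (osc_integrand g (S n) s t \<delta> x \<xi>) \<le> norm (osc_integrand g A s t \<delta> x \<xi>)" for n
      proof (intro AE_I2)
        fix \<xi> :: "real^2"
        have "\<delta> * norm \<xi> \<ge> 0" using \<delta> by simp
        from SA[OF this, of n] show "norm (osc_integrand g (S n) s t \<delta> x \<xi>) \<le> norm (osc_integrand g A s t \<delta> x \<xi>)"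
          unfolding norm_osc_integrand by (intro mult_right_mono) auto
      qed
    qed
    then have lim: "(\<lambda>n. norm (\<Sum>k\<in>F n. osc_I g Q0 s t \<delta> x k)) \<longlonglongrightarrow> norm (LP_integral g \<phi>\<^sub>0 y\<^sub>1 s t \<delta> x)"
      unfolding LS LP_integral_def using True by (simp add: LPA tendsto_norm)
    have "norm (\<Sum>k\<in>F n. osc_I g Q0 s t \<delta> x k) \<le> M" for n
      by (rule order_trans[OF norm_sum bound[OF F]])
    then show ?thesis
      by (intro LIMSEQ_le_const2[OF lim]) auto
  qed
qed

lemma eq_0_outside_closure_support: "closure {y. f y \<noteq> 0} \<subseteq> S \<Longrightarrow> y \<notin> S \<Longrightarrow> f y = 0"
  using closure_subset[of "{y. f y \<noteq> 0}"] by blast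

text \<open>Transfers bounds on finite real sums to \<open>ennreal\<close>, where suprema over x and
  sums over k exist before their finiteness is known.\<close>

lemma infsum_ennreal_le:
  fixes f :: "'a \<Rightarrow> ennreal"
  assumes "\<And>k. k \<in> K \<Longrightarrow> f k \<le> ennreal (B k)" "\<And>k. k \<in> K \<Longrightarrow> B k \<ge> 0"
    and "\<And>F. finite F \<Longrightarrow> F \<subseteq> K \<Longrightarrow> sum B F \<le> M"
  shows "(\<Sum>\<^sub>\<infinity>k\<in>K. f k) \<le> ennreal M"
proof (rule infsum_le_finite_sums)
  fix F assume F: "finite F" "F \<subseteq> K"
  have "sum f F \<le> (\<Sum>k\<in>F. ennreal (B k))"
    using F assms(1) by (intro sum_mono) auto
  also have "\<dots> = ennreal (sum B F)"
    using F assms(2) by (intro sum_ennreal) auto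
  also have "\<dots> \<le> ennreal M"
    using assms(3)[OF F] by (rule ennreal_leI)
  finally show "sum f F \<le> ennreal M" .
next
  show "f summable_on K"
    by (rule nonneg_summable_on_complete) simp
qed

theorem lemma2p17:
  fixes P \<phi>\<^sub>0 g :: "real \<Rightarrow> real" and Lam lam y\<^sub>1 l \<alpha> :: real
  assumes P_smooth: "smooth_real P"
    and P_even: "\<And>y. P (- y) = P y"
    and P_supp: "closure {y. P y \<noteq> 0} \<subseteq> {-2 .. -1/2} \<union> {1/2 .. 2}"
    and phi_smooth: "smooth_real \<phi>\<^sub>0"
    and phi_nonneg: "\<And>y. \<phi>\<^sub>0 y \<ge> 0"
    and phi_even: "\<And>y. \<phi>\<^sub>0 (- y) = \<phi>\<^sub>0 y"
    and phi_supp: "closure {y. \<phi>\<^sub>0 y \<noteq> 0} \<subseteq> {-4/5 .. 4/5}"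
    and phi_one: "\<And>y. y \<in> {-3/5 .. 3/5} \<Longrightarrow> \<phi>\<^sub>0 y = 1"
    and phi_mono: "antimono_on {0..} \<phi>\<^sub>0"
    and pos: "Lam > 0" "lam > 0" "y\<^sub>1 > 0"
    and ell: "l \<noteq> 0"
    and alpha: "\<alpha> < -1"
    and g_C2: "C2_on {0<..} g"
    and g': "\<And>y. y \<ge> y\<^sub>1 \<Longrightarrow> \<bar>deriv g y\<bar> \<ge> lam"
    and g'': "\<And>y. y \<ge> y\<^sub>1 \<Longrightarrow> \<bar>deriv (deriv g) y\<bar> \<ge> lam * y powr \<alpha>"
  shows
    "(\<forall>s::real. ((\<alpha> - 1) / 2 < s \<and> s < -2) \<or> ((\<alpha> - 1) / 2 > s \<and> s > -2) \<longrightarrow>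
       (\<exists>C>0. \<forall>t \<delta>. t \<noteq> 0 \<and> \<delta> > 0 \<longrightarrow>
          (\<Sum>\<^sub>\<infinity>k\<in>dyadic_range y\<^sub>1. SUP x. ennreal (norm (osc_I g P s t \<delta> x k)))
            \<le> ennreal (C * (\<delta> powr (- ((\<alpha> + 1) * (s + 2) / (\<alpha> + 3)))
                               / \<bar>t\<bar> powr (2 * (s + 2) / (\<alpha> + 3)))) \<and>
          (\<forall>x. LP_converges g \<phi>\<^sub>0 y\<^sub>1 s t \<delta> x) \<and>
          (SUP x. ennreal (norm (LP_integral g \<phi>\<^sub>0 y\<^sub>1 s t \<delta> x)))
            \<le> ennreal (C * (\<delta> powr (- ((\<alpha> + 1) * (s + 2) / (\<alpha> + 3)))
                               / \<bar>t\<bar> powr (2 * (s + 2) / (\<alpha> + 3))))))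
     \<and>
     (\<alpha> \<noteq> -2 \<and>
      (\<forall>y\<ge>y\<^sub>1. lam * y powr (\<alpha> + 1) \<le> \<bar>deriv g y - l\<bar> \<and>
                \<bar>deriv g y - l\<bar> \<le> Lam * y powr (\<alpha> + 1)) \<longrightarrow>
       (\<exists>C>0. \<forall>t \<delta>. t \<noteq> 0 \<and> \<delta> > 0 \<longrightarrow>
          (SUP x. \<Sum>\<^sub>\<infinity>k\<in>dyadic_range y\<^sub>1. ennreal (norm (osc_I g P ((\<alpha> - 1) / 2) t \<delta> x k)))
            \<le> ennreal (C * (\<delta> powr (- ((\<alpha> + 1) / 2)) / \<bar>t\<bar>)) \<and>
          (\<forall>x. LP_converges g \<phi>\<^sub>0 y\<^sub>1 ((\<alpha> - 1) / 2) t \<delta> x) \<and>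
          (SUP x. ennreal (norm (LP_integral g \<phi>\<^sub>0 y\<^sub>1 ((\<alpha> - 1) / 2) t \<delta> x)))
            \<le> ennreal (C * (\<delta> powr (- ((\<alpha> + 1) / 2)) / \<bar>t\<bar>))))"
proof -
  have g1: "(g has_real_derivative deriv g y) (at y)"
    and g2: "(deriv g has_real_derivative deriv (deriv g) y) (at y)" if "y > 0" for y
    using g_C2 that by (auto simp: C2_on_def field_differentiable_derivI)
  have cont_g2: "continuous_on {0<..} (deriv (deriv g))"
    using g_C2 by (simp add: C2_on_def)
  have smooth: "(f has_real_derivative deriv f y) (at y)" "continuous_on UNIV (deriv f)"
    if "smooth_real f" for f y
  proof -
    have f: "(deriv ^^ n) f field_differentiable at y" for n y
      using that by (simp add: smooth_real_def)
    show "(f has_real_derivative deriv f y) (at y)"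
      using f[of 0 y] by (simp add: field_differentiable_derivI)
    show "continuous_on UNIV (deriv f)"
      using f[of 1] by (intro continuous_at_imp_continuous_on ballI field_differentiable_imp_continuous_at) simp
  qed
  have P0: "P y = 0" if "y > 0" "y \<notin> {1/2..2}" for y
    using that by (intro eq_0_outside_closure_support[OF P_supp]) auto
  define Q where "Q = LP_Q \<phi>\<^sub>0 0"
  have Q_eq: "Q y = \<phi>\<^sub>0 (y / 2) - \<phi>\<^sub>0 y" for y
    by (simp add: Q_def LP_Q_def power_int_minus field_simps)
  define Q' where "Q' y = deriv \<phi>\<^sub>0 (y / 2) * (1 / 2) - deriv \<phi>\<^sub>0 y" for y
  have Q': "(Q has_real_derivative Q' y) (at y)" for y
    unfolding Q_eq[abs_def] Q'_def
    by (intro DERIV_diff DERIV_chain2[OF smooth(1)[OF phi_smooth]] smooth(1)[OF phi_smooth])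
      (auto intro!: derivative_eq_intros)
  have cQ': "continuous_on UNIV Q'"
    unfolding Q'_def[abs_def]
    by (intro continuous_intros continuous_on_compose2[OF smooth(2)[OF phi_smooth]]) auto
  have phi_0: "\<phi>\<^sub>0 y = 0" if "y > 4/5" for y
    using that by (intro eq_0_outside_closure_support[OF phi_supp]) auto
  \<comment> \<open>Below 1/2 both y and y/2 lie where \<phi>_0 is 1; above 2 both exceed 4/5, where
    \<phi>_0 is 0.\<close>
  have Q0: "Q y = 0" if "y > 0" "y \<notin> {1/2..2}" for y
  proof (cases "y < 1/2")
    case True
    then show ?thesis using that by (simp add: Q_eq phi_one)
  next
    case False
    then show ?thesis using that by (simp add: Q_eq phi_0)
  qed
  \<comment> \<open>The monotonicity of \<phi>_0 enters here: it provides the sign on which the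
    domination of the partial sums relies.\<close>
  have Q_nonneg: "Q y \<ge> 0" if "y \<ge> 0" for y
    using monotone_onD[OF phi_mono, of "y / 2" y] that by (simp add: Q_eq)
  \<comment> \<open>The locale puts no assumption on s, so its predicate does not mention s and one
    instance serves every exponent.\<close>
  have oscP: "dyadic_oscillation g (deriv g) (deriv (deriv g)) P (deriv P) lam y\<^sub>1 \<alpha>"
    using pos alpha g1 g2 cont_g2 g' g'' smooth[OF P_smooth] P0 by unfold_locales auto
  have oscQ: "dyadic_oscillation g (deriv g) (deriv (deriv g)) Q Q' lam y\<^sub>1 \<alpha>"
    using pos alpha g1 g2 cont_g2 g' g'' Q' cQ' Q0 by unfold_locales auto
  note intQ = dyadic_oscillation.osc_I_eq(1)[OF oscQ]
  have LP: "LP_converges g \<phi>\<^sub>0 y\<^sub>1 s t \<delta> x \<and> norm (LP_integral g \<phi>\<^sub>0 y\<^sub>1 s t \<delta> x) \<le> M"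
    if "\<delta> > 0" "\<And>F. finite F \<Longrightarrow> F \<subseteq> dyadic_range y\<^sub>1 \<Longrightarrow> (\<Sum>k\<in>F. norm (osc_I g Q s t \<delta> x k)) \<le> M" for s t \<delta> x M
    using LP_integral_bound[where \<phi>\<^sub>0=\<phi>\<^sub>0, folded Q_def, OF that(1) Q_nonneg Q0 intQ[OF that(1)] that(2)] by blast
  show ?thesis
  proof (intro conjI allI impI)
    fix s :: real
    assume s: "((\<alpha> - 1) / 2 < s \<and> s < -2) \<or> ((\<alpha> - 1) / 2 > s \<and> s > -2)"
    let ?\<Phi> = "\<lambda>t \<delta>. \<delta> powr (- ((\<alpha> + 1) * (s + 2) / (\<alpha> + 3))) / \<bar>t\<bar> powr (2 * (s + 2) / (\<alpha> + 3))"
    obtain C1 where C1: "C1 > 0"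
      "\<And>t \<delta>. t \<noteq> 0 \<Longrightarrow> \<delta> > 0 \<Longrightarrow> \<exists>B. (\<forall>k\<in>dyadic_range y\<^sub>1. \<forall>x. norm (osc_I g P s t \<delta> x k) \<le> B k) \<and>
        (\<forall>F. finite F \<and> F \<subseteq> dyadic_range y\<^sub>1 \<longrightarrow> sum B F \<le> C1 * ?\<Phi> t \<delta>)"
      by (rule dyadic_oscillation.osc_I_sum_sup[OF oscP s]) (rule that)
    obtain C2 where C2: "C2 > 0"
      "\<And>t \<delta>. t \<noteq> 0 \<Longrightarrow> \<delta> > 0 \<Longrightarrow> \<exists>B. (\<forall>k\<in>dyadic_range y\<^sub>1. \<forall>x. norm (osc_I g Q s t \<delta> x k) \<le> B k) \<and>
        (\<forall>F. finite F \<and> F \<subseteq> dyadic_range y\<^sub>1 \<longrightarrow> sum B F \<le> C2 * ?\<Phi> t \<delta>)"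
      by (rule dyadic_oscillation.osc_I_sum_sup[OF oscQ s]) (rule that)
    show "\<exists>C>0. \<forall>t \<delta>. t \<noteq> 0 \<and> \<delta> > 0 \<longrightarrow>
        (\<Sum>\<^sub>\<infinity>k\<in>dyadic_range y\<^sub>1. SUP x. ennreal (norm (osc_I g P s t \<delta> x k))) \<le> ennreal (C * ?\<Phi> t \<delta>) \<and>
        (\<forall>x. LP_converges g \<phi>\<^sub>0 y\<^sub>1 s t \<delta> x) \<and>
        (SUP x. ennreal (norm (LP_integral g \<phi>\<^sub>0 y\<^sub>1 s t \<delta> x))) \<le> ennreal (C * ?\<Phi> t \<delta>)"
    \<comment> \<open>One constant has to serve both the sum with P and the Littlewood-Paley
      integral, whose bounds come from different bumps.\<close>
    proof (intro exI[of _ "max C1 C2"] conjI allI impI)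
      show "max C1 C2 > 0" using C1 by simp
      fix t \<delta> :: real assume "t \<noteq> 0 \<and> \<delta> > 0"
      then have t: "t \<noteq> 0" and \<delta>: "\<delta> > 0" by auto
      have le: "C1 * ?\<Phi> t \<delta> \<le> max C1 C2 * ?\<Phi> t \<delta>" "C2 * ?\<Phi> t \<delta> \<le> max C1 C2 * ?\<Phi> t \<delta>"
        by (intro mult_right_mono; simp)+
      from C1(2)[OF t \<delta>] obtain B where
        "(\<forall>k\<in>dyadic_range y\<^sub>1. \<forall>x. norm (osc_I g P s t \<delta> x k) \<le> B k) \<and>
          (\<forall>F. finite F \<and> F \<subseteq> dyadic_range y\<^sub>1 \<longrightarrow> sum B F \<le> C1 * ?\<Phi> t \<delta>)" ..
      then have B: "k \<in> dyadic_range y\<^sub>1 \<Longrightarrow> norm (osc_I g P s t \<delta> x k) \<le> B k"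
        "finite F \<Longrightarrow> F \<subseteq> dyadic_range y\<^sub>1 \<Longrightarrow> sum B F \<le> C1 * ?\<Phi> t \<delta>" for k x F
        by simp_all
      show "(\<Sum>\<^sub>\<infinity>k\<in>dyadic_range y\<^sub>1. SUP x. ennreal (norm (osc_I g P s t \<delta> x k))) \<le> ennreal (max C1 C2 * ?\<Phi> t \<delta>)"
      proof (rule infsum_ennreal_le[where B=B])
        fix k assume k: "k \<in> dyadic_range y\<^sub>1"
        show "(SUP x. ennreal (norm (osc_I g P s t \<delta> x k))) \<le> ennreal (B k)"
          by (intro SUP_least ennreal_leI B(1) k)
        show "B k \<ge> 0" by (rule order_trans[OF norm_ge_zero B(1)[OF k, of 0]])
      next
        fix F assume "finite F" "F \<subseteq> dyadic_range y\<^sub>1"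
        then show "sum B F \<le> max C1 C2 * ?\<Phi> t \<delta>"
          by (intro order_trans[OF B(2) le(1)])
      qed
      from C2(2)[OF t \<delta>] obtain B' where
        "(\<forall>k\<in>dyadic_range y\<^sub>1. \<forall>x. norm (osc_I g Q s t \<delta> x k) \<le> B' k) \<and>
          (\<forall>F. finite F \<and> F \<subseteq> dyadic_range y\<^sub>1 \<longrightarrow> sum B' F \<le> C2 * ?\<Phi> t \<delta>)" ..
      then have B': "k \<in> dyadic_range y\<^sub>1 \<Longrightarrow> norm (osc_I g Q s t \<delta> x k) \<le> B' k"
        "finite F \<Longrightarrow> F \<subseteq> dyadic_range y\<^sub>1 \<Longrightarrow> sum B' F \<le> C2 * ?\<Phi> t \<delta>" for k x F
        by simp_all
      have sumQ: "(\<Sum>k\<in>F. norm (osc_I g Q s t \<delta> x k)) \<le> max C1 C2 * ?\<Phi> t \<delta>"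
        if F: "finite F" "F \<subseteq> dyadic_range y\<^sub>1" for F x
      proof -
        have "(\<Sum>k\<in>F. norm (osc_I g Q s t \<delta> x k)) \<le> sum B' F"
          using F by (intro sum_mono B'(1)) auto
        then show ?thesis using B'(2)[OF F] le(2) by linarith
      qed
      show "LP_converges g \<phi>\<^sub>0 y\<^sub>1 s t \<delta> x" for x
        by (rule LP[THEN conjunct1, OF \<delta> sumQ])
      show "(SUP x. ennreal (norm (LP_integral g \<phi>\<^sub>0 y\<^sub>1 s t \<delta> x))) \<le> ennreal (max C1 C2 * ?\<Phi> t \<delta>)"
        by (intro SUP_least ennreal_leI LP[THEN conjunct2, OF \<delta> sumQ])
    qed
  next
    assume "\<alpha> \<noteq> -2 \<and> (\<forall>y\<ge>y\<^sub>1. lam * y powr (\<alpha> + 1) \<le> \<bar>deriv g y - l\<bar> \<and> \<bar>deriv g y - l\<bar> \<le> Lam * y powr (\<alpha> + 1))"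
    then have \<alpha>2: "\<alpha> \<noteq> -2" and near: "\<And>y. y \<ge> y\<^sub>1 \<Longrightarrow> lam * y powr (\<alpha> + 1) \<le> \<bar>deriv g y - l\<bar> \<and> \<bar>deriv g y - l\<bar> \<le> Lam * y powr (\<alpha> + 1)"
      by auto
    let ?s = "(\<alpha> - 1) / 2"
    let ?\<Phi> = "\<lambda>t \<delta>. \<delta> powr (- ((\<alpha> + 1) / 2)) / \<bar>t\<bar>"
    obtain C1 where C1: "C1 > 0" "\<And>t \<delta> x F. \<lbrakk>t \<noteq> 0; \<delta> > 0; finite F; F \<subseteq> dyadic_range y\<^sub>1\<rbrakk> \<Longrightarrow>
        (\<Sum>k\<in>F. norm (osc_I g P ?s t \<delta> x k)) \<le> C1 * ?\<Phi> t \<delta>"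
      by (rule dyadic_oscillation.osc_I_sum_critical[OF oscP refl \<alpha>2 pos(1) near], assumption, rule that)
    obtain C2 where C2: "C2 > 0" "\<And>t \<delta> x F. \<lbrakk>t \<noteq> 0; \<delta> > 0; finite F; F \<subseteq> dyadic_range y\<^sub>1\<rbrakk> \<Longrightarrow>
        (\<Sum>k\<in>F. norm (osc_I g Q ?s t \<delta> x k)) \<le> C2 * ?\<Phi> t \<delta>"
      by (rule dyadic_oscillation.osc_I_sum_critical[OF oscQ refl \<alpha>2 pos(1) near], assumption, rule that)
    show "\<exists>C>0. \<forall>t \<delta>. t \<noteq> 0 \<and> \<delta> > 0 \<longrightarrow>
        (SUP x. \<Sum>\<^sub>\<infinity>k\<in>dyadic_range y\<^sub>1. ennreal (norm (osc_I g P ?s t \<delta> x k))) \<le> ennreal (C * ?\<Phi> t \<delta>) \<and>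
        (\<forall>x. LP_converges g \<phi>\<^sub>0 y\<^sub>1 ?s t \<delta> x) \<and>
        (SUP x. ennreal (norm (LP_integral g \<phi>\<^sub>0 y\<^sub>1 ?s t \<delta> x))) \<le> ennreal (C * ?\<Phi> t \<delta>)"
    proof (intro exI[of _ "max C1 C2"] conjI allI impI)
      show "max C1 C2 > 0" using C1 by simp
      fix t \<delta> :: real assume "t \<noteq> 0 \<and> \<delta> > 0"
      then have t: "t \<noteq> 0" and \<delta>: "\<delta> > 0" by auto
      have le: "C1 * ?\<Phi> t \<delta> \<le> max C1 C2 * ?\<Phi> t \<delta>" "C2 * ?\<Phi> t \<delta> \<le> max C1 C2 * ?\<Phi> t \<delta>"
        by (intro mult_right_mono; simp)+
      show "(SUP x. \<Sum>\<^sub>\<infinity>k\<in>dyadic_range y\<^sub>1. ennreal (norm (osc_I g P ?s t \<delta> x k))) \<le> ennreal (max C1 C2 * ?\<Phi> t \<delta>)"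
      proof (rule SUP_least)
        fix x :: "real^2"
        show "(\<Sum>\<^sub>\<infinity>k\<in>dyadic_range y\<^sub>1. ennreal (norm (osc_I g P ?s t \<delta> x k))) \<le> ennreal (max C1 C2 * ?\<Phi> t \<delta>)"
          by (rule infsum_ennreal_le[OF order_refl norm_ge_zero order_trans[OF C1(2)[OF t \<delta>] le(1)]])
      qed
      note sumQ = order_trans[OF C2(2)[OF t \<delta>] le(2)]
      show "LP_converges g \<phi>\<^sub>0 y\<^sub>1 ?s t \<delta> x" for x
        by (rule LP[THEN conjunct1, OF \<delta> sumQ])
      show "(SUP x. ennreal (norm (LP_integral g \<phi>\<^sub>0 y\<^sub>1 ?s t \<delta> x))) \<le> ennreal (max C1 C2 * ?\<Phi> t \<delta>)"
        by (intro SUP_least ennreal_leI LP[THEN conjunct2, OF \<delta> sumQ])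
    qed
  qed
qed

end
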